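(* Let $$\mathcal A=\begin{pmatrix}A&B^T\\-B&0\end{pmatrix},\qquad \mathcal B_D=\begin{pmatrix}A&0\\0&BD_A^{-1}B^T\end{pmatrix}^{-1}.$$ Then $\kappa(\mathcal B_D\mathcal A)\le\dfrac{\alpha}{\beta}$, where $\alpha,\beta>0$ are the continuity and inf-sup constants, with respect to the norm $|||\cdot|||$, of the bilinear form $\mathcal L(\bm w_h,p_h;\bm r_h,q_h)=a(\bm w_h,\bm r_h)+a^D(\bm D_hp_h,\bm r_h)+a^D(\bm D_hq_h,\bm w_h)$ on $\bm W_h\times Q_h$.
   Context: **Geometry.** Let $n\in\{2,3\}$. A fractured porous medium of rectangular type (fractures are line segments if $n=2$, flat surfaces if $n=3$) is decomposed by the fractures into $n$-dimensional subdomains $\Omega_i^n$, $i\in I^n$; fractures and their intersections are lower-dimensional subdomains $\Omega_i^d$, $i\in I^d$, $0\le d<n$. For $0\le d\le n-1$ and $i\in I^d$, $\Gamma_{ij}^d$ ($j\in J_i^d$) are the interfaces between $\Omega_i^d$ and the adjacent $(d+1)$-dimensional subdomains. Set $\Omega^d=\bigcup_i\Omega_i^d$, $\Gamma^d=\bigcup_i\bigcup_j\Gamma_{ij}^d$, $\Omega=\bigcup_{d=0}^n\Omega^d$, $\Gamma=\bigcup_{d=0}^{n-1}\Gamma^d$. The boundary splits disjointly as $\partial\Omega=\partial\Omega_D\cup\partial\Omega_N$ with $\partial\Omega_D$ of positive measure; $\partial\Omega_N^d$ is the part of $\partial\Omega_N$ on $\partial\Omega^d$; $\bm\nu$ is the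 outward unit normal. **Physical parameters.** The permeability $K$ (on $\Omega$) and normal permeability $K_{\bm\nu}$ (on $\Gamma$) are symmetric positive definite tensors bounded above and below; $\gamma>0$ on $\Gamma$ (distance from $\Gamma_{ij}^d$ to $\Omega_i^d$; the aperture for $d=n-1$). All are assumed constant on each subdomain/interface. **Spaces.** $\bm V^d=\{\bm v\in (L^2(\Omega^d))^d:\nabla\cdot\bm v\in L^2(\Omega^d),\ \bm v\cdot\bm\nu=0 \text{ on }\partial\Omega_N^d\}$ for $1\le d\le n$; $\bm V_0^d=\{\bm v\in\bm V^d:\bm v\cdot\bm\nu=0\text{ on }\Gamma^{d-1}\}$; $\Lambda^d=L^2(\Gamma^d)$ for $0\le d\le n-1$; $Q^d=L^2(\Omega^d)$ for $0\le d\le n$. On shape-regular simplicial triangulations $\mathcal T^d_\Omega$ of $\Omega^d$ and $\mathcal T^d_\Gamma$ of $\Gamma^d$ (maximal mesh size $h$), $\bm V_h^d\subset\bm V^d$ and $\bm V_{0h}^d\subset\bm V_0^d$ are lowest-order Raviart–Thomas spaces $\mathbb{RT}_0(\mathcal T_\Omega^d)$, $\Lambda_h^d=\mathbb P_0(\mathcal T_\Gamma^d)$ and $Q_h^d=\mathbb P_0(\mathcal T_\Omega^d)$ (piecewise constants). Put $\bm V_{0h}=\bigoplus_{d=1}^n\bm V_{0h}^d$, $\Lambda_h=\bigoplus_{d=0}^{n-1}\Lambda_h^d$, $Q_h=\bigoplus_{d=0}^nQ_h^d$, $\bm W_h=\bm V_{0h}\times\Lambda_h$. **Discrete extension.** $\widehat\Pi_h^d:\Lambda_h^d\to\bm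 V_h^{d+1}\cdot\bm\nu|_{\Gamma^d}$ is the $L^2$-projection, $(\widehat\Pi_h^d\mu-\mu,\bm v\cdot\bm\nu)_{L^2(\Gamma^d)}=0$ for all $\bm v\in\bm V_h^{d+1}$. $R_h^d:\Lambda_h^d\to\bm V_h^{d+1}$ is defined by $R_h^d\lambda\cdot\bm\nu=\widehat\Pi_h^d\lambda$ on $\Gamma^d$ and $0$ elsewhere (all other facet normal components vanish); $R_h=\bigoplus_{d=0}^{n-1}R_h^d$. **Forms.** $(\cdot,\cdot)_\Omega$, $(\cdot,\cdot)_\Gamma$ are the sums of the $L^2$ inner products over all subdomains, respectively interfaces, with the convention that flux components for $d=0$ and mortar components for $d=n$ are zero. The jump is $\llbracket\lambda\rrbracket|_{\Omega_i^d}=-\sum_{j\in J_i^d}\lambda_{ij}^d$, and $\bm D\cdot[\bm u,\lambda]=\nabla\cdot\bm u+\llbracket\lambda\rrbracket$. For $\bm w_h=[\bm u_{0h},\lambda_h]$, $\bm r_h=[\bm v_{0h},\mu_h]\in\bm W_h$, $q_h\in Q_h$: $$a(\bm w_h,\bm r_h)=(K^{-1}(\bm u_{0h}+R_h\lambda_h),\bm v_{0h}+R_h\mu_h)_\Omega+(\gamma K_{\bm\nu}^{-1}\lambda_h,\mu_h)_\Gamma,$$ $$b(\bm r_h,q_h)=-(q_h,\bm D\cdot[\bm v_{0h}+R_h\mu_h,\mu_h])_\Omega,$$ $$a^D(\bm w_h,\bm r_h)=(K^{-1}(\bm u_{0h}+R_h\lambda_h),\bm v_{0h}+R_h\mu_h)_{D,\Omega}+(\gamma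 K_{\bm\nu}^{-1}\lambda_h,\mu_h)_\Gamma,$$ where $$(K^{-1}\bm u,\bm v)_{D,\Omega}=\sum_{d=0}^n\sum_{T\in\mathcal T_\Omega^d}\sum_{f\in\partial T}(\bm u\cdot\bm\nu_f)(\bm v\cdot\bm\nu_f)(K^{-1}\bm\phi_f,\bm\phi_f)_T.$$ Here $f$ runs over the faces of the element $T$, $\bm\nu_f$ is the unit outer normal of $f$, and $\bm\phi_f\in\mathbb{RT}_0(T)$ is the basis function of face $f$ (so $\bm v|_T=\sum_f(\bm v\cdot\bm\nu_f)\bm\phi_f$ for $\bm v\in\mathbb{RT}_0(T)$). The discrete gradient $\bm D_h:Q_h\to\bm W_h$ is defined by $a^D(\bm D_hp_h,\bm r_h)=b(\bm r_h,p_h)$ for all $\bm r_h\in\bm W_h$. **Operators and norm.** With primes for dual spaces and $\langle\cdot,\cdot\rangle$ for duality pairings: $A:\bm W_h\to\bm W_h'$, $\langle A\bm w_h,\bm r_h\rangle=a(\bm w_h,\bm r_h)$; $D_A:\bm W_h\to\bm W_h'$, $\langle D_A\bm w_h,\bm r_h\rangle=a^D(\bm w_h,\bm r_h)$; $B:\bm W_h\to Q_h'$, $\langle B\bm r_h,q_h\rangle=b(\bm r_h,q_h)$, with transpose $B^T:Q_h\to\bm W_h'$. The norm is $|||(\bm r_h,q_h)|||^2=a(\bm r_h,\bm r_h)+a^D(\bm D_hq_h,\bm D_hq_h)$. **Constants.** $\alpha,\beta>0$ satisfy $|\mathcal L(x;y)|\le\alpha|||x|||\,|||y|||$ for all $x,y\in\bm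 W_h\times Q_h$ and $\inf_{y\ne0}\sup_{x\neq0}\mathcal L(x;y)/(|||x|||\,|||y|||)\ge\beta$. **Condition number.** For an invertible operator $T$ on $\bm W_h\times Q_h$, $\kappa(T)=\|T\|\,\|T^{-1}\|$, with operator norms induced by $|||\cdot|||$. *)

theory Defs
  imports "HOL-Analysis.Analysis" "HOL-Library.Function_Algebras"
begin

section \<open>Functions as a real vector space\<close>

instantiation "fun" :: (type, real_vector) real_vector
begin

definition scaleR_fun_def: "scaleR c f = (\<lambda>x. c *\<^sub>R f x)"

instance
  by standard (auto simp: scaleR_fun_def fun_eq_iff scaleR_add_right scaleR_add_left)

end

section \<open>Calculus on flat pieces\<close>

definition tangent :: "'a::euclidean_space set \<Rightarrow> 'a set" where
  "tangent S = span {x - y | x y. x \<in> S \<and> y \<in> S}"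

text \<open>Some orthonormal basis of a subspace, enumerated by \<open>{..<dim U}\<close>.\<close>

definition onb :: "'a::euclidean_space set \<Rightarrow> nat \<Rightarrow> 'a" where
  "onb U = (SOME e. (\<forall>k<dim U. \<forall>l<dim U. e k \<bullet> e l = (if k = l then 1 else 0)) \<and>
                    span (e ` {..<dim U}) = U)"

text \<open>Lebesgue measure of dimension \<open>dim (tangent S)\<close> on the affine hull of \<open>S\<close>: the image of the
  product Lebesgue measure under an isometric parametrization. Since Lebesgue measure is invariant
  under isometries, it does not depend on the chosen origin and basis. If \<open>S\<close> is a single point,
  this is the unit mass at that point.\<close>

definition flat_measure :: "'a::euclidean_space set \<Rightarrow> 'a measure" where
  "flat_measure S =
     (let A = affine hull S; U = tangent A in
      distr (\<Pi>\<^sub>M k\<in>{..<dim U}. lborel) borel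
            (\<lambda>y. (SOME p. p \<in> A) + (\<Sum>k<dim U. y k *\<^sub>R onb U k)))"

text \<open>Divergence along the subspace \<open>U\<close>, i.e. the trace of the derivative restricted to \<open>U\<close>.\<close>

definition flat_div :: "'a::euclidean_space set \<Rightarrow> ('a \<Rightarrow> 'a) \<Rightarrow> 'a \<Rightarrow> real" where
  "flat_div U g x = (\<Sum>k<dim U. vector_derivative (\<lambda>t. g (x + t *\<^sub>R onb U k)) (at 0) \<bullet> onb U k)"

section \<open>Local finite elements\<close>

definition outer_normal :: "'a::euclidean_space set \<Rightarrow> 'a set \<Rightarrow> 'a" where
  "outer_normal T f = (THE \<nu>. \<nu> \<in> tangent T \<and> norm \<nu> = 1 \<and> (\<forall>x\<in>f. \<forall>y\<in>T. \<nu> \<bullet> (y - x) \<le> 0))"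

text \<open>The local Raviart-Thomas space: tangential fields \<open>x \<mapsto> a + b x\<close> on the simplex \<open>T\<close>,
  extended by zero off \<open>T\<close> so that two elements are equal iff they agree on \<open>T\<close>.\<close>

definition RT0 :: "'a::euclidean_space set \<Rightarrow> ('a \<Rightarrow> 'a) set" where
  "RT0 T = {g. (\<exists>a b. \<forall>x\<in>T. g x = a + b *\<^sub>R x) \<and> (\<forall>x\<in>T. g x \<in> tangent T) \<and> (\<forall>x. x \<notin> T \<longrightarrow> g x = 0)}"

text \<open>Outward normal component on a facet of \<open>T\<close>. For fields in \<open>RT0 T\<close> it is constant
  on the facet, so any point of the facet may be used to evaluate it.\<close>

definition nflux :: "'a::euclidean_space set \<Rightarrow> 'a set \<Rightarrow> ('a \<Rightarrow> 'a) \<Rightarrow> real" where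
  "nflux T f g = g (SOME x. x \<in> f) \<bullet> outer_normal T f"

definition RT_basis :: "'a::euclidean_space set \<Rightarrow> 'a set \<Rightarrow> 'a \<Rightarrow> 'a" where
  "RT_basis T f = (THE g. g \<in> RT0 T \<and>
     (\<forall>f'. f' facet_of T \<longrightarrow> (\<forall>x\<in>f'. g x \<bullet> outer_normal T f' = (if f' = f then 1 else 0))))"

text \<open>Piecewise constants, as the \<open>L\<^sup>2\<close> representatives that vanish off the relative
  interiors of the elements.\<close>

definition P0 :: "'a::euclidean_space set set \<Rightarrow> ('a \<Rightarrow> real) set" where
  "P0 \<T> = {q. (\<forall>T\<in>\<T>. q constant_on rel_interior T) \<and>
               (\<forall>x. x \<notin> (\<Union>T\<in>\<T>. rel_interior T) \<longrightarrow> q x = 0)}"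

section \<open>Fractured porous media\<close>

text \<open>The \<open>i\<close>-th subdomain of dimension \<open>d\<close> is \<open>subdom M d i\<close>, for \<open>i \<in> subidx M d\<close>. The interfaces of this subdomain are
  indexed by \<open>j \<in> intidx M d i\<close>; geometrically each of them coincides with the subdomain itself and
  is one of its sides, determined by the index \<open>nbr M d i j\<close> of the adjacent subdomain of dimension
  \<open>d + 1\<close> and by the unit normal \<open>nrm M d i j\<close> pointing out of that subdomain. The permeability of
  a \<open>d\<close>-dimensional subdomain is a linear map on its tangent space, whereas the normal permeability
  is a scalar because normal fluxes are scalar. \<open>mesh\<close> and \<open>imesh\<close> are the
  triangulations of subdomains and interfaces, which need not match.\<close>

record ('a, 'i, 'j) medium =
  subidx :: "nat \<Rightarrow> 'i set"
  subdom :: "nat \<Rightarrow> 'i \<Rightarrow> 'a set"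
  intidx :: "nat \<Rightarrow> 'i \<Rightarrow> 'j set"
  nbr :: "nat \<Rightarrow> 'i \<Rightarrow> 'j \<Rightarrow> 'i"
  nrm :: "nat \<Rightarrow> 'i \<Rightarrow> 'j \<Rightarrow> 'a"
  bdD :: "'a set"
  bdN :: "'a set"
  perm :: "nat \<Rightarrow> 'i \<Rightarrow> 'a \<Rightarrow> 'a"
  nperm :: "nat \<Rightarrow> 'i \<Rightarrow> 'j \<Rightarrow> real"
  aper :: "nat \<Rightarrow> 'i \<Rightarrow> 'j \<Rightarrow> real"
  mesh :: "nat \<Rightarrow> 'i \<Rightarrow> 'a set set"
  imesh :: "nat \<Rightarrow> 'i \<Rightarrow> 'j \<Rightarrow> 'a set set"

type_synonym ('a, 'i) flux = "nat \<Rightarrow> 'i \<Rightarrow> 'a set \<Rightarrow> 'a \<Rightarrow> 'a"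
type_synonym ('a, 'i, 'j) mortar = "nat \<Rightarrow> 'i \<Rightarrow> 'j \<Rightarrow> 'a \<Rightarrow> real"
type_synonym ('a, 'i) pressure = "nat \<Rightarrow> 'i \<Rightarrow> 'a \<Rightarrow> real"

definition whole_domain :: "('a::euclidean_space, 'i, 'j) medium \<Rightarrow> 'a set" where
  "whole_domain M = (\<Union>d\<in>{..DIM('a)}. \<Union>i\<in>subidx M d. subdom M d i)"

definition is_side :: "('a::euclidean_space, 'i, 'j) medium \<Rightarrow> nat \<Rightarrow> 'i \<Rightarrow> 'i \<Rightarrow> 'a \<Rightarrow> bool" where
  "is_side M d i k \<nu> \<longleftrightarrow>
     norm \<nu> = 1 \<and> \<nu> \<in> tangent (subdom M (Suc d) k) \<and> (\<forall>\<tau>\<in>tangent (subdom M d i). \<nu> \<bullet> \<tau> = 0) \<and>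
     (\<forall>x\<in>subdom M d i. \<exists>\<epsilon>>0. \<forall>t\<in>{0<..<\<epsilon>}. x - t *\<^sub>R \<nu> \<in> subdom M (Suc d) k)"

text \<open>Flat, relatively open, connected subdomains; the boundary of each consists of subdomains of
  lower dimension and of parts of the outer boundary (third condition, which also contains the
  disjointness of the subdomains). As the outer boundary is contained in finitely many
  hyperplanes, positive measure of its Dirichlet part is tested on hyperplanes.\<close>

definition fractured_geometry :: "('a::euclidean_space, 'i, 'j) medium \<Rightarrow> bool" where
  "fractured_geometry M \<longleftrightarrow>
     (\<forall>d\<le>DIM('a). finite (subidx M d)) \<and> subidx M (DIM('a)) \<noteq> {} \<and>
     (\<forall>d\<le>DIM('a). \<forall>i\<in>subidx M d.
        aff_dim (subdom M d i) = int d \<and> connected (subdom M d i) \<and> bounded (subdom M d i) \<and>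
        openin (top_of_set (affine hull subdom M d i)) (subdom M d i)) \<and>
     (\<forall>d\<le>DIM('a). \<forall>e\<le>DIM('a). \<forall>i\<in>subidx M d. \<forall>k\<in>subidx M e.
        closure (subdom M d i) \<inter> subdom M e k \<noteq> {} \<longrightarrow> e < d \<or> (e = d \<and> k = i)) \<and>
     open (whole_domain M) \<and>
     (\<forall>d<DIM('a). \<forall>i\<in>subidx M d. finite (intidx M d i) \<and>
        bij_betw (\<lambda>j. (nbr M d i j, nrm M d i j)) (intidx M d i)
                 {(k, \<nu>). k \<in> subidx M (Suc d) \<and> is_side M d i k \<nu>}) \<and>
     frontier (whole_domain M) = bdD M \<union> bdN M \<and> bdD M \<inter> bdN M = {} \<and>
     (\<exists>H. affine H \<and> aff_dim H = int (DIM('a)) - 1 \<and> emeasure (flat_measure H) (bdD M \<inter> H) > 0)"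

definition admissible_parameters :: "('a::euclidean_space, 'i, 'j) medium \<Rightarrow> bool" where
  "admissible_parameters M \<longleftrightarrow>
     (\<exists>c>0. \<exists>C. \<forall>d\<in>{1..DIM('a)}. \<forall>i\<in>subidx M d.
        let U = tangent (subdom M d i); K = perm M d i in
        linear K \<and> K ` U \<subseteq> U \<and> (\<forall>x\<in>U. \<forall>y\<in>U. K x \<bullet> y = x \<bullet> K y) \<and>
        (\<forall>x\<in>U. c * (x \<bullet> x) \<le> K x \<bullet> x \<and> K x \<bullet> x \<le> C * (x \<bullet> x))) \<and>
     (\<exists>c>0. \<exists>C. \<forall>d<DIM('a). \<forall>i\<in>subidx M d. \<forall>j\<in>intidx M d i.
        c \<le> nperm M d i j \<and> nperm M d i j \<le> C) \<and>
     (\<forall>d<DIM('a). \<forall>i\<in>subidx M d. \<forall>j\<in>intidx M d i. aper M d i j > 0)"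

section \<open>Meshes\<close>

definition mesh_of :: "nat \<Rightarrow> 'a::euclidean_space set \<Rightarrow> 'a set set \<Rightarrow> bool" where
  "mesh_of d S \<T> \<longleftrightarrow> triangulation \<T> \<and> \<Union>\<T> = closure S \<and>
     (\<forall>T\<in>\<T>. (int d) simplex T \<and> rel_interior T \<subseteq> S)"

definition shape_regular :: "real \<Rightarrow> 'a::euclidean_space set set \<Rightarrow> bool" where
  "shape_regular \<sigma> \<T> \<longleftrightarrow>
     (\<forall>T\<in>\<T>. \<exists>z\<in>T. \<exists>r>0. cball z r \<inter> affine hull T \<subseteq> T \<and> diameter T \<le> \<sigma> * r)"

text \<open>The last condition says that the element facets resolve the geometry: a facet of a
  \<open>(d + 1)\<close>-dimensional mesh is interior, or lies on one subdomain of dimension \<open>d\<close>, or on the outer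
  boundary.\<close>

definition admissible_meshes :: "real \<Rightarrow> ('a::euclidean_space, 'i, 'j) medium \<Rightarrow> bool" where
  "admissible_meshes \<sigma> M \<longleftrightarrow>
     (\<forall>d\<le>DIM('a). \<forall>i\<in>subidx M d.
        mesh_of d (subdom M d i) (mesh M d i) \<and> shape_regular \<sigma> (mesh M d i)) \<and>
     (\<forall>d<DIM('a). \<forall>i\<in>subidx M d. \<forall>j\<in>intidx M d i.
        mesh_of d (subdom M d i) (imesh M d i j) \<and> shape_regular \<sigma> (imesh M d i j)) \<and>
     (\<forall>d<DIM('a). \<forall>k\<in>subidx M (Suc d). \<forall>T\<in>mesh M (Suc d) k. \<forall>f. f facet_of T \<longrightarrow>
        rel_interior f \<subseteq> subdom M (Suc d) k \<or>
        (\<exists>i\<in>subidx M d. rel_interior f \<subseteq> subdom M d i) \<or>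
        rel_interior f \<subseteq> frontier (whole_domain M))"

text \<open>\<open>f\<close> is a facet of the element \<open>T\<close>, and \<open>T\<close> touches the interface \<open>(d, i, j)\<close> along \<open>f\<close>.\<close>

definition on_interface ::
    "('a::euclidean_space, 'i, 'j) medium \<Rightarrow> nat \<Rightarrow> 'i \<Rightarrow> 'j \<Rightarrow> 'a set \<Rightarrow> 'a set \<Rightarrow> bool" where
  "on_interface M d i j T f \<longleftrightarrow>
     i \<in> subidx M d \<and> j \<in> intidx M d i \<and> T \<in> mesh M (Suc d) (nbr M d i j) \<and> f facet_of T \<and>
     rel_interior f \<subseteq> subdom M d i \<and> outer_normal T f = nrm M d i j"

section \<open>Discrete spaces\<close>

text \<open>Fields are stored elementwise, \<open>v i T\<close> being the restriction to the (closed) element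
  \<open>T\<close> of the mesh of the \<open>i\<close>-th subdomain, since they are two-valued on facets. The three conditions
  are: piecewise Raviart-Thomas, normal continuity across the facets interior to a subdomain
  (facets on a fracture are not interior, even if the same subdomain lies on both sides), and
  vanishing normal component on the Neumann boundary.\<close>

definition Vh :: "('a::euclidean_space, 'i, 'j) medium \<Rightarrow> nat \<Rightarrow> ('i \<Rightarrow> 'a set \<Rightarrow> 'a \<Rightarrow> 'a) set" where
  "Vh M d = {v.
     (\<forall>i T. if i \<in> subidx M d \<and> T \<in> mesh M d i then v i T \<in> RT0 T else v i T = 0) \<and>
     (\<forall>i\<in>subidx M d. \<forall>T\<in>mesh M d i. \<forall>T'\<in>mesh M d i. \<forall>f.
        T \<noteq> T' \<and> f facet_of T \<and> f facet_of T' \<and> rel_interior f \<subseteq> subdom M d i \<longrightarrow>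
        nflux T f (v i T) + nflux T' f (v i T') = 0) \<and>
     (\<forall>i\<in>subidx M d. \<forall>T\<in>mesh M d i. \<forall>f. f facet_of T \<longrightarrow>
        (AE x in flat_measure f. x \<in> f \<inter> bdN M \<longrightarrow> nflux T f (v i T) = 0))}"

text \<open>Only used for \<open>d \<ge> 1\<close>: the normal component vanishes on all \<open>(d - 1)\<close>-dimensional interfaces.\<close>

definition V0h_comp :: "('a::euclidean_space, 'i, 'j) medium \<Rightarrow> nat \<Rightarrow> ('i \<Rightarrow> 'a set \<Rightarrow> 'a \<Rightarrow> 'a) set" where
  "V0h_comp M d = {v \<in> Vh M d.
     \<forall>i j T f. on_interface M (d - 1) i j T f \<longrightarrow> nflux T f (v (nbr M (d - 1) i j) T) = 0}"

definition Lh_comp :: "('a::euclidean_space, 'i, 'j) medium \<Rightarrow> nat \<Rightarrow> ('i \<Rightarrow> 'j \<Rightarrow> 'a \<Rightarrow> real) set" where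
  "Lh_comp M d = {\<mu>. \<forall>i j. if i \<in> subidx M d \<and> j \<in> intidx M d i then \<mu> i j \<in> P0 (imesh M d i j)
                          else \<mu> i j = 0}"

definition Qh_comp :: "('a::euclidean_space, 'i, 'j) medium \<Rightarrow> nat \<Rightarrow> ('i \<Rightarrow> 'a \<Rightarrow> real) set" where
  "Qh_comp M d = {q. \<forall>i. if i \<in> subidx M d then q i \<in> P0 (mesh M d i) else q i = 0}"

definition V0h :: "('a::euclidean_space, 'i, 'j) medium \<Rightarrow> ('a, 'i) flux set" where
  "V0h M = {v. \<forall>d. if 1 \<le> d \<and> d \<le> DIM('a) then v d \<in> V0h_comp M d else v d = 0}"

definition Lh :: "('a::euclidean_space, 'i, 'j) medium \<Rightarrow> ('a, 'i, 'j) mortar set" where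
  "Lh M = {\<mu>. \<forall>d. if d < DIM('a) then \<mu> d \<in> Lh_comp M d else \<mu> d = 0}"

definition Qh :: "('a::euclidean_space, 'i, 'j) medium \<Rightarrow> ('a, 'i) pressure set" where
  "Qh M = {q. \<forall>d. if d \<le> DIM('a) then q d \<in> Qh_comp M d else q d = 0}"

definition Wh :: "('a::euclidean_space, 'i, 'j) medium \<Rightarrow> (('a, 'i) flux \<times> ('a, 'i, 'j) mortar) set" where
  "Wh M = V0h M \<times> Lh M"

definition Xh :: "('a::euclidean_space, 'i, 'j) medium \<Rightarrow>
    ((('a, 'i) flux \<times> ('a, 'i, 'j) mortar) \<times> ('a, 'i) pressure) set" where
  "Xh M = Wh M \<times> Qh M"

section \<open>Discrete extension\<close>

text \<open>Normal trace on the \<open>d\<close>-dimensional interfaces of \<open>v \<in> Vh M (d + 1)\<close>, vanishing off the relative interiors of the facets.\<close>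

definition ntrace :: "('a::euclidean_space, 'i, 'j) medium \<Rightarrow> nat \<Rightarrow>
    ('i \<Rightarrow> 'a set \<Rightarrow> 'a \<Rightarrow> 'a) \<Rightarrow> 'i \<Rightarrow> 'j \<Rightarrow> 'a \<Rightarrow> real" where
  "ntrace M d v i j x =
     (\<Sum>(T, f)\<in>{(T, f). on_interface M d i j T f}. indicator (rel_interior f) x * nflux T f (v (nbr M d i j) T))"

definition ip_Gamma :: "('a::euclidean_space, 'i, 'j) medium \<Rightarrow> nat \<Rightarrow>
    ('i \<Rightarrow> 'j \<Rightarrow> 'a \<Rightarrow> real) \<Rightarrow> ('i \<Rightarrow> 'j \<Rightarrow> 'a \<Rightarrow> real) \<Rightarrow> real" where
  "ip_Gamma M d \<eta> \<mu> = (\<Sum>i\<in>subidx M d. \<Sum>j\<in>intidx M d i.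
     (LINT x:subdom M d i|flat_measure (subdom M d i). \<eta> i j x * \<mu> i j x))"

definition Pihat :: "('a::euclidean_space, 'i, 'j) medium \<Rightarrow> nat \<Rightarrow>
    ('i \<Rightarrow> 'j \<Rightarrow> 'a \<Rightarrow> real) \<Rightarrow> 'i \<Rightarrow> 'j \<Rightarrow> 'a \<Rightarrow> real" where
  "Pihat M d \<mu> = (THE m. m \<in> ntrace M d ` Vh M (Suc d) \<and>
     (\<forall>v\<in>Vh M (Suc d). ip_Gamma M d (m - \<mu>) (ntrace M d v) = 0))"

definition Rh_comp :: "('a::euclidean_space, 'i, 'j) medium \<Rightarrow> nat \<Rightarrow>
    ('i \<Rightarrow> 'j \<Rightarrow> 'a \<Rightarrow> real) \<Rightarrow> 'i \<Rightarrow> 'a set \<Rightarrow> 'a \<Rightarrow> 'a" where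
  "Rh_comp M d \<mu> = (THE v. v \<in> Vh M (Suc d) \<and> ntrace M d v = Pihat M d \<mu> \<and>
     (\<forall>k\<in>subidx M (Suc d). \<forall>T\<in>mesh M (Suc d) k. \<forall>f.
        f facet_of T \<and> \<not> (\<exists>i j. on_interface M d i j T f) \<longrightarrow> nflux T f (v k T) = 0))"

definition Rh :: "('a::euclidean_space, 'i, 'j) medium \<Rightarrow> ('a, 'i, 'j) mortar \<Rightarrow> ('a, 'i) flux" where
  "Rh M \<mu> = (\<lambda>d. if 1 \<le> d \<and> d \<le> DIM('a) then Rh_comp M (d - 1) (\<mu> (d - 1)) else 0)"

section \<open>Forms\<close>

definition jump :: "('a::euclidean_space, 'i, 'j) medium \<Rightarrow> ('a, 'i, 'j) mortar \<Rightarrow> nat \<Rightarrow> 'i \<Rightarrow> 'a \<Rightarrow> real" where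
  "jump M \<mu> d i x = - (\<Sum>j\<in>intidx M d i. \<mu> d i j x)"

definition mdiv :: "('a::euclidean_space, 'i, 'j) medium \<Rightarrow>
    ('a, 'i) flux \<Rightarrow> ('a, 'i, 'j) mortar \<Rightarrow> nat \<Rightarrow> 'i \<Rightarrow> 'a \<Rightarrow> real" where
  "mdiv M u \<mu> d i x =
     (\<Sum>T\<in>mesh M d i. indicator (rel_interior T) x * flat_div (tangent T) (u d i T) x) +
     (if d < DIM('a) then jump M \<mu> d i x else 0)"

definition perm_inv :: "('a::euclidean_space, 'i, 'j) medium \<Rightarrow> nat \<Rightarrow> 'i \<Rightarrow> 'a \<Rightarrow> 'a" where
  "perm_inv M d i = inv_into (tangent (subdom M d i)) (perm M d i)"

definition ip_K :: "('a::euclidean_space, 'i, 'j) medium \<Rightarrow> ('a, 'i) flux \<Rightarrow> ('a, 'i) flux \<Rightarrow> real" where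
  "ip_K M u v = (\<Sum>d=1..DIM('a). \<Sum>i\<in>subidx M d. \<Sum>T\<in>mesh M d i.
     (LINT x:T|flat_measure T. perm_inv M d i (u d i T x) \<bullet> v d i T x))"

definition ip_KD :: "('a::euclidean_space, 'i, 'j) medium \<Rightarrow> ('a, 'i) flux \<Rightarrow> ('a, 'i) flux \<Rightarrow> real" where
  "ip_KD M u v = (\<Sum>d=0..DIM('a). \<Sum>i\<in>subidx M d. \<Sum>T\<in>mesh M d i. \<Sum>f\<in>{f. f facet_of T}.
     nflux T f (u d i T) * nflux T f (v d i T) *
     (LINT x:T|flat_measure T. perm_inv M d i (RT_basis T f x) \<bullet> RT_basis T f x))"

definition ip_mortar :: "('a::euclidean_space, 'i, 'j) medium \<Rightarrow>
    ('a, 'i, 'j) mortar \<Rightarrow> ('a, 'i, 'j) mortar \<Rightarrow> real" where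
  "ip_mortar M \<eta> \<mu> =
     (\<Sum>d<DIM('a). ip_Gamma M d (\<lambda>i j x. aper M d i j / nperm M d i j * \<eta> d i j x) (\<mu> d))"

type_synonym ('a, 'i, 'j) wvec = "('a, 'i) flux \<times> ('a, 'i, 'j) mortar"
type_synonym ('a, 'i, 'j) xvec = "('a, 'i, 'j) wvec \<times> ('a, 'i) pressure"

definition a_form :: "('a::euclidean_space, 'i, 'j) medium \<Rightarrow>
    ('a, 'i, 'j) wvec \<Rightarrow> ('a, 'i, 'j) wvec \<Rightarrow> real" where
  "a_form M w r = ip_K M (fst w + Rh M (snd w)) (fst r + Rh M (snd r)) + ip_mortar M (snd w) (snd r)"

definition aD_form :: "('a::euclidean_space, 'i, 'j) medium \<Rightarrow>
    ('a, 'i, 'j) wvec \<Rightarrow> ('a, 'i, 'j) wvec \<Rightarrow> real" where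
  "aD_form M w r = ip_KD M (fst w + Rh M (snd w)) (fst r + Rh M (snd r)) + ip_mortar M (snd w) (snd r)"

definition b_form :: "('a::euclidean_space, 'i, 'j) medium \<Rightarrow>
    ('a, 'i, 'j) wvec \<Rightarrow> ('a, 'i) pressure \<Rightarrow> real" where
  "b_form M r q = - (\<Sum>d=0..DIM('a). \<Sum>i\<in>subidx M d.
     (LINT x:subdom M d i|flat_measure (subdom M d i).
        q d i x * mdiv M (fst r + Rh M (snd r)) (snd r) d i x))"

definition Dh :: "('a::euclidean_space, 'i, 'j) medium \<Rightarrow> ('a, 'i) pressure \<Rightarrow> ('a, 'i, 'j) wvec" where
  "Dh M p = (THE w. w \<in> Wh M \<and> (\<forall>r\<in>Wh M. aD_form M w r = b_form M r p))"

definition L_form :: "('a::euclidean_space, 'i, 'j) medium \<Rightarrow>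
    ('a, 'i, 'j) xvec \<Rightarrow> ('a, 'i, 'j) xvec \<Rightarrow> real" where
  "L_form M = (\<lambda>(w, p) (r, q). a_form M w r + aD_form M (Dh M p) r + aD_form M (Dh M q) w)"

definition tnorm :: "('a::euclidean_space, 'i, 'j) medium \<Rightarrow> ('a, 'i, 'j) xvec \<Rightarrow> real" where
  "tnorm M = (\<lambda>(r, q). sqrt (a_form M r r + aD_form M (Dh M q) (Dh M q)))"

section \<open>Operators\<close>

text \<open>Functionals on a subspace \<open>S\<close> are represented by functions vanishing off \<open>S\<close>.\<close>

definition on_space :: "'v set \<Rightarrow> ('v \<Rightarrow> real) \<Rightarrow> 'v \<Rightarrow> real" where
  "on_space S F = (\<lambda>x. if x \<in> S then F x else 0)"

definition dual_space :: "'v::real_vector set \<Rightarrow> ('v \<Rightarrow> real) set" where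
  "dual_space S = {F. (\<forall>x\<in>S. \<forall>y\<in>S. F (x + y) = F x + F y) \<and>
                      (\<forall>c. \<forall>x\<in>S. F (c *\<^sub>R x) = c * F x) \<and> (\<forall>x. x \<notin> S \<longrightarrow> F x = 0)}"

definition A_op :: "('a::euclidean_space, 'i, 'j) medium \<Rightarrow>
    ('a, 'i, 'j) wvec \<Rightarrow> ('a, 'i, 'j) wvec \<Rightarrow> real" where
  "A_op M w = on_space (Wh M) (\<lambda>r. a_form M w r)"

definition DA_op :: "('a::euclidean_space, 'i, 'j) medium \<Rightarrow>
    ('a, 'i, 'j) wvec \<Rightarrow> ('a, 'i, 'j) wvec \<Rightarrow> real" where
  "DA_op M w = on_space (Wh M) (\<lambda>r. aD_form M w r)"

definition B_op :: "('a::euclidean_space, 'i, 'j) medium \<Rightarrow>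
    ('a, 'i, 'j) wvec \<Rightarrow> ('a, 'i) pressure \<Rightarrow> real" where
  "B_op M r = on_space (Qh M) (\<lambda>q. b_form M r q)"

definition BT_op :: "('a::euclidean_space, 'i, 'j) medium \<Rightarrow>
    ('a, 'i) pressure \<Rightarrow> ('a, 'i, 'j) wvec \<Rightarrow> real" where
  "BT_op M q = on_space (Wh M) (\<lambda>r. B_op M r q)"

definition DA_inv :: "('a::euclidean_space, 'i, 'j) medium \<Rightarrow>
    (('a, 'i, 'j) wvec \<Rightarrow> real) \<Rightarrow> ('a, 'i, 'j) wvec" where
  "DA_inv M = inv_into (Wh M) (DA_op M)"

definition A_block :: "('a::euclidean_space, 'i, 'j) medium \<Rightarrow> ('a, 'i, 'j) xvec \<Rightarrow>
    (('a, 'i, 'j) wvec \<Rightarrow> real) \<times> (('a, 'i) pressure \<Rightarrow> real)" where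
  "A_block M = (\<lambda>(w, p). (A_op M w + BT_op M p, - B_op M w))"

definition diag_block :: "('a::euclidean_space, 'i, 'j) medium \<Rightarrow> ('a, 'i, 'j) xvec \<Rightarrow>
    (('a, 'i, 'j) wvec \<Rightarrow> real) \<times> (('a, 'i) pressure \<Rightarrow> real)" where
  "diag_block M = (\<lambda>(w, p). (A_op M w, B_op M (DA_inv M (BT_op M p))))"

definition B_D :: "('a::euclidean_space, 'i, 'j) medium \<Rightarrow>
    (('a, 'i, 'j) wvec \<Rightarrow> real) \<times> (('a, 'i) pressure \<Rightarrow> real) \<Rightarrow> ('a, 'i, 'j) xvec" where
  "B_D M = inv_into (Xh M) (diag_block M)"

text \<open>The vector \<open>0\<close> contributes the value \<open>0 / 0 = 0\<close> to the supremum.\<close>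

definition op_norm :: "('v \<Rightarrow> real) \<Rightarrow> 'v set \<Rightarrow> ('v \<Rightarrow> 'v) \<Rightarrow> real" where
  "op_norm N X T = (SUP x\<in>X. N (T x) / N x)"

definition cond_number :: "('v \<Rightarrow> real) \<Rightarrow> 'v set \<Rightarrow> ('v \<Rightarrow> 'v) \<Rightarrow> real" where
  "cond_number N X T = op_norm N X T * op_norm N X (inv_into X T)"

end

theory Submission
  imports Defs
begin

text \<open>Write \<open>T\<close> for the preconditioned operator and \<open>(x, y)\<close> for the symmetric form
\<open>a(w, r) + a\<^sup>D(D\<^sub>h p, D\<^sub>h q)\<close> of \<open>x = (w, p)\<close>, \<open>y = (r, q)\<close> (below: \<open>ipX\<close>), whose square root is
the norm. As \<open>D\<^sub>A\<close> maps \<open>D\<^sub>h p\<close> to \<open>B\<^sup>T p\<close>, and \<open>b(D\<^sub>h p, q) = a\<^sup>D(D\<^sub>h q, D\<^sub>h p)\<close>, the block diagonal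
operator is exactly the Riesz map of this form. Applying its inverse turns a functional into the
vector that represents it, so that
\<open>(T x, y) = a(w, r) + b(r, p) - b(w, q) = L(x; r, -q)\<close> (\<open>precond_op_form\<close>).

The sign change of the pressure is an isometry. Continuity of \<open>L\<close>, tested with \<open>y = T x\<close>, therefore
gives \<open>|||T x||| \<le> \<alpha> |||x|||\<close> (\<open>precond_op_upper\<close>). For the inverse, \<open>L\<close> is symmetric, so the inf-sup
condition bounds \<open>\<beta> |||y|||\<close> by the supremum over \<open>x\<close> of \<open>L(y; x) / |||x|||\<close>, and this is at most
\<open>|||T y|||\<close> by Cauchy-Schwarz (\<open>precond_op_lower\<close>). Hence \<open>\<kappa>(T) \<le> \<alpha> \<cdot> 1 / \<beta>\<close>.

For this argument the objects involved must have the properties that their names promise.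
\<^item> The extension \<open>R\<^sub>h\<close> and the gradient \<open>D\<^sub>h\<close> are defined by descriptions. Both are Riesz representatives:
  \<open>D\<^sub>h\<close> with respect to \<open>a\<^sup>D\<close>, and \<open>R\<^sub>h\<close> with respect to the pairing of normal traces on those
  Raviart-Thomas fields that have flux through interface facets only (\<open>Rh_comp_iff\<close>). Linearity follows.
\<^item> Definiteness of \<open>a\<^sup>D\<close> (\<open>inner_form_aD\<close>) rests on geometry: fluxes through facets determine a
  Raviart-Thomas field (\<open>RT0_unisolvent\<close>), basis fields vanish nowhere inside their simplex,
  and nonempty relatively open sets have positive measure.
\<^item> Definiteness of the norm, and with it definiteness of \<open>a\<close> and injectivity of \<open>B\<^sup>T\<close>, is extracted from
  the inf-sup condition: a vector of norm zero would make all its quotients zero (\<open>inner_form_ipX\<close>).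
\<^item> Surjectivity uses the Riesz theorem on finite-dimensional spaces. For \<open>T\<close> itself, symmetry of \<open>L\<close>
  shows that the adjoint of \<open>T\<close> is \<open>T\<close> conjugated with the pressure flip, hence injective
  like \<open>T\<close> (\<open>bij_precond_op\<close>).\<close>

section \<open>Positive forms on finite-dimensional spaces\<close>

text \<open>The spaces are subsets of types of functions, so linearity is relative to a carrier.\<close>

definition lin_on :: "'v::real_vector set \<Rightarrow> ('v \<Rightarrow> real) \<Rightarrow> bool" where
  "lin_on S F \<longleftrightarrow> (\<forall>x\<in>S. \<forall>y\<in>S. F (x + y) = F x + F y) \<and> (\<forall>c. \<forall>x\<in>S. F (c *\<^sub>R x) = c * F x)"

lemma lin_onI:
  assumes "\<And>x y. x \<in> S \<Longrightarrow> y \<in> S \<Longrightarrow> F (x + y) = F x + F y"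
    and "\<And>c x. x \<in> S \<Longrightarrow> F (c *\<^sub>R x) = c * F x"
  shows "lin_on S F"
  using assms by (auto simp: lin_on_def)

lemma lin_on_add: "lin_on S F \<Longrightarrow> x \<in> S \<Longrightarrow> y \<in> S \<Longrightarrow> F (x + y) = F x + F y"
  by (auto simp: lin_on_def)

lemma lin_on_scale: "lin_on S F \<Longrightarrow> x \<in> S \<Longrightarrow> F (c *\<^sub>R x) = c * F x"
  by (auto simp: lin_on_def)

lemma lin_on_zero: "lin_on S F \<Longrightarrow> subspace S \<Longrightarrow> F 0 = 0"
  using lin_on_scale[of S F 0 0] subspace_0[of S] by simp

lemma lin_on_diff: "lin_on S F \<Longrightarrow> subspace S \<Longrightarrow> x \<in> S \<Longrightarrow> y \<in> S \<Longrightarrow> F (x - y) = F x - F y"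
  using lin_on_add[of S F x "(-1) *\<^sub>R y"] lin_on_scale[of S F y "-1"] subspace_scale[of S y "-1"] by simp

lemma lin_on_subset: "lin_on S F \<Longrightarrow> S' \<subseteq> S \<Longrightarrow> lin_on S' F"
  by (simp add: lin_on_def subset_iff)

lemma dual_space_iff_lin_on: "F \<in> dual_space S \<longleftrightarrow> lin_on S F \<and> (\<forall>x. x \<notin> S \<longrightarrow> F x = 0)"
  by (auto simp: dual_space_def lin_on_def)

lemma on_space_in_dual: "subspace S \<Longrightarrow> lin_on S F \<Longrightarrow> on_space S F \<in> dual_space S"
  by (auto simp: dual_space_def lin_on_def on_space_def subspace_add subspace_scale)

text \<open>Finite dimension, expressed through coordinates instead of a spanning set: degrees of freedom
such as facet fluxes or cell values are functionals at hand, whereas a basis would have to be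
constructed.\<close>

definition fin_coord :: "'v::real_vector set \<Rightarrow> bool" where
  "fin_coord S \<longleftrightarrow> (\<exists>\<Phi>. finite \<Phi> \<and> (\<forall>F\<in>\<Phi>. lin_on S F) \<and> (\<forall>x\<in>S. (\<forall>F\<in>\<Phi>. F x = 0) \<longrightarrow> x = 0))"

lemma fin_coord_family:
  assumes "finite K" and "\<And>k. k \<in> K \<Longrightarrow> lin_on S (F k)"
    and "\<And>x. x \<in> S \<Longrightarrow> (\<And>k. k \<in> K \<Longrightarrow> F k x = 0) \<Longrightarrow> x = 0"
  shows "fin_coord S"
  unfolding fin_coord_def
  by (rule exI[of _ "F ` K"]) (use assms in auto)

lemma fin_coord_Times:
  assumes "fin_coord S" "fin_coord S'"
  shows "fin_coord (S \<times> S')"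
proof -
  obtain \<Phi> \<Psi> where *: "finite \<Phi>" "\<forall>F\<in>\<Phi>. lin_on S F" "\<forall>x\<in>S. (\<forall>F\<in>\<Phi>. F x = 0) \<longrightarrow> x = 0"
    "finite \<Psi>" "\<forall>F\<in>\<Psi>. lin_on S' F" "\<forall>x\<in>S'. (\<forall>F\<in>\<Psi>. F x = 0) \<longrightarrow> x = 0"
    using assms unfolding fin_coord_def by metis
  show ?thesis
    unfolding fin_coord_def
  proof (intro exI conjI ballI impI)
    show "finite ((\<lambda>F. F \<circ> fst) ` \<Phi> \<union> (\<lambda>F. F \<circ> snd) ` \<Psi>)" using * by auto
    show "lin_on (S \<times> S') F" if "F \<in> (\<lambda>F. F \<circ> fst) ` \<Phi> \<union> (\<lambda>F. F \<circ> snd) ` \<Psi>" for F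
      using that * by (auto simp: lin_on_def)
    show "x = 0" if "x \<in> S \<times> S'" "\<forall>F\<in>(\<lambda>F. F \<circ> fst) ` \<Phi> \<union> (\<lambda>F. F \<circ> snd) ` \<Psi>. F x = 0" for x
    proof -
      have "fst x = 0" "snd x = 0"
        using that *(3,6) by (auto simp: ball_Un)
      then show ?thesis by (simp add: prod_eq_iff)
    qed
  qed
qed

text \<open>A symmetric positive semidefinite bilinear form; linearity in the first argument follows from
symmetry.\<close>

locale semi_form =
  fixes S :: "'v::real_vector set" and a :: "'v \<Rightarrow> 'v \<Rightarrow> real"
  assumes sub: "subspace S"
    and lin: "\<And>x. x \<in> S \<Longrightarrow> lin_on S (a x)"
    and sym: "\<And>x y. x \<in> S \<Longrightarrow> y \<in> S \<Longrightarrow> a x y = a y x"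
    and nonneg: "\<And>x. x \<in> S \<Longrightarrow> a x x \<ge> 0"
begin

lemma add_r: "x \<in> S \<Longrightarrow> y \<in> S \<Longrightarrow> z \<in> S \<Longrightarrow> a x (y + z) = a x y + a x z"
  using lin lin_on_add by blast
lemma scale_r: "x \<in> S \<Longrightarrow> y \<in> S \<Longrightarrow> a x (c *\<^sub>R y) = c * a x y"
  using lin lin_on_scale by blast
lemma diff_r: "x \<in> S \<Longrightarrow> y \<in> S \<Longrightarrow> z \<in> S \<Longrightarrow> a x (y - z) = a x y - a x z"
  using lin lin_on_diff sub by blast
lemma zero_r: "x \<in> S \<Longrightarrow> a x 0 = 0"
  using lin lin_on_zero sub by blast
lemma add_l: "x \<in> S \<Longrightarrow> y \<in> S \<Longrightarrow> z \<in> S \<Longrightarrow> a (y + z) x = a y x + a z x"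
  using add_r[of x y z] sym[of _ x] subspace_add[OF sub] by metis
lemma scale_l: "x \<in> S \<Longrightarrow> y \<in> S \<Longrightarrow> a (c *\<^sub>R y) x = c * a y x"
  using scale_r[of x y c] sym[of _ x] subspace_scale[OF sub] by metis
lemma diff_l: "x \<in> S \<Longrightarrow> y \<in> S \<Longrightarrow> z \<in> S \<Longrightarrow> a (y - z) x = a y x - a z x"
  using diff_r[of x y z] sym[of _ x] subspace_diff[OF sub] by metis
lemma zero_l: "x \<in> S \<Longrightarrow> a 0 x = 0"
  using zero_r sym[of 0 x] subspace_0[OF sub] by metis

lemmas in_sub = subspace_add[OF sub] subspace_scale[OF sub] subspace_diff[OF sub] subspace_0[OF sub]
lemmas expand = add_r scale_r diff_r zero_r add_l scale_l diff_l zero_l in_sub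

text \<open>The form may be degenerate, so the case \<open>a y y = 0\<close> needs its own argument: then the quadratic
below is affine in \<open>t\<close>, and nonnegative only if \<open>a x y = 0\<close>.\<close>

lemma Cauchy_Schwarz:
  assumes x: "x \<in> S" and y: "y \<in> S"
  shows "\<bar>a x y\<bar> \<le> sqrt (a x x) * sqrt (a y y)"
proof -
  have quad: "0 \<le> a x x + 2 * t * a x y + t\<^sup>2 * a y y" for t
  proof -
    have "0 \<le> a (x + t *\<^sub>R y) (x + t *\<^sub>R y)"
      using x y by (intro nonneg in_sub)
    also have "\<dots> = a x x + 2 * t * a x y + t\<^sup>2 * a y y"
      using x y sym[OF x y] by (simp add: expand algebra_simps power2_eq_square)
    finally show ?thesis .
  qed
  have "(a x y)\<^sup>2 \<le> a x x * a y y"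
  proof (cases "a y y = 0")
    case True
    have "a x y = 0"
    proof (rule ccontr)
      assume n: "a x y \<noteq> 0"
      \<comment> \<open>this \<open>t\<close> makes the affine function take the value \<open>-1\<close>\<close>
      have "0 \<le> a x x + 2 * (- (a x x + 1) / (2 * a x y)) * a x y"
        using quad[of "- (a x x + 1) / (2 * a x y)"] True by simp
      also have "\<dots> = -1" using n by (simp add: field_simps)
      finally show False by simp
    qed
    then show ?thesis using True by simp
  next
    case False
    then have p: "a y y > 0" using nonneg[OF y] by simp
    have "0 \<le> a y y * (a x x + 2 * (- a x y / a y y) * a x y + (- a x y / a y y)\<^sup>2 * a y y)"
      using quad[of "- a x y / a y y"] p by (simp only: zero_le_mult_iff) simp
    also have "\<dots> = a x x * a y y - (a x y)\<^sup>2"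
      using p by (simp add: field_simps power2_eq_square)
    finally show ?thesis by simp
  qed
  then have "sqrt ((a x y)\<^sup>2) \<le> sqrt (a x x * a y y)" by (rule real_sqrt_le_mono)
  then show ?thesis by (simp add: real_sqrt_mult)
qed

end

locale inner_form = semi_form +
  assumes definite: "\<And>x. x \<in> S \<Longrightarrow> a x x = 0 \<Longrightarrow> x = 0"
begin

lemma eqI:
  assumes "x \<in> S" "y \<in> S" "\<And>z. z \<in> S \<Longrightarrow> a x z = a y z"
  shows "x = y"
proof -
  have "a (x - y) (x - y) = 0"
    using assms by (simp add: diff_l in_sub)
  then show ?thesis using definite[of "x - y"] assms in_sub by simp
qed

end

lemma inner_form_subset:
  assumes "inner_form S a" "subspace S'" "S' \<subseteq> S"
  shows "inner_form S' a"
proof -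
  interpret inner_form S a by fact
  show ?thesis
    using assms(2,3) lin nonneg definite
    by unfold_locales (auto intro: lin_on_subset sym)
qed

text \<open>Induction on the number of coordinates. Passing to the kernel of one coordinate \<open>k\<close> costs one
dimension; a vector \<open>e\<close> outside the kernel is made orthogonal to it by subtracting the
representative of \<open>a x0\<close> on the kernel, and the representative for the whole space is corrected along \<open>e\<close>.\<close>

lemma riesz_family:
  assumes "finite \<Phi>" "inner_form S a" "\<forall>F\<in>\<Phi>. lin_on S F" "\<forall>x\<in>S. (\<forall>F\<in>\<Phi>. F x = 0) \<longrightarrow> x = 0"
    and "lin_on S G"
  shows "\<exists>w\<in>S. \<forall>r\<in>S. a w r = G r"
  using assms
proof (induction \<Phi> arbitrary: S G rule: finite_induct)
  case empty
  interpret inner_form S a by fact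
  have "S = {0}" using empty sub subspace_0 by auto
  moreover have "G 0 = 0" using empty lin_on_zero sub by blast
  ultimately show ?case using zero_r by auto
next
  case (insert k \<Phi>)
  interpret inner_form S a by (rule insert.prems)
  have linG: "lin_on S G" and link: "lin_on S k" using insert.prems by auto
  define S' where "S' = {x\<in>S. k x = 0}"
  have S': "subspace S'" "S' \<subseteq> S"
    using sub link lin_on_zero[OF link sub]
    by (auto simp: S'_def subspace_def lin_on_def)
  have IH: "\<exists>w\<in>S'. \<forall>r\<in>S'. a w r = H r" if "lin_on S H" for H
  proof (rule insert.IH)
    show "inner_form S' a" using inner_form_subset insert.prems(1) S' by blast
    show "\<forall>F\<in>\<Phi>. lin_on S' F" using insert.prems S' lin_on_subset by blast
    show "\<forall>x\<in>S'. (\<forall>F\<in>\<Phi>. F x = 0) \<longrightarrow> x = 0" using insert.prems by (auto simp: S'_def)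
    show "lin_on S' H" using that S' lin_on_subset by blast
  qed
  show ?case
  proof (cases "\<exists>x\<in>S. k x \<noteq> 0")
    case False
    then have "S' = S" by (auto simp: S'_def)
    then show ?thesis using IH[OF linG] by simp
  next
    case True
    then obtain x0 where x0: "x0 \<in> S" "k x0 \<noteq> 0" by auto
    obtain y0 where y0: "y0 \<in> S'" "\<And>r. r \<in> S' \<Longrightarrow> a y0 r = a x0 r" using IH[OF lin[OF x0(1)]] by auto
    obtain w0 where w0: "w0 \<in> S'" "\<And>r. r \<in> S' \<Longrightarrow> a w0 r = G r" using IH[OF linG] by auto
    define e where "e = x0 - y0"
    have e: "e \<in> S" using x0 y0 S' in_sub by (auto simp: e_def)
    have ke: "k e \<noteq> 0"
      using x0 y0 S' lin_on_diff[OF link sub, of x0 y0] by (auto simp: e_def S'_def)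
    have eorth: "a e r = 0" if "r \<in> S'" for r
      using that S' x0 y0 by (auto simp: e_def diff_l subsetD)
    have aee: "a e e \<noteq> 0" using definite[OF e] ke lin_on_zero[OF link sub] by auto
    \<comment> \<open>the correction along \<open>e\<close> that makes the representation exact on \<open>e\<close> itself\<close>
    define c where "c = (G e - a w0 e) / a e e"
    define w where "w = w0 + c *\<^sub>R e"
    have w0S: "w0 \<in> S" using w0 S' by auto
    have wS: "w \<in> S" using w0S e in_sub by (simp add: w_def)
    show ?thesis
    proof (rule bexI[OF _ wS], rule ballI)
      fix r assume r: "r \<in> S"
      define t where "t = k r / k e"
      define r' where "r' = r - t *\<^sub>R e"
      have r': "r' \<in> S'"
        using r e ke lin_on_diff[OF link sub, of r "t *\<^sub>R e"] lin_on_scale[OF link, of e t]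
        by (auto simp: S'_def r'_def in_sub t_def)
      have r'S: "r' \<in> S" using r' S' by auto
      have req: "r = r' + t *\<^sub>R e" by (simp add: r'_def)
      have "a w r = a w0 r' + t * a w0 e + c * (a e r' + t * a e e)"
        unfolding req w_def using w0S e r'S by (simp add: expand algebra_simps)
      also have "\<dots> = G r' + t * (a w0 e + c * a e e)"
        using w0(2)[OF r'] eorth[OF r'] by (simp add: algebra_simps)
      also have "a w0 e + c * a e e = G e" using aee by (simp add: c_def)
      also have "G r' + t * G e = G r"
        unfolding req using lin_on_add[OF linG r'S, of "t *\<^sub>R e"] lin_on_scale[OF linG e] e in_sub by simp
      finally show "a w r = G r" .
    qed
  qed
qed

lemma (in inner_form) riesz:
  assumes "fin_coord S" "lin_on S G"
  shows "\<exists>!w. w \<in> S \<and> (\<forall>r\<in>S. a w r = G r)"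
proof -
  obtain \<Phi> where "finite \<Phi>" "\<forall>F\<in>\<Phi>. lin_on S F" "\<forall>x\<in>S. (\<forall>F\<in>\<Phi>. F x = 0) \<longrightarrow> x = 0"
    using assms unfolding fin_coord_def by auto
  then have "\<exists>w\<in>S. \<forall>r\<in>S. a w r = G r"
    by (rule riesz_family[OF _ inner_form_axioms _ _ assms(2)])
  then obtain w where w: "w \<in> S" "\<forall>r\<in>S. a w r = G r" by blast
  show ?thesis
    by (rule ex1I[of _ w]) (use w in \<open>auto intro: eqI\<close>)
qed

lemma (in inner_form) riesz_bij:
  assumes "fin_coord S"
  shows "bij_betw (\<lambda>w. on_space S (a w)) S (dual_space S)"
proof (rule bij_betw_imageI)
  show "inj_on (\<lambda>w. on_space S (a w)) S"
  proof (rule inj_onI)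
    fix x y assume xy: "x \<in> S" "y \<in> S" and eq: "on_space S (a x) = on_space S (a y)"
    show "x = y"
    proof (rule eqI[OF xy])
      show "a x z = a y z" if "z \<in> S" for z
        using fun_cong[OF eq, of z] that by (simp add: on_space_def)
    qed
  qed
  show "(\<lambda>w. on_space S (a w)) ` S = dual_space S"
  proof
    show "(\<lambda>w. on_space S (a w)) ` S \<subseteq> dual_space S"
      by (rule image_subsetI) (rule on_space_in_dual[OF sub lin])
    show "dual_space S \<subseteq> (\<lambda>w. on_space S (a w)) ` S"
    proof
      fix F assume F: "F \<in> dual_space S"
      then have "lin_on S F" by (simp add: dual_space_iff_lin_on)
      from riesz[OF assms this] obtain w where w: "w \<in> S" "\<forall>r\<in>S. a w r = F r" by blast
      have "F = on_space S (a w)"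
      proof
        show "F x = on_space S (a w) x" for x
          using F w(2) by (cases "x \<in> S") (simp_all add: on_space_def dual_space_iff_lin_on)
      qed
      then show "F \<in> (\<lambda>w. on_space S (a w)) ` S" using w(1) by (rule image_eqI)
    qed
  qed
qed

lemma lin_on_comp:
  assumes "lin_on S F" "\<And>x. x \<in> S' \<Longrightarrow> f x \<in> S"
    and "\<And>x y. x \<in> S' \<Longrightarrow> y \<in> S' \<Longrightarrow> f (x + y) = f x + f y"
    and "\<And>c x. x \<in> S' \<Longrightarrow> f (c *\<^sub>R x) = c *\<^sub>R f x"
  shows "lin_on S' (\<lambda>x. F (f x))"
  using assms by (intro lin_onI) (simp_all add: lin_on_add lin_on_scale)

lemma lin_on_plus: "lin_on S F \<Longrightarrow> lin_on S G \<Longrightarrow> lin_on S (\<lambda>x. F x + G x)"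
  by (intro lin_onI) (simp_all add: lin_on_add lin_on_scale algebra_simps)

lemma lin_on_mult: "lin_on S F \<Longrightarrow> lin_on S (\<lambda>x. c * F x)"
  by (intro lin_onI) (simp_all add: lin_on_add lin_on_scale algebra_simps)

lemma lin_on_sum: "(\<And>k. k \<in> K \<Longrightarrow> lin_on S (F k)) \<Longrightarrow> lin_on S (\<lambda>x. \<Sum>k\<in>K. F k x)"
proof (induction K rule: infinite_finite_induct)
  case (insert k K)
  then show ?case using lin_on_plus[of S "F k" "\<lambda>x. \<Sum>k\<in>K. F k x"] by simp
qed (simp_all add: lin_on_def)

text \<open>All forms below are sums of integrals, each of which sees a field only through one of its
restrictions; the pullback along this restriction and the sum rule assemble them.\<close>

lemma semi_form_pullback:
  assumes "semi_form S a" "subspace S'" "\<And>x. x \<in> S' \<Longrightarrow> f x \<in> S"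
    and "\<And>x y. x \<in> S' \<Longrightarrow> y \<in> S' \<Longrightarrow> f (x + y) = f x + f y"
    and "\<And>c x. x \<in> S' \<Longrightarrow> f (c *\<^sub>R x) = c *\<^sub>R f x"
  shows "semi_form S' (\<lambda>x y. a (f x) (f y))"
proof -
  interpret semi_form S a by fact
  show ?thesis
  proof
    show "lin_on S' (\<lambda>y. a (f x) (f y))" if "x \<in> S'" for x
      by (rule lin_on_comp[OF lin]) (use assms that in auto)
  qed (use assms(2,3) sym nonneg in auto)
qed

lemma semi_form_scale:
  assumes "semi_form S a" "c \<ge> 0" shows "semi_form S (\<lambda>x y. c * a x y)"
proof -
  interpret semi_form S a by fact
  show ?thesis
  proof
    show "lin_on S (\<lambda>y. c * a x y)" if "x \<in> S" for x by (rule lin_on_mult[OF lin[OF that]])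
  qed (use sub sym nonneg assms(2) in auto)
qed

lemma semi_form_add:
  assumes "semi_form S a" "semi_form S b" shows "semi_form S (\<lambda>x y. a x y + b x y)"
proof -
  interpret a: semi_form S a by fact
  interpret b: semi_form S b by fact
  show ?thesis
  proof
    show "lin_on S (\<lambda>y. a x y + b x y)" if "x \<in> S" for x
      by (rule lin_on_plus[OF a.lin[OF that] b.lin[OF that]])
    show "a x y + b x y = a y x + b y x" if "x \<in> S" "y \<in> S" for x y
      using a.sym[OF that] b.sym[OF that] by simp
    show "0 \<le> a x x + b x x" if "x \<in> S" for x
      using a.nonneg[OF that] b.nonneg[OF that] by simp
  qed (rule a.sub)
qed

lemma semi_form_sum:
  assumes "subspace S" "\<And>k. k \<in> K \<Longrightarrow> semi_form S (a k)"
  shows "semi_form S (\<lambda>x y. \<Sum>k\<in>K. a k x y)"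
  using assms(2)
proof (induction K rule: infinite_finite_induct)
  case (insert k K)
  then show ?case using semi_form_add[of S "a k" "\<lambda>x y. \<Sum>k\<in>K. a k x y"] by simp
qed (use assms(1) in \<open>simp_all add: semi_form_def lin_on_def\<close>)

section \<open>Lebesgue measure on flats\<close>

lemma subspace_tangent [simp]: "subspace (tangent S)"
  by (simp add: tangent_def)

lemma diff_in_tangent: "x \<in> S \<Longrightarrow> y \<in> S \<Longrightarrow> x - y \<in> tangent S"
  by (auto simp: tangent_def intro: span_base)

lemma tangent_le_subspace:
  assumes "subspace V" "\<And>x y. x \<in> S \<Longrightarrow> y \<in> S \<Longrightarrow> x - y \<in> V"
  shows "tangent S \<subseteq> V"
  unfolding tangent_def by (rule span_minimal) (use assms in auto)

lemma affine_hull_eq_translate_tangent: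
  assumes "p \<in> S"
  shows "affine hull S = (\<lambda>v. p + v) ` tangent S"
proof -
  have "span ((\<lambda>x. - p + x) ` S) = tangent S"
  proof
    show "span ((\<lambda>x. - p + x) ` S) \<subseteq> tangent S"
    proof (rule span_minimal)
      show "(\<lambda>x. - p + x) ` S \<subseteq> tangent S" using diff_in_tangent[OF _ assms] by auto
    qed simp
    show "tangent S \<subseteq> span ((\<lambda>x. - p + x) ` S)"
    proof (rule tangent_le_subspace)
      fix x y assume xy: "x \<in> S" "y \<in> S"
      have "(- p + x) - (- p + y) \<in> span ((\<lambda>x. - p + x) ` S)"
        by (rule span_diff) (use xy in \<open>auto intro: span_base\<close>)
      then show "x - y \<in> span ((\<lambda>x. - p + x) ` S)" by simp
    qed simp
  qed
  then show ?thesis using affine_hull_span_gen[of p S] assms hull_subset[of S affine] by auto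
qed

lemma tangent_affine_hull [simp]: "tangent (affine hull S) = tangent S"
proof
  show "tangent S \<subseteq> tangent (affine hull S)"
    by (rule tangent_le_subspace) (auto intro: diff_in_tangent hull_inc)
  show "tangent (affine hull S) \<subseteq> tangent S"
  proof (rule tangent_le_subspace)
    fix x y assume xy: "x \<in> affine hull S" "y \<in> affine hull S"
    then have "S \<noteq> {}" by auto
    then obtain p where "p \<in> S" by auto
    from affine_hull_eq_translate_tangent[OF this] xy
    obtain v w where "v \<in> tangent S" "w \<in> tangent S" "x = p + v" "y = p + w" by auto
    then show "x - y \<in> tangent S" using subspace_diff[OF subspace_tangent] by simp
  qed simp
qed

lemma affine_hull_translate_tangent:
  assumes "p \<in> affine hull S"
  shows "affine hull S = (\<lambda>v. p + v) ` tangent S"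
  using affine_hull_eq_translate_tangent[OF assms] by (simp add: hull_hull)

lemma onb_spec:
  fixes U :: "'a::euclidean_space set"
  assumes "subspace U"
  shows onb_inner: "k < dim U \<Longrightarrow> l < dim U \<Longrightarrow> onb U k \<bullet> onb U l = (if k = l then 1 else 0)"
    and span_onb: "span (onb U ` {..<dim U}) = U"
proof -
  obtain B where B: "B \<subseteq> U" "pairwise orthogonal B" "\<And>x. x \<in> B \<Longrightarrow> norm x = 1"
    "independent B" "card B = dim U" "span B = U"
    using orthonormal_basis_subspace[OF assms] by metis
  have "finite B" using B independent_imp_finite by blast
  then obtain h where h: "bij_betw h {0..<card B} B" using ex_bij_betw_nat_finite by blast
  have 1: "h k \<bullet> h l = (if k = l then 1 else 0)" if "k < dim U" "l < dim U" for k l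
  proof -
    have "h k \<in> B" "h l \<in> B" "k \<noteq> l \<Longrightarrow> h k \<noteq> h l"
      using h that B(5) by (auto simp: bij_betw_def inj_on_def)
    then show ?thesis using B(2,3) by (auto simp: pairwise_def orthogonal_def dot_square_norm)
  qed
  have 2: "span (h ` {..<dim U}) = U"
    using h B by (simp add: bij_betw_def lessThan_atLeast0)
  have "(\<forall>k<dim U. \<forall>l<dim U. onb U k \<bullet> onb U l = (if k = l then 1 else 0)) \<and>
        span (onb U ` {..<dim U}) = U"
    unfolding onb_def by (rule someI[of _ h]) (use 1 2 in auto)
  then show "k < dim U \<Longrightarrow> l < dim U \<Longrightarrow> onb U k \<bullet> onb U l = (if k = l then 1 else 0)"
    and "span (onb U ` {..<dim U}) = U" by auto
qed

lemma onb_mem: "subspace U \<Longrightarrow> k < dim U \<Longrightarrow> onb U k \<in> U"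
  using span_onb[of U] span_base[of "onb U k" "onb U ` {..<dim U}"] by auto

lemma onb_expansion:
  fixes U :: "'a::euclidean_space set"
  assumes U: "subspace U" and x: "x \<in> U"
  shows "(\<Sum>k<dim U. (x \<bullet> onb U k) *\<^sub>R onb U k) = x"
proof -
  have "x \<in> span (onb U ` {..<dim U})" using span_onb[OF U] x by simp
  then show ?thesis
  proof (rule span_induct)
    show "subspace {x. (\<Sum>k<dim U. (x \<bullet> onb U k) *\<^sub>R onb U k) = x}"
      by (auto simp: subspace_def inner_add_left scaleR_add_left sum.distrib scaleR_sum_right[symmetric]
            simp flip: scaleR_scaleR)
    show "(\<Sum>k<dim U. (x \<bullet> onb U k) *\<^sub>R onb U k) = x" if "x \<in> onb U ` {..<dim U}" for x
    proof -
      from that obtain l where l: "l < dim U" "x = onb U l" by auto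
      have "(\<Sum>k<dim U. (x \<bullet> onb U k) *\<^sub>R onb U k) = (\<Sum>k<dim U. if k = l then onb U k else 0)"
        by (rule sum.cong) (use l onb_inner[OF U, of l] in auto)
      then show ?thesis using l by simp
    qed
  qed
qed

text \<open>The parametrization whose image measure is \<open>flat_measure S\<close>.\<close>

definition flat_param :: "'a::euclidean_space set \<Rightarrow> (nat \<Rightarrow> real) \<Rightarrow> 'a" where
  "flat_param S y = (SOME p. p \<in> affine hull S) + (\<Sum>k<dim (tangent S). y k *\<^sub>R onb (tangent S) k)"

lemma flat_measure_eq:
  "flat_measure S = distr (\<Pi>\<^sub>M k\<in>{..<dim (tangent S)}. lborel) borel (flat_param S)"
  unfolding flat_measure_def Let_def flat_param_def tangent_affine_hull by (rule refl)

lemma sets_flat_measure [simp, measurable_cong]: "sets (flat_measure S) = sets borel"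
  by (simp add: flat_measure_eq)

lemma space_flat_measure [simp]: "space (flat_measure S) = UNIV"
  by (simp add: flat_measure_eq)

lemma flat_param_measurable [measurable]:
  "flat_param S \<in> measurable (\<Pi>\<^sub>M k\<in>{..<dim (tangent S)}. lborel) borel"
  unfolding flat_param_def by measurable

text \<open>The parameters are the coordinates in an orthonormal basis, hence bounded on bounded sets.\<close>

lemma flat_param_inner:
  assumes "k < dim (tangent S)"
  shows "(flat_param S y - (SOME p. p \<in> affine hull S)) \<bullet> onb (tangent S) k = y k"
proof -
  have "(flat_param S y - (SOME p. p \<in> affine hull S)) \<bullet> onb (tangent S) k =
      (\<Sum>l<dim (tangent S). if l = k then y k else 0)"
    unfolding flat_param_def add_diff_cancel_left' inner_sum_left
    by (rule sum.cong) (use assms onb_inner[OF subspace_tangent, of _ S k] in auto)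
  then show ?thesis using assms by simp
qed

lemma emeasure_flat_measure:
  assumes "B \<in> sets borel"
  shows "emeasure (flat_measure S) B =
    emeasure (\<Pi>\<^sub>M k\<in>{..<dim (tangent S)}. lborel)
      (flat_param S -` B \<inter> space (\<Pi>\<^sub>M k\<in>{..<dim (tangent S)}. lborel))"
  unfolding flat_measure_eq using assms by (intro emeasure_distr) auto

lemma emeasure_PiM_box:
  fixes lo hi :: "nat \<Rightarrow> real"
  shows "emeasure (\<Pi>\<^sub>M k\<in>{..<n}. lborel) (PiE {..<n} (\<lambda>k. {lo k..hi k})) =
    (\<Prod>k<n. emeasure lborel {lo k..hi k})"
proof -
  interpret product_sigma_finite "\<lambda>_::nat. lborel :: real measure"
    by standard
  show ?thesis by (rule emeasure_PiM) auto
qed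

lemma flat_measure_bounded_finite:
  assumes "bounded B" "B \<in> sets borel"
  shows "emeasure (flat_measure S) B < \<infinity>"
proof -
  let ?n = "dim (tangent S)" and ?p = "SOME p. p \<in> affine hull S"
  obtain r where r: "\<And>x. x \<in> B \<Longrightarrow> norm x \<le> r" using assms bounded_iff by metis
  define R where "R = r + norm ?p"
  have "flat_param S -` B \<inter> space (\<Pi>\<^sub>M k\<in>{..<?n}. lborel) \<subseteq> PiE {..<?n} (\<lambda>k. {-R..R})"
  proof
    fix y assume y: "y \<in> flat_param S -` B \<inter> space (\<Pi>\<^sub>M k\<in>{..<?n}. lborel)"
    have "\<bar>y k\<bar> \<le> R" if k: "k < ?n" for k
    proof -
      have "\<bar>y k\<bar> \<le> norm (flat_param S y - ?p) * norm (onb (tangent S) k)"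
        unfolding flat_param_inner[OF k, of y, symmetric] by (rule Cauchy_Schwarz_ineq2)
      also have "norm (onb (tangent S) k) = 1"
        using onb_inner[OF subspace_tangent k k] by (simp add: norm_eq_sqrt_inner)
      also have "norm (flat_param S y - ?p) * 1 \<le> R"
        using norm_triangle_ineq4[of "flat_param S y" ?p] r[of "flat_param S y"] y by (auto simp: R_def)
      finally show ?thesis .
    qed
    then show "y \<in> PiE {..<?n} (\<lambda>k. {-R..R})"
      using y by (auto simp: space_PiM PiE_iff abs_le_iff) (smt (verit))
  qed
  then have "emeasure (flat_measure S) B \<le> emeasure (\<Pi>\<^sub>M k\<in>{..<?n}. lborel) (PiE {..<?n} (\<lambda>k. {-R..R}))"
    unfolding emeasure_flat_measure[OF assms(2)]
    by (rule emeasure_mono) (auto intro!: sets_PiM_I_finite)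
  also have "\<dots> < \<infinity>"
    unfolding emeasure_PiM_box
    by (auto simp: ennreal_prod_eq_top less_top[symmetric] emeasure_lborel_Icc_eq power_eq_top_ennreal)
  finally show ?thesis .
qed

lemma openin_affine_hull_borel:
  fixes Z :: "'a::euclidean_space set"
  assumes "openin (top_of_set (affine hull S)) Z"
  shows "Z \<in> sets borel"
proof -
  obtain V where "open V" "Z = affine hull S \<inter> V" using assms by (auto simp: openin_open)
  then show ?thesis by (simp add: borel_closed borel_open sets.Int)
qed

text \<open>A small box of parameters around those of a point of \<open>Z\<close> is mapped into \<open>Z\<close>, and a box has
positive measure.\<close>

lemma flat_measure_openin_pos:
  fixes Z :: "'a::euclidean_space set"
  assumes Z: "openin (top_of_set (affine hull S)) Z" "Z \<noteq> {}"
  shows "emeasure (flat_measure S) Z > 0"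
proof -
  let ?n = "dim (tangent S)" and ?p = "SOME p. p \<in> affine hull S" and ?e = "onb (tangent S)"
  obtain x0 where x0: "x0 \<in> Z" using Z by auto
  then have x0A: "x0 \<in> affine hull S" using Z(1) openin_imp_subset by blast
  then have pA: "?p \<in> affine hull S" by (rule someI)
  obtain d where d: "d > 0" "ball x0 d \<inter> affine hull S \<subseteq> Z"
    using Z(1) x0 by (auto simp: openin_contains_ball)
  have aff: "affine hull S = (\<lambda>v. ?p + v) ` tangent S" by (rule affine_hull_translate_tangent[OF pA])
  define c where "c k = (x0 - ?p) \<bullet> ?e k" for k
  have c: "x0 - ?p = (\<Sum>k<?n. c k *\<^sub>R ?e k)"
    unfolding c_def using x0A pA diff_in_tangent[of x0 "affine hull S" ?p]
    by (subst onb_expansion) auto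
  \<comment> \<open>\<open>?n\<close> coordinates, each off by at most \<open>\<delta>\<close>, move the point by less than \<open>d\<close>, also for \<open>?n = 0\<close>\<close>
  define \<delta> where "\<delta> = d / (real ?n + 1)"
  have \<delta>: "\<delta> > 0" using d by (simp add: \<delta>_def)
  have "PiE {..<?n} (\<lambda>k. {c k - \<delta>..c k + \<delta>}) \<subseteq> flat_param S -` Z \<inter> space (\<Pi>\<^sub>M k\<in>{..<?n}. lborel)"
  proof
    fix y assume y: "y \<in> PiE {..<?n} (\<lambda>k. {c k - \<delta>..c k + \<delta>})"
    have "(\<Sum>k<?n. y k *\<^sub>R ?e k) \<in> tangent S"
      by (intro subspace_sum subspace_scale subspace_tangent onb_mem) auto
    then have 1: "flat_param S y \<in> affine hull S" unfolding flat_param_def by (subst aff) auto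
    have "flat_param S y - x0 = (\<Sum>k<?n. y k *\<^sub>R ?e k) - (x0 - ?p)" by (simp add: flat_param_def)
    also have "\<dots> = (\<Sum>k<?n. (y k - c k) *\<^sub>R ?e k)"
      unfolding c by (simp add: scaleR_diff_left sum_subtractf)
    finally have "norm (flat_param S y - x0) \<le> (\<Sum>k<?n. norm ((y k - c k) *\<^sub>R ?e k))"
      using norm_sum by metis
    also have "\<dots> \<le> (\<Sum>k<?n. \<delta>)"
    proof (rule sum_mono)
      fix k assume k: "k \<in> {..<?n}"
      then have "norm (?e k) = 1"
        using onb_inner[OF subspace_tangent, of k S k] by (simp add: norm_eq_sqrt_inner)
      moreover have "\<bar>y k - c k\<bar> \<le> \<delta>" using y k by (force simp: PiE_iff abs_le_iff)
      ultimately show "norm ((y k - c k) *\<^sub>R ?e k) \<le> \<delta>" by simp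
    qed
    also have "\<dots> = real ?n * \<delta>" by simp
    also have "\<dots> < d" using d by (simp add: \<delta>_def field_simps)
    finally have "flat_param S y \<in> ball x0 d" by (simp add: dist_norm norm_minus_commute)
    then show "y \<in> flat_param S -` Z \<inter> space (\<Pi>\<^sub>M k\<in>{..<?n}. lborel)"
      using 1 d y by (auto simp: space_PiM PiE_iff)
  qed
  then have "emeasure (\<Pi>\<^sub>M k\<in>{..<?n}. lborel) (PiE {..<?n} (\<lambda>k. {c k - \<delta>..c k + \<delta>})) \<le> emeasure (flat_measure S) Z"
    unfolding emeasure_flat_measure[OF openin_affine_hull_borel[OF Z(1)]]
    by (rule emeasure_mono) (intro measurable_sets[OF flat_param_measurable] openin_affine_hull_borel[OF Z(1)])
  moreover have "emeasure (\<Pi>\<^sub>M k\<in>{..<?n}. lborel) (PiE {..<?n} (\<lambda>k. {c k - \<delta>..c k + \<delta>})) > 0"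
    unfolding emeasure_PiM_box using \<delta> by (auto simp: zero_less_iff_neq_zero)
  ultimately show ?thesis by order
qed

text \<open>The source of every definiteness statement in this theory: a nonnegative function with integral
zero cannot be positive on a set of positive measure.\<close>

lemma flat_integral_zero_on_openin:
  fixes f :: "'a::euclidean_space \<Rightarrow> real"
  assumes int: "set_integrable (flat_measure S) B f"
    and nn: "\<And>x. x \<in> B \<Longrightarrow> f x \<ge> 0"
    and zero: "(LINT x:B|flat_measure S. f x) = 0"
    and Z: "openin (top_of_set (affine hull S)) Z" "Z \<subseteq> B" "Z \<noteq> {}"
  shows "\<exists>x\<in>Z. f x = 0"
proof (rule ccontr)
  assume n: "\<not> (\<exists>x\<in>Z. f x = 0)"
  have "AE x in flat_measure S. indicator B x *\<^sub>R f x = 0"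
    using int zero nn unfolding set_integrable_def set_lebesgue_integral_def
    by (subst integral_nonneg_eq_0_iff_AE[symmetric]) (auto simp: indicator_def)
  then have "AE x in flat_measure S. x \<notin> Z"
    by (rule AE_mp) (use n Z in \<open>auto simp: indicator_def\<close>)
  then have "Z \<in> null_sets (flat_measure S)"
    using openin_affine_hull_borel[OF Z(1)] by (subst AE_iff_null_sets) auto
  then show False using flat_measure_openin_pos[OF Z(1,3)] by auto
qed

text \<open>A class of functions closed under products whose members are integrable for every
flat measure. It contains the piecewise constants on any mesh, so products of piecewise constants on
nonmatching meshes need no common refinement.\<close>

definition tame :: "('a::euclidean_space \<Rightarrow> real) \<Rightarrow> bool" where
  "tame f \<longleftrightarrow> f \<in> borel_measurable borel \<and> bounded (range f) \<and> bounded {x. f x \<noteq> 0}"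

lemma tame_bound:
  assumes "tame f" obtains b where "\<And>x. \<bar>f x\<bar> \<le> b"
  using assms unfolding tame_def bounded_iff by auto

lemma tame_zero [simp]: "tame (\<lambda>x. 0)" "tame 0"
  by (auto simp: tame_def zero_fun_def image_constant_conv)

lemma tame_add: assumes "tame f" "tame g" shows "tame (\<lambda>x. f x + g x)"
proof -
  obtain b c where "\<And>x. \<bar>f x\<bar> \<le> b" "\<And>x. \<bar>g x\<bar> \<le> c" using assms tame_bound by metis
  then have "\<bar>f x + g x\<bar> \<le> b + c" for x
    by (rule order_trans[OF abs_triangle_ineq add_mono])
  then have "bounded (range (\<lambda>x. f x + g x))" unfolding bounded_iff by auto
  moreover have "bounded {x. f x + g x \<noteq> 0}"
    by (rule bounded_subset[of "{x. f x \<noteq> 0} \<union> {x. g x \<noteq> 0}"]) (use assms in \<open>auto simp: tame_def\<close>)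
  ultimately show ?thesis using assms by (auto simp: tame_def)
qed

lemma tame_mult: assumes "tame f" "tame g" shows "tame (\<lambda>x. f x * g x)"
proof -
  obtain b c where "\<And>x. \<bar>f x\<bar> \<le> b" "\<And>x. \<bar>g x\<bar> \<le> c" using assms tame_bound by metis
  then have "\<bar>f x * g x\<bar> \<le> b * c" for x
    unfolding abs_mult by (intro mult_mono) (auto intro: order_trans[OF abs_ge_zero])
  then have "bounded (range (\<lambda>x. f x * g x))" unfolding bounded_iff by auto
  moreover have "bounded {x. f x * g x \<noteq> 0}"
    by (rule bounded_subset[of "{x. f x \<noteq> 0}"]) (use assms in \<open>auto simp: tame_def\<close>)
  ultimately show ?thesis using assms by (auto simp: tame_def)
qed

lemma tame_indicator: 
  assumes "A \<in> sets borel" "bounded A" shows "tame (\<lambda>x. indicator A x :: real)"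
proof -
  have "{x. (indicator A x :: real) \<noteq> 0} = A" by (auto simp: indicator_def)
  moreover have "bounded (range (indicator A :: _ \<Rightarrow> real))"
    by (rule bounded_subset[of "{0, 1}"]) (auto simp: indicator_def)
  ultimately show ?thesis using assms by (auto simp: tame_def)
qed

lemma tame_cmult: assumes "tame f" shows "tame (\<lambda>x. c * f x)"
proof -
  obtain b where "\<And>x. \<bar>f x\<bar> \<le> b" using assms tame_bound by metis
  then have "\<bar>c * f x\<bar> \<le> \<bar>c\<bar> * b" for x unfolding abs_mult by (intro mult_left_mono) auto
  then have "bounded (range (\<lambda>x. c * f x))" unfolding bounded_iff by auto
  moreover have "bounded {x. c * f x \<noteq> 0}"
    by (rule bounded_subset[of "{x. f x \<noteq> 0}"]) (use assms in \<open>auto simp: tame_def\<close>)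
  ultimately show ?thesis using assms by (auto simp: tame_def)
qed

lemma tame_sum: "(\<And>i. i \<in> I \<Longrightarrow> tame (f i)) \<Longrightarrow> tame (\<lambda>x. \<Sum>i\<in>I. f i x)"
  by (induction I rule: infinite_finite_induct) (auto intro: tame_add)

lemma tame_integrable: "tame f \<Longrightarrow> integrable (flat_measure S) f"
proof -
  assume f: "tame f"
  obtain b where b: "\<And>x. \<bar>f x\<bar> \<le> b" using f tame_bound by metis
  from f have "bounded {x. f x \<noteq> 0}" by (simp add: tame_def)
  from bounded_subset_ballD[OF this, of 0] obtain r where "{x. f x \<noteq> 0} \<subseteq> ball 0 r" by auto
  then have r: "x \<notin> cball 0 r \<longrightarrow> f x = 0" "x \<in> cball 0 r \<longrightarrow> norm (f x) \<le> b" for x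
    using b by auto
  show ?thesis
  proof (rule integrableI_bounded_set[where A = "cball 0 r" and B = b])
    show "emeasure (flat_measure S) (cball 0 r) < \<infinity>" by (rule flat_measure_bounded_finite) auto
    show "f \<in> borel_measurable (flat_measure S)" using f by (simp add: tame_def cong: measurable_cong_sets)
  qed (use r in \<open>auto intro!: AE_I2\<close>)
qed

lemma tame_set_integrable: "tame f \<Longrightarrow> B \<in> sets borel \<Longrightarrow> set_integrable (flat_measure S) B f"
  unfolding set_integrable_def by (rule integrable_mult_indicator[OF _ tame_integrable]) auto

lemma continuous_set_integrable_flat:
  fixes f :: "'a::euclidean_space \<Rightarrow> real"
  assumes "compact T" "continuous_on T f"
  shows "set_integrable (flat_measure S) T f"
  unfolding set_integrable_def
proof (rule tame_integrable)
  have "bounded (f ` T)" by (rule compact_imp_bounded[OF compact_continuous_image[OF assms(2,1)]])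
  then obtain b where b: "\<And>x. x \<in> T \<Longrightarrow> \<bar>f x\<bar> \<le> b" unfolding bounded_iff by auto
  have "bounded (range (\<lambda>x. indicator T x *\<^sub>R f x))"
    unfolding bounded_iff by (rule exI[of _ "max b 0"]) (use b in \<open>auto simp: indicator_def le_max_iff_disj\<close>)
  moreover have "bounded {x. indicator T x *\<^sub>R f x \<noteq> 0}"
    by (rule bounded_subset[of T]) (use assms compact_imp_bounded in \<open>auto simp: indicator_def\<close>)
  moreover have "(\<lambda>x. indicator T x *\<^sub>R f x) \<in> borel_measurable borel"
    by (rule borel_measurable_continuous_on_indicator) (use assms in \<open>auto simp: borel_closed compact_imp_closed\<close>)
  ultimately show "tame (\<lambda>x. indicator T x *\<^sub>R f x)" by (simp add: tame_def)
qed

lemma semi_form_L2: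
  assumes B: "B \<in> sets borel"
  shows "semi_form {f. tame f} (\<lambda>f g. LINT x:B|flat_measure S. f x * g x)"
proof
  show "subspace {f :: 'a \<Rightarrow> real. tame f}"
    by (rule subspaceI) (auto simp: scaleR_fun_def plus_fun_def intro: tame_add tame_cmult tame_zero)
  have int: "set_integrable (flat_measure S) B (\<lambda>x. f x * g x)" if "tame f" "tame g" for f g :: "'a \<Rightarrow> real"
    by (rule tame_set_integrable[OF tame_mult[OF that] B])
  fix f :: "'a \<Rightarrow> real" assume f: "f \<in> {f. tame f}"
  show "lin_on {f. tame f} (\<lambda>g. LINT x:B|flat_measure S. f x * g x)"
  proof (rule lin_onI)
    fix g h :: "'a \<Rightarrow> real" assume gh: "g \<in> {f. tame f}" "h \<in> {f. tame f}"
    show "(LINT x:B|flat_measure S. f x * (g + h) x) =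
        (LINT x:B|flat_measure S. f x * g x) + (LINT x:B|flat_measure S. f x * h x)"
      using set_integral_add(2)[OF int int, of f g f h] f gh by (simp add: distrib_left)
  next
    fix c and g :: "'a \<Rightarrow> real"
    show "(LINT x:B|flat_measure S. f x * (c *\<^sub>R g) x) = c * (LINT x:B|flat_measure S. f x * g x)"
      by (simp add: scaleR_fun_def mult.left_commute)
  qed
  show "0 \<le> (LINT x:B|flat_measure S. f x * f x)"
    unfolding set_lebesgue_integral_def by (rule integral_nonneg_AE) (auto simp: indicator_def)
  fix g :: "'a \<Rightarrow> real"
  show "(LINT x:B|flat_measure S. f x * g x) = (LINT x:B|flat_measure S. g x * f x)"
    by (simp add: mult.commute)
qed

section \<open>Raviart-Thomas fields on a simplex\<close>

lemma tangent_convex_hull [simp]: "tangent (convex hull C) = tangent C"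
  by (metis affine_hull_convex_hull tangent_affine_hull)

lemma RT0_iff:
  "g \<in> RT0 T \<longleftrightarrow> (\<exists>a b. \<forall>x\<in>T. g x = a + b *\<^sub>R x) \<and> (\<forall>x\<in>T. g x \<in> tangent T) \<and> (\<forall>x. x \<notin> T \<longrightarrow> g x = 0)"
  by (simp add: RT0_def)

lemma subspace_RT0: "subspace (RT0 T)"
proof (rule subspaceI)
  show "0 \<in> RT0 T" unfolding RT0_iff
    by (auto simp: subspace_0 intro!: exI[of _ 0])
next
  fix g h assume g: "g \<in> RT0 T" and h: "h \<in> RT0 T"
  obtain a b where ab: "\<forall>x\<in>T. g x = a + b *\<^sub>R x" using g unfolding RT0_iff by blast
  obtain c d where cd: "\<forall>x\<in>T. h x = c + d *\<^sub>R x" using h unfolding RT0_iff by blast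
  have "\<forall>x\<in>T. (g + h) x = (a + c) + (b + d) *\<^sub>R x" using ab cd by (simp add: algebra_simps)
  moreover have "\<forall>x\<in>T. (g + h) x \<in> tangent T"
    using g h unfolding RT0_iff plus_fun_apply by (blast intro: subspace_add[OF subspace_tangent])
  moreover have "\<forall>x. x \<notin> T \<longrightarrow> (g + h) x = 0" using g h unfolding RT0_iff by simp
  ultimately show "g + h \<in> RT0 T" unfolding RT0_iff by blast
next
  fix k :: real and g assume g: "g \<in> RT0 T"
  obtain a b where ab: "\<forall>x\<in>T. g x = a + b *\<^sub>R x" using g unfolding RT0_iff by blast
  have "\<forall>x\<in>T. (k *\<^sub>R g) x = (k *\<^sub>R a) + (k * b) *\<^sub>R x" using ab by (simp add: scaleR_fun_def algebra_simps)
  moreover have "\<forall>x\<in>T. (k *\<^sub>R g) x \<in> tangent T"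
    using g unfolding RT0_iff scaleR_fun_def by (blast intro: subspace_scale[OF subspace_tangent])
  moreover have "\<forall>x. x \<notin> T \<longrightarrow> (k *\<^sub>R g) x = 0" using g unfolding RT0_iff by (simp add: scaleR_fun_def)
  ultimately show "k *\<^sub>R g \<in> RT0 T" unfolding RT0_iff by blast
qed

lemma nflux_add: "nflux T f (g + h) = nflux T f g + nflux T f h"
  and nflux_scale: "nflux T f (c *\<^sub>R g) = c * nflux T f g"
  and nflux_zero [simp]: "nflux T f 0 = 0"
  by (simp_all add: nflux_def scaleR_fun_def inner_add_left inner_diff_left)

lemma nflux_sum: "nflux T f (\<Sum>i\<in>I. g i) = (\<Sum>i\<in>I. nflux T f (g i))"
  by (induction I rule: infinite_finite_induct) (simp_all only: sum.infinite sum.empty sum.insert nflux_add nflux_zero simp_thms)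

text \<open>Nondegenerate simplices of positive dimension, given by their vertex set. A vertex \<open>p\<close> stands for
the opposite facet \<open>opp p\<close>.\<close>

locale simplex_vertices =
  fixes C :: "'a::euclidean_space set"
  assumes indep: "\<not> affine_dependent C" and card2: "card C \<ge> 2"
begin

abbreviation T where "T \<equiv> convex hull C"
abbreviation opp where "opp p \<equiv> convex hull (C - {p})"

lemma finC: "finite C" using indep aff_independent_finite by blast

lemma other_vertex: "p \<in> C \<Longrightarrow> \<exists>q. q \<in> C - {p}"
  using card2 finC by (metis card_le_Suc0_iff_eq Diff_iff not_less_eq_eq numeral_2_eq_2 singletonD)

lemma facet_iff: "f facet_of T \<longleftrightarrow> (\<exists>p\<in>C. f = opp p)"
  unfolding facet_of_convex_hull_affine_independent[OF indep] using other_vertex by fastforce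

lemma finite_facets: "finite {f. f facet_of T}"
  by (rule finite_subset[of _ "opp ` C"]) (auto simp: facet_iff finC)

lemma tangent_span: "p \<in> C \<Longrightarrow> tangent C = span ((\<lambda>x. x - p) ` (C - {p}))"
proof
  assume p: "p \<in> C"
  show "tangent C \<subseteq> span ((\<lambda>x. x - p) ` (C - {p}))"
  proof (rule tangent_le_subspace)
    fix x y assume xy: "x \<in> C" "y \<in> C"
    have *: "u - p \<in> span ((\<lambda>x. x - p) ` (C - {p}))" if "u \<in> C" for u
      by (cases "u = p") (use that in \<open>auto intro: span_base span_zero\<close>)
    from span_diff[OF *[OF xy(1)] *[OF xy(2)]] show "x - y \<in> span ((\<lambda>x. x - p) ` (C - {p}))" by simp
  qed simp
  show "span ((\<lambda>x. x - p) ` (C - {p})) \<subseteq> tangent C"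
    by (rule span_minimal) (use p in \<open>auto intro: diff_in_tangent\<close>)
qed

lemma orth_vertices_zero:
  assumes "p \<in> C" "w \<in> tangent C" "\<And>x. x \<in> C - {p} \<Longrightarrow> w \<bullet> (x - p) = 0"
  shows "w = 0"
proof -
  have "span ((\<lambda>x. x - p) ` (C - {p})) \<subseteq> {v. w \<bullet> v = 0}"
    by (rule span_minimal) (use assms(3) in \<open>auto simp: subspace_hyperplane\<close>)
  then show ?thesis using assms(1,2) tangent_span by auto
qed

text \<open>Minus the gradient of the barycentric coordinate of \<open>p\<close>: the functional \<open>z \<bullet> (x - p)\<close> vanishes at
\<open>p\<close> and is \<open>1\<close> on the opposite facet. Normalized, it is the outer normal of this facet.\<close>

definition grad :: "'a \<Rightarrow> 'a" where
  "grad p = (SOME z. z \<in> tangent C \<and> (\<forall>x\<in>C - {p}. z \<bullet> (x - p) = 1))"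

text \<open>The edges from \<open>p\<close> are independent, so some linear functional is \<open>1\<close> on all of them; \<open>z\<close> is its
representing vector, projected to the tangent space.\<close>

lemma grad_exists:
  assumes p: "p \<in> C"
  shows "\<exists>z. z \<in> tangent C \<and> (\<forall>x\<in>C - {p}. z \<bullet> (x - p) = 1)"
proof -
  have "independent ((\<lambda>x. - p + x) ` (C - {p}))"
    using affine_dependent_iff_dependent[of p "C - {p}"] indep p by (simp add: insert_absorb)
  then have "independent ((\<lambda>x. x - p) ` (C - {p}))" by (simp add: add.commute[of "- p"])
  from linear_independent_extend[OF this, of "\<lambda>_. 1::real"]
  obtain g where g: "linear g" "\<forall>x\<in>(\<lambda>x. x - p) ` (C - {p}). g x = (1::real)" by auto
  obtain y z where yz: "y \<in> span (tangent C)" "\<And>w. w \<in> span (tangent C) \<Longrightarrow> orthogonal z w" "adjoint g 1 = y + z"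
    using orthogonal_subspace_decomp_exists[of "tangent C" "adjoint g 1"] by metis
  have sp: "span (tangent C) = tangent C" by simp
  have "y \<bullet> (x - p) = 1" if x: "x \<in> C - {p}" for x
  proof -
    have "y \<bullet> (x - p) = (x - p) \<bullet> adjoint g 1 - z \<bullet> (x - p)"
      by (simp add: yz(3) inner_add_right inner_commute)
    also have "(x - p) \<bullet> adjoint g 1 = 1" using adjoint_works[OF g(1), of "x - p" 1] g(2) x by auto
    also have "z \<bullet> (x - p) = 0"
      using yz(2)[unfolded sp, of "x - p"] x p by (auto simp: orthogonal_def intro: diff_in_tangent)
    finally show ?thesis by simp
  qed
  then show ?thesis using yz(1) sp by blast
qed

lemma grad_spec: "p \<in> C \<Longrightarrow> grad p \<in> tangent C \<and> (\<forall>x\<in>C - {p}. grad p \<bullet> (x - p) = 1)"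
  unfolding grad_def by (rule someI_ex[OF grad_exists])

lemma grad_tangent: "p \<in> C \<Longrightarrow> grad p \<in> tangent C"
  and grad_vertex: "p \<in> C \<Longrightarrow> x \<in> C - {p} \<Longrightarrow> grad p \<bullet> (x - p) = 1"
  using grad_spec by auto

lemma grad_nonzero:
  assumes p: "p \<in> C" shows "grad p \<noteq> 0"
proof -
  obtain q where "q \<in> C - {p}" using other_vertex[OF p] by blast
  from grad_vertex[OF p this] show ?thesis by auto
qed

lemma grad_opp: "p \<in> C \<Longrightarrow> x \<in> opp p \<Longrightarrow> grad p \<bullet> (x - p) = 1"
proof -
  assume p: "p \<in> C" and x: "x \<in> opp p"
  have "opp p \<subseteq> {x. grad p \<bullet> x = 1 + grad p \<bullet> p}"
    by (rule hull_minimal) (use grad_vertex[OF p] in \<open>auto simp: inner_diff_right convex_hyperplane algebra_simps\<close>)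
  then show ?thesis using x by (auto simp: inner_diff_right)
qed

lemma grad_le_1: "p \<in> C \<Longrightarrow> x \<in> T \<Longrightarrow> grad p \<bullet> (x - p) \<le> 1"
proof -
  assume p: "p \<in> C" and x: "x \<in> T"
  have "grad p \<bullet> y \<le> 1 + grad p \<bullet> p" if "y \<in> C" for y
    using grad_vertex[OF p, of y] that by (cases "y = p") (auto simp: inner_diff_right)
  then have "T \<subseteq> {x. grad p \<bullet> x \<le> 1 + grad p \<bullet> p}"
    by (intro hull_minimal) (auto simp: convex_halfspace_le)
  then show ?thesis using x by (auto simp: inner_diff_right)
qed

text \<open>The facet lies in a hyperplane orthogonal to \<open>n\<close>, so \<open>n\<close> has the same product \<open>c\<close> with every edge
from \<open>p\<close>, just like \<open>c\<close> times the gradient; the norm and the sign of \<open>c\<close> leave one choice.\<close>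

lemma outer_normal_unique:
  assumes p: "p \<in> C" and n: "n \<in> tangent T" "norm n = 1" "\<And>x y. x \<in> opp p \<Longrightarrow> y \<in> T \<Longrightarrow> n \<bullet> (y - x) \<le> 0"
  shows "n = grad p /\<^sub>R norm (grad p)"
proof -
  obtain q where q: "q \<in> C - {p}" using other_vertex p by blast
  have inopp: "x \<in> opp p" "x \<in> T" if "x \<in> C - {p}" for x
    using that hull_inc[of x "C - {p}" convex] hull_inc[of x C convex] by auto
  have pT: "p \<in> T" using p by (simp add: hull_inc)
  define c where "c = n \<bullet> (q - p)"
  have c0: "c \<ge> 0" using n(3)[OF inopp(1)[OF q] pT] by (simp add: c_def inner_diff_right)
  have "n \<bullet> (x - p) = c" if x: "x \<in> C - {p}" for x
    using n(3)[OF inopp(1)[OF q] inopp(2)[OF x]] n(3)[OF inopp(1)[OF x] inopp(2)[OF q]]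
    by (simp add: c_def inner_diff_right)
  then have "n - c *\<^sub>R grad p = 0"
    using n(1) grad_tangent[OF p] grad_vertex[OF p]
    by (intro orth_vertices_zero[OF p]) (auto simp: inner_diff_left subspace_diff subspace_scale)
  then have nc: "n = c *\<^sub>R grad p" by simp
  then have "c * norm (grad p) = 1" using n(2) c0 by simp
  then have "c = inverse (norm (grad p))" using grad_nonzero[OF p] by (simp add: field_simps)
  then show ?thesis using nc by simp
qed

lemma outer_normal_opp:
  assumes p: "p \<in> C"
  shows "outer_normal T (opp p) = grad p /\<^sub>R norm (grad p)"
  unfolding outer_normal_def
proof (rule the_equality)
  have "(grad p /\<^sub>R norm (grad p)) \<bullet> (y - x) \<le> 0" if "x \<in> opp p" "y \<in> T" for x y
  proof -
    have "grad p \<bullet> (y - x) = grad p \<bullet> (y - p) - grad p \<bullet> (x - p)" by (simp add: inner_diff_right)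
    also have "\<dots> \<le> 0" using grad_le_1[OF p that(2)] grad_opp[OF p that(1)] by simp
    finally show ?thesis by (simp add: mult_nonneg_nonpos)
  qed
  then show "grad p /\<^sub>R norm (grad p) \<in> tangent T \<and> norm (grad p /\<^sub>R norm (grad p)) = 1 \<and>
      (\<forall>x\<in>opp p. \<forall>y\<in>T. (grad p /\<^sub>R norm (grad p)) \<bullet> (y - x) \<le> 0)"
    using grad_tangent[OF p] grad_nonzero[OF p] by (auto simp: subspace_scale)
qed (use outer_normal_unique[OF p] in auto)

lemma inner_outer_normal_opp:
  "p \<in> C \<Longrightarrow> v \<bullet> outer_normal T (opp p) = (v \<bullet> grad p) / norm (grad p)"
  by (simp add: outer_normal_opp field_simps)

lemma outer_normal_facet_orth:
  assumes "f facet_of T" "x \<in> f" "y \<in> f"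
  shows "(x - y) \<bullet> outer_normal T f = 0"
proof -
  obtain p where p: "p \<in> C" "f = opp p" using assms facet_iff by auto
  have "(x - y) \<bullet> grad p = 0"
    using grad_opp[OF p(1), of x] grad_opp[OF p(1), of y] assms p
    by (simp add: inner_diff_left inner_diff_right inner_commute)
  then show ?thesis using p by (simp add: inner_outer_normal_opp)
qed

text \<open>The position dependence \<open>b x\<close> of the field is orthogonal to the normal along the facet, so the point
chosen in the definition of the flux is immaterial.\<close>

lemma RT0_flux_constant:
  assumes g: "g \<in> RT0 T" and f: "f facet_of T" and x: "x \<in> f"
  shows "g x \<bullet> outer_normal T f = nflux T f g"
proof -
  have y: "(SOME x. x \<in> f) \<in> f" using x by (rule someI)
  have fT: "f \<subseteq> T" using f by (simp add: facet_of_imp_subset)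
  obtain a b where ab: "\<And>x. x \<in> T \<Longrightarrow> g x = a + b *\<^sub>R x" using g by (auto simp: RT0_def)
  have "(g x - g (SOME x. x \<in> f)) \<bullet> outer_normal T f = b * ((x - (SOME x. x \<in> f)) \<bullet> outer_normal T f)"
    using ab x y fT by (simp add: subset_iff inner_diff_left inner_add_left algebra_simps)
  also have "\<dots> = 0" using outer_normal_facet_orth[OF f x y] by simp
  finally show ?thesis by (simp add: nflux_def inner_diff_left)
qed

text \<open>The normals of the facets through \<open>p\<close> are dual to the edges from \<open>p\<close>, up to sign: each one is
orthogonal to all these edges but one. Hence they detect every edge coefficient of \<open>w\<close>.\<close>

lemma vertex_value_zero:
  assumes p: "p \<in> C" and w: "w \<in> tangent C" and z: "\<And>q. q \<in> C - {p} \<Longrightarrow> w \<bullet> grad q = 0"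
  shows "w = 0"
proof -
  have inj: "inj_on (\<lambda>x. x - p) (C - {p})" by (auto simp: inj_on_def)
  have "w \<in> span ((\<lambda>x. x - p) ` (C - {p}))" using w tangent_span[OF p] by simp
  then obtain u where "w = (\<Sum>v\<in>(\<lambda>x. x - p) ` (C - {p}). u v *\<^sub>R v)"
    using span_finite[of "(\<lambda>x. x - p) ` (C - {p})"] finC by auto
  then have weq: "w = (\<Sum>q\<in>C - {p}. u (q - p) *\<^sub>R (q - p))" using sum.reindex[OF inj] by simp
  have "u (q - p) = 0" if q: "q \<in> C - {p}" for q
  proof -
    have pq: "grad q \<bullet> (p - q) = 1" using grad_vertex[of q p] q p by auto
    have "(q' - p) \<bullet> grad q = (if q' = q then - 1 else 0)" if q': "q' \<in> C - {p}" for q'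
    proof (cases "q' = q")
      case True then show ?thesis using pq by (simp add: inner_diff_left inner_diff_right inner_commute)
    next
      case False
      then have "grad q \<bullet> (q' - q) = 1" using grad_vertex[of q q'] q q' by auto
      then show ?thesis using pq False by (simp add: inner_diff_left inner_diff_right inner_commute)
    qed
    then have "w \<bullet> grad q = (\<Sum>q'\<in>C - {p}. if q' = q then - u (q - p) else 0)"
      unfolding weq inner_sum_left by (intro sum.cong) auto
    also have "\<dots> = - u (q - p)" using q finC by simp
    finally show ?thesis using z[OF q] by simp
  qed
  then show ?thesis unfolding weq by simp
qed

text \<open>At a vertex the fluxes through the adjacent facets determine the field; an affine field that
vanishes at all vertices vanishes on the simplex.\<close>

lemma RT0_unisolvent:
  assumes g: "g \<in> RT0 T" and flux: "\<And>f. f facet_of T \<Longrightarrow> nflux T f g = 0"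
  shows "g = 0"
proof -
  obtain a b where ab: "\<And>x. x \<in> T \<Longrightarrow> g x = a + b *\<^sub>R x" using g by (auto simp: RT0_def)
  have v: "g p = 0" if p: "p \<in> C" for p
  proof (rule vertex_value_zero[OF p])
    show "g p \<in> tangent C" using g p by (auto simp: RT0_def hull_inc)
    fix q assume q: "q \<in> C - {p}"
    then have "opp q facet_of T" "p \<in> opp q" using p by (auto simp: facet_iff hull_inc)
    then have "g p \<bullet> outer_normal T (opp q) = 0" using RT0_flux_constant[OF g] flux by simp
    then show "g p \<bullet> grad q = 0" using q grad_nonzero by (simp add: inner_outer_normal_opp)
  qed
  have "convex {x. a + b *\<^sub>R x = 0}"
  proof (rule convexI)
    fix x y :: 'a and u v :: real
    assume *: "x \<in> {x. a + b *\<^sub>R x = 0}" "y \<in> {x. a + b *\<^sub>R x = 0}" "0 \<le> u" "0 \<le> v" "u + v = 1"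
    have "a + b *\<^sub>R (u *\<^sub>R x + v *\<^sub>R y) = (u + v) *\<^sub>R a + b *\<^sub>R (u *\<^sub>R x + v *\<^sub>R y)" using * by simp
    also have "\<dots> = u *\<^sub>R (a + b *\<^sub>R x) + v *\<^sub>R (a + b *\<^sub>R y)" by (simp add: algebra_simps)
    also have "\<dots> = 0" using * by simp
    finally show "u *\<^sub>R x + v *\<^sub>R y \<in> {x. a + b *\<^sub>R x = 0}" by simp
  qed
  moreover have "C \<subseteq> {x. a + b *\<^sub>R x = 0}" using v ab by (auto simp: hull_inc)
  ultimately have "T \<subseteq> {x. a + b *\<^sub>R x = 0}" by (rule hull_minimal[rotated])
  then have "g x = 0" for x using ab g by (cases "x \<in> T") (auto simp: RT0_def)
  then show ?thesis by (simp add: fun_eq_iff)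
qed

text \<open>The Raviart-Thomas basis field of the facet opposite to \<open>p\<close>: it points away from \<open>p\<close>, hence is
tangential to all facets through \<open>p\<close>; the factor is the inverse height of the simplex over the facet.\<close>

definition vertex_field :: "'a \<Rightarrow> 'a \<Rightarrow> 'a" where
  "vertex_field p x = (if x \<in> T then norm (grad p) *\<^sub>R (x - p) else 0)"

lemma vertex_field_RT0: "p \<in> C \<Longrightarrow> vertex_field p \<in> RT0 T"
proof -
  assume p: "p \<in> C"
  have "\<forall>x\<in>T. vertex_field p x = - (norm (grad p) *\<^sub>R p) + norm (grad p) *\<^sub>R x" by (simp add: vertex_field_def algebra_simps)
  moreover have "\<forall>x\<in>T. vertex_field p x \<in> tangent T"
  proof
    fix x assume x: "x \<in> T"
    have "x - p \<in> tangent T" by (rule diff_in_tangent) (use x p in \<open>auto simp: hull_inc\<close>)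
    then show "vertex_field p x \<in> tangent T" using x by (simp add: vertex_field_def subspace_scale del: tangent_convex_hull)
  qed
  moreover have "\<forall>x. x \<notin> T \<longrightarrow> vertex_field p x = 0" by (simp add: vertex_field_def)
  ultimately show ?thesis unfolding RT0_def by blast
qed

lemma vertex_field_flux:
  assumes p: "p \<in> C" and f: "f facet_of T" "x \<in> f"
  shows "vertex_field p x \<bullet> outer_normal T f = (if f = opp p then 1 else 0)"
proof -
  have xT: "x \<in> T" using f facet_of_imp_subset by blast
  obtain q where q: "q \<in> C" "f = opp q" using f facet_iff by auto
  show ?thesis
  proof (cases "q = p")
    case True
    then show ?thesis using q xT grad_opp[OF p, of x] f grad_nonzero[OF p]
      by (simp add: inner_outer_normal_opp inner_commute vertex_field_def)
  next
    case False
    have "(x - p) \<bullet> grad q = 0"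
      using grad_opp[OF q(1), of x] grad_vertex[OF q(1), of p] p False f q
      by (simp add: inner_diff_left inner_diff_right inner_commute)
    moreover have "f \<noteq> opp p"
    proof
      assume "f = opp p"
      moreover have "q \<in> opp p" using q False by (auto simp: hull_inc)
      ultimately show False using grad_opp[OF q(1), of q] q by simp
    qed
    ultimately show ?thesis using q xT by (simp add: inner_outer_normal_opp vertex_field_def)
  qed
qed

lemma facet_point: "f facet_of T \<Longrightarrow> (SOME x. x \<in> f) \<in> f"
  by (simp add: facet_of_def some_in_eq)

lemma RT_basis_opp:
  assumes p: "p \<in> C"
  shows "RT_basis T (opp p) = vertex_field p"
  unfolding RT_basis_def
proof (rule the_equality)
  show "vertex_field p \<in> RT0 T \<and> (\<forall>f'. f' facet_of T \<longrightarrow>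
      (\<forall>x\<in>f'. vertex_field p x \<bullet> outer_normal T f' = (if f' = opp p then 1 else 0)))"
    using vertex_field_RT0 vertex_field_flux p by simp
  fix g assume g: "g \<in> RT0 T \<and> (\<forall>f'. f' facet_of T \<longrightarrow>
      (\<forall>x\<in>f'. g x \<bullet> outer_normal T f' = (if f' = opp p then 1 else 0)))"
  have "g - vertex_field p = 0"
  proof (rule RT0_unisolvent[OF subspace_diff[OF subspace_RT0]])
    show "g \<in> RT0 T" "vertex_field p \<in> RT0 T" using g vertex_field_RT0[OF p] by auto
    fix f assume f: "f facet_of T"
    have "g (SOME x. x \<in> f) \<bullet> outer_normal T f = (if f = opp p then 1 else 0)"
      using g f facet_point[OF f] by blast
    then show "nflux T f (g - vertex_field p) = 0"
      using vertex_field_flux[OF p f facet_point[OF f]] by (simp add: nflux_def inner_diff_left)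
  qed
  then show "g = vertex_field p" by simp
qed

text \<open>A basis field vanishes only at a vertex, and a vertex lies on a facet, not in the relative
interior.\<close>

lemma RT_basis_props:
  assumes f: "f facet_of T"
  shows RT_basis_RT0: "RT_basis T f \<in> RT0 T"
    and nflux_RT_basis: "f' facet_of T \<Longrightarrow> nflux T f' (RT_basis T f) = (if f' = f then 1 else 0)"
    and RT_basis_nonzero: "x \<in> rel_interior T \<Longrightarrow> RT_basis T f x \<noteq> 0"
proof -
  obtain p where p: "p \<in> C" "f = opp p" using f facet_iff by auto
  note eq = RT_basis_opp[OF p(1), folded p(2)]
  show "RT_basis T f \<in> RT0 T" unfolding eq by (rule vertex_field_RT0[OF p(1)])
  show "nflux T f' (RT_basis T f) = (if f' = f then 1 else 0)" if "f' facet_of T"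
    unfolding eq nflux_def using vertex_field_flux[OF p(1) that facet_point[OF that]] p(2) by simp
  show "RT_basis T f x \<noteq> 0" if x: "x \<in> rel_interior T"
  proof -
    obtain q where q: "q \<in> C - {p}" using other_vertex p by blast
    then have "opp q facet_of T" "p \<in> opp q" using p by (auto simp: facet_iff hull_inc)
    then have "opp q face_of T" "opp q \<noteq> T" "p \<in> opp q" by (auto simp: facet_of_def)
    then have "x \<noteq> p" using face_of_disjoint_rel_interior x by blast
    then show ?thesis using x rel_interior_subset[of T] grad_nonzero[OF p(1)] unfolding eq by (auto simp: vertex_field_def)
  qed
qed

text \<open>In terms of edges from \<open>p\<close> the coefficients of \<open>w\<close> sum to \<open>0\<close>, so \<open>p\<close> may be replaced by any
other vertex \<open>q0\<close>.\<close>

lemma tangent_opp: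
  assumes p: "p \<in> C" and w: "w \<in> tangent T" "grad p \<bullet> w = 0"
  shows "w \<in> tangent (opp p)"
proof -
  obtain q0 where q0: "q0 \<in> C - {p}" using other_vertex p by blast
  have inj: "inj_on (\<lambda>x. x - p) (C - {p})" by (auto simp: inj_on_def)
  have "w \<in> span ((\<lambda>x. x - p) ` (C - {p}))" using w tangent_span[OF p] by simp
  then obtain u where "w = (\<Sum>v\<in>(\<lambda>x. x - p) ` (C - {p}). u v *\<^sub>R v)"
    using span_finite[of "(\<lambda>x. x - p) ` (C - {p})"] finC by auto
  then have weq: "w = (\<Sum>q\<in>C - {p}. u (q - p) *\<^sub>R (q - p))" using sum.reindex[OF inj] by simp
  have "grad p \<bullet> w = (\<Sum>q\<in>C - {p}. u (q - p))"
    unfolding weq inner_sum_right by (rule sum.cong) (use grad_vertex[OF p] in auto)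
  then have "(\<Sum>q\<in>C - {p}. u (q - p)) *\<^sub>R (q0 - p) = 0" using w by simp
  then have "w = (\<Sum>q\<in>C - {p}. u (q - p) *\<^sub>R (q - p)) - (\<Sum>q\<in>C - {p}. u (q - p)) *\<^sub>R (q0 - p)" using weq by simp
  also have "\<dots> = (\<Sum>q\<in>C - {p}. u (q - p) *\<^sub>R (q - q0))"
    unfolding scaleR_sum_left sum_subtractf[symmetric] by (rule sum.cong) (auto simp: algebra_simps)
  also have "\<dots> \<in> tangent (opp p)"
    unfolding tangent_convex_hull
    by (intro subspace_sum subspace_scale subspace_tangent diff_in_tangent) (use q0 in auto)
  finally show ?thesis .
qed

text \<open>The point \<open>x - t n\<close> lies on the segment from \<open>p\<close> to a point \<open>m\<close> of the hyperplane of the facet,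
and \<open>m\<close> tends to \<open>x\<close> as \<open>t\<close> tends to \<open>0\<close>. Once \<open>m\<close> is in the relative interior of the facet, all
barycentric coordinates of \<open>x - t n\<close> are positive.\<close>

lemma facet_approach_interior:
  assumes f: "f facet_of T" and x: "x \<in> rel_interior f"
  shows "\<exists>\<epsilon>>0. \<forall>t\<in>{0<..<\<epsilon>}. x - t *\<^sub>R outer_normal T f \<in> rel_interior T"
proof -
  obtain p where p: "p \<in> C" "f = opp p" using f facet_iff by auto
  define N where "N = norm (grad p)"
  define n where "n = outer_normal T f"
  have N: "N > 0" using grad_nonzero p by (simp add: N_def)
  have n: "n = grad p /\<^sub>R N" by (simp add: n_def N_def outer_normal_opp p)
  have nt: "n \<in> tangent T" using grad_tangent[OF p(1)] by (simp add: n subspace_scale)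
  have gn: "grad p \<bullet> n = N" using N unfolding n N_def by (simp add: dot_square_norm power2_eq_square)
  have xf: "x \<in> f" using x rel_interior_subset by blast
  have xT: "x \<in> T" using xf f facet_of_imp_subset by blast
  have pT: "p \<in> T" using p by (simp add: hull_inc)
  obtain e where e: "e > 0" "ball x e \<inter> affine hull f \<subseteq> rel_interior f"
    using openin_rel_interior[of f, unfolded openin_contains_ball] x by blast
  define K where "K = norm (N *\<^sub>R (x - p) - n)"
  \<comment> \<open>the first bound keeps \<open>s = t N\<close> below \<open>1 / 2\<close>; then \<open>m\<close> differs from \<open>x\<close> by at most \<open>2 t K\<close>\<close>
  define \<epsilon> where "\<epsilon> = min (1 / (2 * N)) (e / (2 * K + 1))"
  have K: "K \<ge> 0" by (simp add: K_def)
  have \<epsilon>: "\<epsilon> > 0" using N K e by (simp add: \<epsilon>_def)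
  show ?thesis
  proof (intro exI[of _ \<epsilon>] conjI ballI \<epsilon>)
    fix t assume t: "t \<in> {0<..<\<epsilon>}"
    then have t1: "t > 0" "t * N < 1 / 2" "t * (2 * K + 1) < e"
      using N K by (auto simp: \<epsilon>_def field_simps)
    \<comment> \<open>the barycentric coordinate of \<open>x - t n\<close> with respect to \<open>p\<close>\<close>
    define s where "s = t * N"
    have s: "0 < s" "s < 1 / 2" using t1 N by (auto simp: s_def)
    define y where "y = x - t *\<^sub>R n"
    define w where "w = s *\<^sub>R (x - p) - t *\<^sub>R n"
    define m where "m = x + w /\<^sub>R (1 - s)"
    have "w \<in> tangent T"
      unfolding w_def by (intro subspace_diff subspace_scale subspace_tangent nt diff_in_tangent xT pT)
    moreover have "grad p \<bullet> w = 0"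
      using grad_opp[OF p(1), of x] xf p(2) gn by (simp add: w_def s_def inner_diff_right algebra_simps)
    ultimately have wt: "w \<in> tangent f" using tangent_opp p by simp
    have "m \<in> affine hull f"
      unfolding affine_hull_eq_translate_tangent[OF xf] m_def using wt by (simp add: subspace_scale)
    moreover have "norm (m - x) < e"
    proof -
      have "w = t *\<^sub>R (N *\<^sub>R (x - p) - n)" by (simp add: w_def s_def algebra_simps)
      then have "norm w = t * K" using t1 by (simp add: K_def)
      moreover have "norm (m - x) = inverse (1 - s) * norm w" using s by (simp add: m_def)
      ultimately have "norm (m - x) = t * K / (1 - s)" by (simp add: divide_inverse)
      also have "\<dots> \<le> t * K / (1 / 2)" using s t1 K by (intro divide_left_mono) auto
      also have "\<dots> < e" using t1 by (simp add: algebra_simps)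
      finally show ?thesis .
    qed
    ultimately have "m \<in> rel_interior f" using e(2) by (auto simp: dist_norm norm_minus_commute)
    moreover have "\<not> affine_dependent (C - {p})" using indep affine_dependent_subset by blast
    ultimately obtain u where u: "\<forall>q\<in>C - {p}. 0 < u q" "sum u (C - {p}) = 1" "(\<Sum>q\<in>C - {p}. u q *\<^sub>R q) = m"
      unfolding p(2) by (subst (asm) rel_interior_convex_hull_explicit) blast+
    have yeq: "(1 - s) *\<^sub>R m + s *\<^sub>R p = y"
    proof -
      have "(1 - s) *\<^sub>R m = (1 - s) *\<^sub>R x + w" 
        unfolding m_def scaleR_add_right using s by simp
      then show ?thesis by (simp add: w_def y_def algebra_simps)
    qed
    define u' where "u' q = (if q = p then s else (1 - s) * u q)" for q
    have "(\<Sum>q\<in>C. u' q *\<^sub>R q) = s *\<^sub>R p + (\<Sum>q\<in>C - {p}. ((1 - s) * u q) *\<^sub>R q)"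
      using p finC by (subst sum.remove[of _ p]) (auto simp: u'_def intro!: sum.cong)
    also have "(\<Sum>q\<in>C - {p}. ((1 - s) * u q) *\<^sub>R q) = (1 - s) *\<^sub>R m"
      unfolding u(3)[symmetric] scaleR_sum_right by simp
    finally have "(\<Sum>q\<in>C. u' q *\<^sub>R q) = y" using yeq by (simp add: add.commute)
    moreover have "sum u' C = s + (\<Sum>q\<in>C - {p}. (1 - s) * u q)"
      using p finC by (subst sum.remove[of _ p]) (auto simp: u'_def intro!: sum.cong)
    then have "sum u' C = 1" using u(2) by (simp flip: sum_distrib_left)
    moreover have "\<forall>q\<in>C. 0 < u' q" using u(1) s by (auto simp: u'_def)
    ultimately show "x - t *\<^sub>R outer_normal T f \<in> rel_interior T"
      unfolding rel_interior_convex_hull_explicit[OF indep] n_def[symmetric] y_def[symmetric]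
      by blast
  qed
qed

end

section \<open>Triangulations, piecewise constants and divergences\<close>

text \<open>Simplices of positive dimension. The facts above carry over, freed from the choice of the vertex set.\<close>

definition solid :: "'a::euclidean_space set \<Rightarrow> bool" where
  "solid T \<longleftrightarrow> (\<exists>C. simplex_vertices C \<and> T = convex hull C)"

lemma solid_simplex: "int (Suc d) simplex T \<Longrightarrow> solid T"
  unfolding simplex_def solid_def simplex_vertices_def by force

lemma solidE:
  assumes "solid T" obtains C where "simplex_vertices C" "T = convex hull C"
  using assms by (auto simp: solid_def)

lemma solid_finite_facets: "solid T \<Longrightarrow> finite {f. f facet_of T}"
  by (erule solidE) (simp add: simplex_vertices.finite_facets)

lemma solid_unisolvent: "solid T \<Longrightarrow> g \<in> RT0 T \<Longrightarrow> (\<And>f. f facet_of T \<Longrightarrow> nflux T f g = 0) \<Longrightarrow> g = 0"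
  by (erule solidE) (simp add: simplex_vertices.RT0_unisolvent)

lemma solid_basis_RT0: "solid T \<Longrightarrow> f facet_of T \<Longrightarrow> RT_basis T f \<in> RT0 T"
  by (erule solidE) (simp add: simplex_vertices.RT_basis_RT0)

lemma solid_nflux_basis: "solid T \<Longrightarrow> f facet_of T \<Longrightarrow> f' facet_of T \<Longrightarrow>
    nflux T f' (RT_basis T f) = (if f' = f then 1 else 0)"
  by (erule solidE) (simp add: simplex_vertices.nflux_RT_basis)

lemma solid_basis_nonzero: "solid T \<Longrightarrow> f facet_of T \<Longrightarrow> x \<in> rel_interior T \<Longrightarrow> RT_basis T f x \<noteq> 0"
  by (erule solidE) (simp add: simplex_vertices.RT_basis_nonzero)

lemma solid_approach:
  "solid T \<Longrightarrow> f facet_of T \<Longrightarrow> x \<in> rel_interior f \<Longrightarrow>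
    \<exists>\<epsilon>>0. \<forall>t\<in>{0<..<\<epsilon>}. x - t *\<^sub>R outer_normal T f \<in> rel_interior T"
  by (erule solidE) (simp add: simplex_vertices.facet_approach_interior)

lemma simplex_convex: "n simplex T \<Longrightarrow> convex T"
  by (auto simp: simplex_def)

lemma simplex_compact: "n simplex T \<Longrightarrow> compact T"
  unfolding simplex_def by (auto intro: compact_convex_hull finite_imp_compact aff_independent_finite)

lemma simplex_nonempty: "int n simplex T \<Longrightarrow> T \<noteq> {}"
  by (auto simp: simplex_def)

lemma simplex_rel_interior_nonempty: "int n simplex T \<Longrightarrow> rel_interior T \<noteq> {}"
  using simplex_convex simplex_nonempty rel_interior_eq_empty by blast

lemma rel_interior_borel [simp]: "rel_interior T \<in> sets borel" for T :: "'a::euclidean_space set"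
  by (rule openin_affine_hull_borel[OF openin_rel_interior])

lemma facet_rel_interior_nonempty:
  fixes T :: "'a::euclidean_space set"
  assumes "convex T" "f facet_of T" shows "rel_interior f \<noteq> {}"
  using assms by (metis facet_of_def face_of_imp_convex rel_interior_eq_empty)

text \<open>Ensures that the flat measure of a subdomain is the flat measure of each of its mesh cells.\<close>

lemma affine_hull_eq_of_rel_interior:
  fixes T S :: "'a::euclidean_space set"
  assumes "convex T" "T \<noteq> {}" "rel_interior T \<subseteq> S" "aff_dim T = aff_dim S"
  shows "affine hull T = affine hull S"
proof (rule affine_dim_equal)
  show "affine hull T \<subseteq> affine hull S"
    using hull_mono[OF assms(3), of affine] rel_interior_same_affine_hull[OF assms(1)] by simp
qed (use assms in auto)

text \<open>The intersection of two cells is a face of both, and a face that meets the relative interior is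
the whole cell.\<close>

lemma triangulation_rel_interior_unique:
  assumes tr: "triangulation \<T>" and "T \<in> \<T>" "T' \<in> \<T>" "x \<in> rel_interior T" "x \<in> rel_interior T'"
  shows "T = T'"
proof -
  have "T \<inter> T' face_of T" "T' \<inter> T face_of T'" using assms unfolding triangulation_def by blast+
  moreover have "x \<in> T" "x \<in> T'" using assms(4,5) rel_interior_subset by blast+
  ultimately have "T \<inter> T' = T" "T' \<inter> T = T'"
    using face_of_disjoint_rel_interior assms(4,5) by blast+
  then show ?thesis by blast
qed

lemma P0_iff: "q \<in> P0 \<T> \<longleftrightarrow> (\<forall>T\<in>\<T>. \<forall>x\<in>rel_interior T. \<forall>y\<in>rel_interior T. q x = q y) \<and>
    (\<forall>x. (\<forall>T\<in>\<T>. x \<notin> rel_interior T) \<longrightarrow> q x = 0)"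
proof -
  have "q constant_on A \<longleftrightarrow> (\<forall>x\<in>A. \<forall>y\<in>A. q x = q y)" for A
  proof
    assume *: "\<forall>x\<in>A. \<forall>y\<in>A. q x = q y"
    show "q constant_on A"
      unfolding constant_on_def
    proof (intro exI ballI)
      fix x assume x: "x \<in> A"
      then have "(SOME x. x \<in> A) \<in> A" by (rule someI)
      with * x show "q x = q (SOME x. x \<in> A)" by blast
    qed
  qed (auto simp: constant_on_def)
  then show ?thesis by (simp add: P0_def)
qed

lemma P0_same: "q \<in> P0 \<T> \<Longrightarrow> T \<in> \<T> \<Longrightarrow> x \<in> rel_interior T \<Longrightarrow> y \<in> rel_interior T \<Longrightarrow> q x = q y"
  and P0_off: "q \<in> P0 \<T> \<Longrightarrow> \<forall>T\<in>\<T>. x \<notin> rel_interior T \<Longrightarrow> q x = 0"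
  unfolding P0_iff by blast+

lemma subspace_P0: "subspace (P0 \<T>)"
proof (rule subspaceI)
  show "0 \<in> P0 \<T>" by (simp add: P0_iff)
  show "f + g \<in> P0 \<T>" if "f \<in> P0 \<T>" "g \<in> P0 \<T>" for f g
    unfolding P0_iff plus_fun_apply
  proof (intro conjI ballI allI impI)
    show "f x + g x = f y + g y" if "T \<in> \<T>" "x \<in> rel_interior T" "y \<in> rel_interior T" for T x y
      using P0_same[OF \<open>f \<in> P0 \<T>\<close> that] P0_same[OF \<open>g \<in> P0 \<T>\<close> that] by simp
    show "f x + g x = 0" if "\<forall>T\<in>\<T>. x \<notin> rel_interior T" for x
      using P0_off[OF \<open>f \<in> P0 \<T>\<close> that] P0_off[OF \<open>g \<in> P0 \<T>\<close> that] by simp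
  qed
  show "c *\<^sub>R f \<in> P0 \<T>" if "f \<in> P0 \<T>" for c f
    unfolding P0_iff scaleR_fun_def
  proof (intro conjI ballI allI impI)
    show "c *\<^sub>R f x = c *\<^sub>R f y" if "T \<in> \<T>" "x \<in> rel_interior T" "y \<in> rel_interior T" for T x y
      using P0_same[OF \<open>f \<in> P0 \<T>\<close> that] by simp
    show "c *\<^sub>R f x = 0" if "\<forall>T\<in>\<T>. x \<notin> rel_interior T" for x
      using P0_off[OF \<open>f \<in> P0 \<T>\<close> that] by simp
  qed
qed

lemma P0_zeroI:
  assumes q: "q \<in> P0 \<T>" and z: "\<And>T. T \<in> \<T> \<Longrightarrow> \<exists>x\<in>rel_interior T. q x = 0"
  shows "q = 0"
proof
  fix x show "q x = 0 x"
  proof (cases "\<exists>T\<in>\<T>. x \<in> rel_interior T")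
    case True
    then obtain T where T: "T \<in> \<T>" "x \<in> rel_interior T" by blast
    then obtain y where "y \<in> rel_interior T" "q y = 0" using z by blast
    then show ?thesis using P0_same[OF q T] by simp
  next
    case False
    then show ?thesis using P0_off[OF q, of x] by simp
  qed
qed

text \<open>Each point is in the relative interior of at most one cell, so the function is a finite sum of
multiples of indicators.\<close>

lemma P0_tame:
  assumes tr: "triangulation \<T>" and q: "q \<in> P0 \<T>" shows "tame q"
proof -
  define z where "z T = (SOME x. x \<in> rel_interior T)" for T :: "'a set"
  have fin: "finite \<T>" using tr by (simp add: triangulation_def)
  have eq: "q = (\<lambda>x. \<Sum>T\<in>\<T>. q (z T) * indicator (rel_interior T) x)"
  proof
    fix x
    show "q x = (\<Sum>T\<in>\<T>. q (z T) * indicator (rel_interior T) x)"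
    proof (cases "\<exists>T\<in>\<T>. x \<in> rel_interior T")
      case True
      then obtain T where T: "T \<in> \<T>" "x \<in> rel_interior T" by blast
      have "z T \<in> rel_interior T" unfolding z_def using T(2) by (rule someI)
      then have qz: "q (z T) = q x" using P0_same[OF q T(1)] T(2) by blast
      have "(\<Sum>T'\<in>\<T>. q (z T') * indicator (rel_interior T') x) = (\<Sum>T'\<in>\<T>. if T' = T then q x else 0)"
      proof (rule sum.cong)
        fix T' assume T': "T' \<in> \<T>"
        show "q (z T') * indicator (rel_interior T') x = (if T' = T then q x else 0)"
        proof (cases "T' = T")
          case False
          then have "x \<notin> rel_interior T'"
            using triangulation_rel_interior_unique[OF tr T' T(1) _ T(2)] by blast
          then show ?thesis using False by simp
        qed (use T qz in simp)
      qed simp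
      then show ?thesis using fin T by simp
    next
      case False
      then have "q x = 0" using P0_off[OF q] by blast
      then show ?thesis using False by (simp add: indicator_def)
    qed
  qed
  have "tame (\<lambda>x. \<Sum>T\<in>\<T>. q (z T) * indicator (rel_interior T) x)"
  proof (intro tame_sum tame_cmult tame_indicator)
    fix T assume "T \<in> \<T>"
    then obtain n where "n simplex T" using tr unfolding triangulation_def by blast
    then show "bounded (rel_interior T)"
      by (rule bounded_subset[OF compact_imp_bounded[OF simplex_compact] rel_interior_subset])
  qed simp
  then show ?thesis using eq by simp
qed

text \<open>Along a unit tangent vector \<open>e\<close> the field \<open>a + b x\<close> has derivative \<open>b e\<close>; in a relative
interior point short steps in tangential directions stay in \<open>T\<close>.\<close>

lemma flat_div_affine:
  fixes g :: "'a::euclidean_space \<Rightarrow> 'a"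
  assumes g: "\<And>y. y \<in> T \<Longrightarrow> g y = a + b *\<^sub>R y" and x: "x \<in> rel_interior T"
  shows "flat_div (tangent T) g x = b * real (dim (tangent T))"
proof -
  have "vector_derivative (\<lambda>t. g (x + t *\<^sub>R onb (tangent T) k)) (at 0) \<bullet> onb (tangent T) k = b"
    if k: "k < dim (tangent T)" for k
  proof -
    let ?e = "onb (tangent T) k"
    have xT: "x \<in> T" using x rel_interior_subset by blast
    have e1: "?e \<bullet> ?e = 1" using onb_inner[OF subspace_tangent k k] by simp
    obtain \<delta> where \<delta>: "\<delta> > 0" "ball x \<delta> \<inter> affine hull T \<subseteq> rel_interior T"
      using openin_rel_interior[of T, unfolded openin_contains_ball] x by blast
    have inT: "x + t *\<^sub>R ?e \<in> T" if t: "\<bar>t\<bar> < \<delta>" for t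
    proof -
      have "x + t *\<^sub>R ?e \<in> affine hull T"
        unfolding affine_hull_eq_translate_tangent[OF xT] using onb_mem[OF subspace_tangent k]
        by (simp add: subspace_scale)
      moreover have "x + t *\<^sub>R ?e \<in> ball x \<delta>" using t e1 by (simp add: dist_norm norm_eq_sqrt_inner)
      ultimately show ?thesis using \<delta>(2) rel_interior_subset by blast
    qed
    have "((\<lambda>t. a + b *\<^sub>R (x + t *\<^sub>R ?e)) has_vector_derivative b *\<^sub>R ?e) (at 0)"
      by (auto intro!: derivative_eq_intros)
    then have "((\<lambda>t. g (x + t *\<^sub>R ?e)) has_vector_derivative b *\<^sub>R ?e) (at 0)"
      by (rule has_vector_derivative_transform_within[where d = \<delta>]) (use \<delta> g inT in \<open>auto simp: dist_real_def\<close>)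
    then have "vector_derivative (\<lambda>t. g (x + t *\<^sub>R ?e)) (at 0) = b *\<^sub>R ?e"
      by (rule vector_derivative_at)
    then show ?thesis using e1 by simp
  qed
  then show ?thesis unfolding flat_div_def by simp
qed

lemma flat_div_RT0_const:
  assumes "g \<in> RT0 T" shows "\<exists>c. \<forall>x\<in>rel_interior T. flat_div (tangent T) g x = c"
proof -
  obtain a b where "\<forall>x\<in>T. g x = a + b *\<^sub>R x" using assms unfolding RT0_iff by blast
  then show ?thesis using flat_div_affine[of T g a b] by blast
qed

lemma flat_div_lin:
  assumes "x \<in> rel_interior T"
  shows "lin_on (RT0 T) (\<lambda>g. flat_div (tangent T) g x)"
proof (rule lin_onI)
  fix g h assume "g \<in> RT0 T" "h \<in> RT0 T"
  then obtain a b c d where g: "\<forall>x\<in>T. g x = a + b *\<^sub>R x" and h: "\<forall>x\<in>T. h x = c + d *\<^sub>R x"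
    unfolding RT0_iff by blast
  have "(g + h) y = (a + c) + (b + d) *\<^sub>R y" if "y \<in> T" for y using g h that by (simp add: algebra_simps)
  then show "flat_div (tangent T) (g + h) x = flat_div (tangent T) g x + flat_div (tangent T) h x"
    using flat_div_affine[of T g a b] flat_div_affine[of T h c d] flat_div_affine[of T "g + h" "a + c" "b + d"] g h assms
    by (simp add: algebra_simps)
next
  fix k g assume "g \<in> RT0 T"
  then obtain a b where g: "\<forall>x\<in>T. g x = a + b *\<^sub>R x" unfolding RT0_iff by blast
  have "(k *\<^sub>R g) y = (k *\<^sub>R a) + (k * b) *\<^sub>R y" if "y \<in> T" for y
    using g that by (simp add: scaleR_fun_def algebra_simps)
  then show "flat_div (tangent T) (k *\<^sub>R g) x = k * flat_div (tangent T) g x"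
    using flat_div_affine[of T g a b] flat_div_affine[of T "k *\<^sub>R g" "k *\<^sub>R a" "k * b"] g assms by simp
qed

section \<open>Elliptic tensors on a subspace\<close>

text \<open>The permeability acts on the tangent space of a subdomain; its values elsewhere are unspecified,
so its inverse is taken on this subspace.\<close>

locale spd_on =
  fixes U :: "'a::euclidean_space set" and K :: "'a \<Rightarrow> 'a" and c :: real
  assumes U: "subspace U" and linK: "linear K" and KU: "K ` U \<subseteq> U"
    and symK: "\<And>x y. x \<in> U \<Longrightarrow> y \<in> U \<Longrightarrow> K x \<bullet> y = x \<bullet> K y"
    and c: "c > 0" and ell: "\<And>x. x \<in> U \<Longrightarrow> c * (x \<bullet> x) \<le> K x \<bullet> x"
begin

abbreviation Ki where "Ki \<equiv> inv_into U K"

lemma inj: "inj_on K U"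
proof (rule inj_onI)
  fix x y assume xy: "x \<in> U" "y \<in> U" "K x = K y"
  have "K (x - y) = 0" using xy linear_diff[OF linK] by simp
  then have "c * ((x - y) \<bullet> (x - y)) \<le> 0" using ell[of "x - y"] xy subspace_diff[OF U] by simp
  then have "(x - y) \<bullet> (x - y) \<le> 0" using c by (simp add: mult_le_0_iff)
  then have "(x - y) \<bullet> (x - y) = 0" using inner_ge_zero[of "x - y"] by linarith
  then show "x = y" by simp
qed

lemma surj: "K ` U = U"
proof (rule subspace_dim_equal)
  have sp: "span U = U" using U by (simp add: span_eq_iff)
  show "dim U \<le> dim (K ` U)" using dim_image_eq[OF linK, of U] inj sp by simp
qed (use U KU linK linear_subspace_image in auto)

lemma Ki_mem: "x \<in> U \<Longrightarrow> Ki x \<in> U"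
  by (rule inv_into_into) (simp add: surj)
lemma K_Ki: "x \<in> U \<Longrightarrow> K (Ki x) = x"
  by (rule f_inv_into_f) (simp add: surj)
lemma Ki_eqI: "y \<in> U \<Longrightarrow> K y = x \<Longrightarrow> Ki x = y"
  using inv_into_f_f[OF inj] by auto

lemma Ki_lin:
  assumes "x \<in> U" "y \<in> U"
  shows "Ki (x + y) = Ki x + Ki y" "Ki (r *\<^sub>R x) = r *\<^sub>R Ki x"
proof -
  show "Ki (x + y) = Ki x + Ki y"
    by (rule Ki_eqI) (use assms K_Ki Ki_mem linear_add[OF linK] subspace_add[OF U] in auto)
  show "Ki (r *\<^sub>R x) = r *\<^sub>R Ki x"
    by (rule Ki_eqI) (use assms K_Ki Ki_mem linear_cmul[OF linK] subspace_scale[OF U] in auto)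
qed

lemma Ki_sym: "x \<in> U \<Longrightarrow> y \<in> U \<Longrightarrow> Ki x \<bullet> y = Ki y \<bullet> x"
  using symK[OF Ki_mem[of x] Ki_mem[of y]] K_Ki[of x] K_Ki[of y] by (simp add: inner_commute)

lemma Ki_ell: "x \<in> U \<Longrightarrow> c * (Ki x \<bullet> Ki x) \<le> Ki x \<bullet> x"
  using ell[OF Ki_mem[of x]] K_Ki[of x] by (simp add: inner_commute)

lemma Ki_nonneg: "x \<in> U \<Longrightarrow> Ki x \<bullet> x \<ge> 0"
  by (rule order_trans[OF _ Ki_ell]) (use c in auto)

lemma Ki_zero_iff: "x \<in> U \<Longrightarrow> Ki x \<bullet> x = 0 \<Longrightarrow> x = 0"
proof -
  assume x: "x \<in> U" "Ki x \<bullet> x = 0"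
  then have "c * (Ki x \<bullet> Ki x) \<le> 0" using Ki_ell[of x] by simp
  then have "Ki x \<bullet> Ki x \<le> 0" using c by (simp add: mult_le_0_iff)
  then have "Ki x \<bullet> Ki x = 0" using inner_ge_zero[of "Ki x"] by linarith
  then have "Ki x = 0" by simp
  then show "x = 0" using K_Ki[OF x(1)] linear_0[OF linK] by simp
qed

text \<open>Ellipticity and Cauchy-Schwarz. As the inverse is linear on \<open>U\<close>, this bound makes it continuous
and hence makes the integrands of the flux form integrable.\<close>

lemma Ki_bound: "x \<in> U \<Longrightarrow> norm (Ki x) \<le> norm x / c"
proof -
  assume x: "x \<in> U"
  have "c * (norm (Ki x) * norm (Ki x)) \<le> norm (Ki x) * norm x"
    using Ki_ell[OF x] norm_cauchy_schwarz[of "Ki x" x] by (simp add: dot_square_norm power2_eq_square)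
  then have "norm (Ki x) * (c * norm (Ki x)) \<le> norm (Ki x) * norm x" by (simp add: ac_simps)
  then have "c * norm (Ki x) \<le> norm x \<or> norm (Ki x) = 0"
    using mult_le_cancel_left_pos[of "norm (Ki x)" "c * norm (Ki x)" "norm x"] by (cases "Ki x = 0") auto
  then show ?thesis using c by (auto simp: field_simps)
qed

lemma Ki_continuous: "continuous_on U Ki"
proof (rule continuous_onI)
  fix x e assume x: "x \<in> U" and e: "(0::real) < e"
  have "dist (Ki x') (Ki x) \<le> e" if x': "x' \<in> U" "dist x' x < c * e" for x'
  proof -
    have "Ki x' = Ki (x' - x) + Ki x"
      using Ki_lin(1)[of "x' - x" x] x x' subspace_diff[OF U] by simp
    then have "dist (Ki x') (Ki x) = norm (Ki (x' - x))" by (simp add: dist_norm)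
    also have "\<dots> \<le> norm (x' - x) / c" using Ki_bound subspace_diff[OF U x'(1) x] by blast
    also have "\<dots> \<le> e" using x' c by (simp add: dist_norm field_simps)
    finally show ?thesis .
  qed
  then show "\<exists>d>0. \<forall>x'\<in>U. dist x' x < d \<longrightarrow> dist (Ki x') (Ki x) \<le> e"
    using c e by (intro exI[of _ "c * e"]) auto
qed

end

section \<open>Subdomains, interfaces and their meshes\<close>

locale discretized_medium =
  fixes M :: "('a::euclidean_space, 'i, 'j) medium" and \<sigma> :: real
  assumes geo: "fractured_geometry M" and par: "admissible_parameters M"
    and msh: "admissible_meshes \<sigma> M"
begin

lemma geo_fin: "\<forall>d\<le>DIM('a). finite (subidx M d)"
  using geo unfolding fractured_geometry_def by (elim conjE)

lemma geo_shape: "\<forall>d\<le>DIM('a). \<forall>i\<in>subidx M d.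
    aff_dim (subdom M d i) = int d \<and> connected (subdom M d i) \<and> bounded (subdom M d i) \<and>
    openin (top_of_set (affine hull subdom M d i)) (subdom M d i)"
  using geo unfolding fractured_geometry_def by (elim conjE)

lemma geo_disj: "\<forall>d\<le>DIM('a). \<forall>e\<le>DIM('a). \<forall>i\<in>subidx M d. \<forall>k\<in>subidx M e.
    closure (subdom M d i) \<inter> subdom M e k \<noteq> {} \<longrightarrow> e < d \<or> (e = d \<and> k = i)"
  using geo unfolding fractured_geometry_def by (elim conjE)

lemma geo_int: "\<forall>d<DIM('a). \<forall>i\<in>subidx M d. finite (intidx M d i) \<and>
    bij_betw (\<lambda>j. (nbr M d i j, nrm M d i j)) (intidx M d i)
      {(k, \<nu>). k \<in> subidx M (Suc d) \<and> is_side M d i k \<nu>}"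
  using geo unfolding fractured_geometry_def by (elim conjE)

lemma sub_dim: "d \<le> DIM('a) \<Longrightarrow> i \<in> subidx M d \<Longrightarrow> aff_dim (subdom M d i) = int d"
  and sub_openin: "d \<le> DIM('a) \<Longrightarrow> i \<in> subidx M d \<Longrightarrow> openin (top_of_set (affine hull subdom M d i)) (subdom M d i)"
  using geo_shape by simp_all

lemma sub_borel: "d \<le> DIM('a) \<Longrightarrow> i \<in> subidx M d \<Longrightarrow> subdom M d i \<in> sets borel"
  by (rule openin_affine_hull_borel[OF sub_openin])

text \<open>A point of two subdomains lies in the closure of each; the boundary of a subdomain consists of
parts of strictly smaller dimension, which cannot hold in both directions.\<close>

lemma sub_unique:
  assumes "d \<le> DIM('a)" "e \<le> DIM('a)" "i \<in> subidx M d" "k \<in> subidx M e" "x \<in> subdom M d i" "x \<in> subdom M e k"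
  shows "d = e \<and> i = k"
proof -
  have "closure (subdom M d i) \<inter> subdom M e k \<noteq> {}" "closure (subdom M e k) \<inter> subdom M d i \<noteq> {}"
    using assms(5,6) closure_subset[of "subdom M d i"] closure_subset[of "subdom M e k"] by blast+
  then have "e < d \<or> (e = d \<and> k = i)" "d < e \<or> (d = e \<and> i = k)"
    using geo_disj assms(1-4) by simp_all
  then show ?thesis by auto
qed

lemma fin_int: "d < DIM('a) \<Longrightarrow> i \<in> subidx M d \<Longrightarrow> finite (intidx M d i)"
  using geo_int by simp

lemma nbr_mem:
  assumes "d < DIM('a)" "i \<in> subidx M d" "j \<in> intidx M d i"
  shows "nbr M d i j \<in> subidx M (Suc d)"
proof -
  have "bij_betw (\<lambda>j. (nbr M d i j, nrm M d i j)) (intidx M d i)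
      {(k, \<nu>). k \<in> subidx M (Suc d) \<and> is_side M d i k \<nu>}" using geo_int assms by simp
  from bij_betwE[OF this] assms(3) show ?thesis by auto
qed

lemma mesh: "d \<le> DIM('a) \<Longrightarrow> i \<in> subidx M d \<Longrightarrow> mesh_of d (subdom M d i) (mesh M d i)"
  using msh unfolding admissible_meshes_def by simp

lemma imesh: "d < DIM('a) \<Longrightarrow> i \<in> subidx M d \<Longrightarrow> j \<in> intidx M d i \<Longrightarrow> mesh_of d (subdom M d i) (imesh M d i j)"
  using msh unfolding admissible_meshes_def by simp

lemma mesh_tri: "d \<le> DIM('a) \<Longrightarrow> i \<in> subidx M d \<Longrightarrow> triangulation (mesh M d i)"
  using mesh unfolding mesh_of_def by blast

lemma imesh_tri: "d < DIM('a) \<Longrightarrow> i \<in> subidx M d \<Longrightarrow> j \<in> intidx M d i \<Longrightarrow> triangulation (imesh M d i j)"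
  using imesh unfolding mesh_of_def by blast

lemma fin_mesh: "d \<le> DIM('a) \<Longrightarrow> i \<in> subidx M d \<Longrightarrow> finite (mesh M d i)"
  using mesh_tri unfolding triangulation_def by blast

lemma mesh_simplex: "d \<le> DIM('a) \<Longrightarrow> i \<in> subidx M d \<Longrightarrow> T \<in> mesh M d i \<Longrightarrow> int d simplex T"
  using mesh unfolding mesh_of_def by blast

lemma mesh_inside: "d \<le> DIM('a) \<Longrightarrow> i \<in> subidx M d \<Longrightarrow> T \<in> mesh M d i \<Longrightarrow> rel_interior T \<subseteq> subdom M d i"
  using mesh unfolding mesh_of_def by blast

lemma mesh_solid: "d \<le> DIM('a) \<Longrightarrow> 1 \<le> d \<Longrightarrow> i \<in> subidx M d \<Longrightarrow> T \<in> mesh M d i \<Longrightarrow> solid T"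
  using mesh_simplex[of d i T] solid_simplex[of "d - 1" T] by simp

lemma mesh_hull:
  assumes "d \<le> DIM('a)" "i \<in> subidx M d" "T \<in> mesh M d i"
  shows "affine hull T = affine hull subdom M d i"
  using mesh_simplex[OF assms] mesh_inside[OF assms] sub_dim[OF assms(1,2)]
  by (intro affine_hull_eq_of_rel_interior) (auto simp: aff_dim_simplex simplex_convex simplex_nonempty)

lemma imesh_hull:
  assumes "d < DIM('a)" "i \<in> subidx M d" "j \<in> intidx M d i" "T \<in> imesh M d i j"
  shows "affine hull T = affine hull subdom M d i" "rel_interior T \<subseteq> subdom M d i" "rel_interior T \<noteq> {}"
proof -
  have T: "int d simplex T" "rel_interior T \<subseteq> subdom M d i"
    using imesh[OF assms(1-3)] assms(4) unfolding mesh_of_def by blast+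
  then show "affine hull T = affine hull subdom M d i"
    using sub_dim[of d i] assms
    by (intro affine_hull_eq_of_rel_interior) (auto simp: aff_dim_simplex simplex_convex simplex_nonempty)
  show "rel_interior T \<subseteq> subdom M d i" "rel_interior T \<noteq> {}"
    using T simplex_rel_interior_nonempty by auto
qed

section \<open>Raviart-Thomas fields on a subdomain mesh\<close>

lemma Vh_RT0: "v \<in> Vh M d \<Longrightarrow> i \<in> subidx M d \<Longrightarrow> T \<in> mesh M d i \<Longrightarrow> v i T \<in> RT0 T"
  unfolding Vh_def mem_Collect_eq by (elim conjE) presburger

lemma Vh_off: "v \<in> Vh M d \<Longrightarrow> \<not> (i \<in> subidx M d \<and> T \<in> mesh M d i) \<Longrightarrow> v i T = 0"
  unfolding Vh_def mem_Collect_eq by (elim conjE) presburger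

lemma Vh_cont: "v \<in> Vh M d \<Longrightarrow> i \<in> subidx M d \<Longrightarrow> T \<in> mesh M d i \<Longrightarrow> T' \<in> mesh M d i \<Longrightarrow> T \<noteq> T' \<Longrightarrow>
    f facet_of T \<Longrightarrow> f facet_of T' \<Longrightarrow> rel_interior f \<subseteq> subdom M d i \<Longrightarrow> nflux T f (v i T) + nflux T' f (v i T') = 0"
  unfolding Vh_def mem_Collect_eq by (elim conjE) blast

lemma Vh_Neumann:
  assumes "v \<in> Vh M d" "i \<in> subidx M d" "T \<in> mesh M d i" "f facet_of T"
  shows "AE x in flat_measure f. x \<in> f \<inter> bdN M \<longrightarrow> nflux T f (v i T) = 0"
proof -
  have "\<forall>i\<in>subidx M d. \<forall>T\<in>mesh M d i. \<forall>f. f facet_of T \<longrightarrow>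
      (AE x in flat_measure f. x \<in> f \<inter> bdN M \<longrightarrow> nflux T f (v i T) = 0)"
    using assms(1) unfolding Vh_def mem_Collect_eq by (elim conjE)
  from this[THEN bspec, OF assms(2), THEN bspec, OF assms(3), THEN spec, THEN mp, OF assms(4)] show ?thesis .
qed

lemma VhI:
  assumes "\<And>i T. i \<in> subidx M d \<Longrightarrow> T \<in> mesh M d i \<Longrightarrow> v i T \<in> RT0 T"
    and "\<And>i T. \<not> (i \<in> subidx M d \<and> T \<in> mesh M d i) \<Longrightarrow> v i T = 0"
    and "\<And>i T T' f. i \<in> subidx M d \<Longrightarrow> T \<in> mesh M d i \<Longrightarrow> T' \<in> mesh M d i \<Longrightarrow> T \<noteq> T' \<Longrightarrow>
      f facet_of T \<Longrightarrow> f facet_of T' \<Longrightarrow> rel_interior f \<subseteq> subdom M d i \<Longrightarrow> nflux T f (v i T) + nflux T' f (v i T') = 0"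
    and "\<And>i T f. i \<in> subidx M d \<Longrightarrow> T \<in> mesh M d i \<Longrightarrow> f facet_of T \<Longrightarrow>
      AE x in flat_measure f. x \<in> f \<inter> bdN M \<longrightarrow> nflux T f (v i T) = 0"
  shows "v \<in> Vh M d"
  unfolding Vh_def mem_Collect_eq
proof (intro conjI allI ballI impI)
  show "if i \<in> subidx M d \<and> T \<in> mesh M d i then v i T \<in> RT0 T else v i T = 0" for i T
    using assms(1,2) by simp
qed (use assms(3,4) in blast)+

lemma subspace_Vh: "subspace (Vh M d)"
proof (rule subspaceI)
  show "0 \<in> Vh M d"
    by (rule VhI) (simp_all add: subspace_0[OF subspace_RT0])
  show "u + v \<in> Vh M d" if u: "u \<in> Vh M d" and v: "v \<in> Vh M d" for u v
  proof (rule VhI)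
    show "(u + v) i T \<in> RT0 T" if "i \<in> subidx M d" "T \<in> mesh M d i" for i T
      using subspace_add[OF subspace_RT0 Vh_RT0[OF u that] Vh_RT0[OF v that]] by simp
    show "(u + v) i T = 0" if "\<not> (i \<in> subidx M d \<and> T \<in> mesh M d i)" for i T
      using Vh_off[OF u that] Vh_off[OF v that] by simp
    show "nflux T f ((u + v) i T) + nflux T' f ((u + v) i T') = 0"
      if "i \<in> subidx M d" "T \<in> mesh M d i" "T' \<in> mesh M d i" "T \<noteq> T'"
      "f facet_of T" "f facet_of T'" "rel_interior f \<subseteq> subdom M d i" for i T T' f
      using Vh_cont[OF u that] Vh_cont[OF v that] by (simp add: nflux_add)
    show "AE x in flat_measure f. x \<in> f \<inter> bdN M \<longrightarrow> nflux T f ((u + v) i T) = 0"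
      if "i \<in> subidx M d" "T \<in> mesh M d i" "f facet_of T" for i T f
      using Vh_Neumann[OF u that] Vh_Neumann[OF v that] by eventually_elim (simp add: nflux_add)
  qed
  show "c *\<^sub>R u \<in> Vh M d" if u: "u \<in> Vh M d" for c u
  proof (rule VhI)
    show "(c *\<^sub>R u) i T \<in> RT0 T" if "i \<in> subidx M d" "T \<in> mesh M d i" for i T
      using subspace_scale[OF subspace_RT0 Vh_RT0[OF u that]] by (simp add: scaleR_fun_def)
    show "(c *\<^sub>R u) i T = 0" if "\<not> (i \<in> subidx M d \<and> T \<in> mesh M d i)" for i T
      using Vh_off[OF u that] by (simp add: scaleR_fun_def fun_eq_iff)
    have s: "(c *\<^sub>R u) i T = c *\<^sub>R u i T" for i T by (simp add: scaleR_fun_def)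
    show "nflux T f ((c *\<^sub>R u) i T) + nflux T' f ((c *\<^sub>R u) i T') = 0"
      if "i \<in> subidx M d" "T \<in> mesh M d i" "T' \<in> mesh M d i" "T \<noteq> T'"
      "f facet_of T" "f facet_of T'" "rel_interior f \<subseteq> subdom M d i" for i T T' f
      using Vh_cont[OF u that] unfolding s nflux_scale by (simp flip: distrib_left)
    show "AE x in flat_measure f. x \<in> f \<inter> bdN M \<longrightarrow> nflux T f ((c *\<^sub>R u) i T) = 0"
      if "i \<in> subidx M d" "T \<in> mesh M d i" "f facet_of T" for i T f
      using Vh_Neumann[OF u that] by eventually_elim (simp add: s nflux_scale)
  qed
qed

lemma Vh_zeroI:
  assumes "1 \<le> d" "d \<le> DIM('a)" "v \<in> Vh M d"
    and "\<And>i T f. i \<in> subidx M d \<Longrightarrow> T \<in> mesh M d i \<Longrightarrow> f facet_of T \<Longrightarrow> nflux T f (v i T) = 0"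
  shows "v = 0"
proof (intro ext)
  fix i T x
  have "v i T = 0"
  proof (cases "i \<in> subidx M d \<and> T \<in> mesh M d i")
    case True
    then have i: "i \<in> subidx M d" "T \<in> mesh M d i" by auto
    show ?thesis
      by (rule solid_unisolvent[OF mesh_solid[OF assms(2,1) i] Vh_RT0[OF assms(3) i]]) (rule assms(4)[OF i])
  qed (rule Vh_off[OF assms(3)])
  then show "v i T x = 0 i T x" by simp
qed

text \<open>Facet fluxes are the degrees of freedom.\<close>

lemma fin_coord_Vh_subset:
  assumes "1 \<le> d" "d \<le> DIM('a)" "S \<subseteq> Vh M d"
  shows "fin_coord S"
proof (rule fin_coord_family)
  let ?K = "SIGMA i:subidx M d. SIGMA T:mesh M d i. {f. f facet_of T}"
  show "finite ?K"
    using geo_fin fin_mesh solid_finite_facets[OF mesh_solid] assms(1,2) by (intro finite_SigmaI) auto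
  show "lin_on S ((\<lambda>(i, T, f) v. nflux T f (v i T)) k)" for k
    by (rule lin_onI) (auto simp: nflux_add scaleR_fun_def simp flip: nflux_scale split: prod.splits)
  fix v assume v: "v \<in> S" "\<And>k. k \<in> ?K \<Longrightarrow> (\<lambda>(i, T, f) v. nflux T f (v i T)) k v = 0"
  show "v = 0"
  proof (rule Vh_zeroI[OF assms(1,2)])
    show "v \<in> Vh M d" using v assms by blast
    show "nflux T f (v i T) = 0" if "i \<in> subidx M d" "T \<in> mesh M d i" "f facet_of T" for i T f
      using v(2)[of "(i, T, f)"] that by simp
  qed
qed

section \<open>Normal traces and the discrete extension\<close>

lemma on_interfaceD:
  assumes "on_interface M d i j T f" "d < DIM('a)"
  shows "i \<in> subidx M d" "j \<in> intidx M d i" "nbr M d i j \<in> subidx M (Suc d)" "T \<in> mesh M (Suc d) (nbr M d i j)"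
    "f facet_of T" "rel_interior f \<subseteq> subdom M d i" "outer_normal T f = nrm M d i j" "solid T" "int (Suc d) simplex T"
    "rel_interior f \<noteq> {}" "affine hull f = affine hull subdom M d i"
proof -
  show 1: "i \<in> subidx M d" "j \<in> intidx M d i" "T \<in> mesh M (Suc d) (nbr M d i j)"
    "f facet_of T" "rel_interior f \<subseteq> subdom M d i" "outer_normal T f = nrm M d i j"
    using assms(1) unfolding on_interface_def by simp_all
  show 2: "nbr M d i j \<in> subidx M (Suc d)" using nbr_mem[OF assms(2) 1(1,2)] .
  show 3: "solid T" "int (Suc d) simplex T"
    using mesh_solid[OF _ _ 2 1(3)] mesh_simplex[OF _ 2 1(3)] assms(2) by simp_all
  then show ne: "rel_interior f \<noteq> {}"
    using facet_rel_interior_nonempty 1(4) simplex_convex by blast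
  have "aff_dim f = int d" using 1(4) 3(2) by (simp add: facet_of_def aff_dim_simplex)
  moreover have "convex f" using 1(4) 3(2) by (meson facet_of_def face_of_imp_convex simplex_convex)
  ultimately show "affine hull f = affine hull subdom M d i"
    using 1 sub_dim[of d i] assms(2)
    by (intro affine_hull_eq_of_rel_interior) (simp_all add: facet_of_def)
qed

text \<open>Two cells on the same side of an interface, touching it at a common point \<open>x\<close>, both contain
\<open>x - t \<nu>\<close> in their relative interiors for small \<open>t\<close>, hence coincide. A subdomain on both sides
of a fracture is no exception, since the two sides are different interfaces with opposite normals.\<close>

lemma on_interface_unique:
  assumes d: "d < DIM('a)" and 1: "on_interface M d i j T f" and 2: "on_interface M d i j T' f'"
    and x: "x \<in> rel_interior f" "x \<in> rel_interior f'"
  shows "T = T' \<and> f = f'"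
proof -
  note a = on_interfaceD[OF 1 d] and b = on_interfaceD[OF 2 d]
  obtain \<epsilon> where e: "\<epsilon> > 0" "\<forall>t\<in>{0<..<\<epsilon>}. x - t *\<^sub>R outer_normal T f \<in> rel_interior T"
    using solid_approach[OF a(8,5) x(1)] by blast
  obtain \<epsilon>' where e': "\<epsilon>' > 0" "\<forall>t\<in>{0<..<\<epsilon>'}. x - t *\<^sub>R outer_normal T' f' \<in> rel_interior T'"
    using solid_approach[OF b(8,5) x(2)] by blast
  define t where "t = min \<epsilon> \<epsilon>' / 2"
  have t: "t \<in> {0<..<\<epsilon>}" "t \<in> {0<..<\<epsilon>'}" using e(1) e'(1) by (auto simp: t_def)
  have "x - t *\<^sub>R nrm M d i j \<in> rel_interior T" "x - t *\<^sub>R nrm M d i j \<in> rel_interior T'"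
    using e(2) e'(2) t a(7) b(7) by auto
  then have TT: "T = T'"
    using triangulation_rel_interior_unique[OF mesh_tri[OF _ a(3)] a(4) b(4)] d by simp
  have "f face_of T" "f' face_of T" using a(5) b(5) TT by (simp_all add: facet_of_def)
  then have "f = f'" using face_of_eq x by blast
  then show ?thesis using TT by simp
qed

lemma finite_on_interface: "d < DIM('a) \<Longrightarrow> finite {(T, f). on_interface M d i j T f}"
proof -
  assume d: "d < DIM('a)"
  show ?thesis
  proof (cases "i \<in> subidx M d \<and> j \<in> intidx M d i")
    case True
    then have k: "nbr M d i j \<in> subidx M (Suc d)" using nbr_mem d by blast
    have "finite (SIGMA T:mesh M (Suc d) (nbr M d i j). {f. f facet_of T})"
      using d k fin_mesh solid_finite_facets[OF mesh_solid[OF _ _ k]] by (intro finite_SigmaI) auto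
    then show ?thesis
      by (rule finite_subset[rotated]) (auto simp: on_interface_def)
  next
    case False
    then have "{(T, f). on_interface M d i j T f} = {}" by (auto simp: on_interface_def)
    then show ?thesis by (simp only: finite.emptyI)
  qed
qed

text \<open>By disjointness only one term of the sum defining the trace survives.\<close>

lemma ntrace_at:
  assumes d: "d < DIM('a)" and on: "on_interface M d i j T f" and x: "x \<in> rel_interior f"
  shows "ntrace M d v i j x = nflux T f (v (nbr M d i j) T)"
proof -
  let ?g = "\<lambda>(T', f'). indicator (rel_interior f') x * nflux T' f' (v (nbr M d i j) T')"
  have "ntrace M d v i j x = sum ?g {(T, f)}"
    unfolding ntrace_def
  proof (rule sum.mono_neutral_right[OF finite_on_interface[OF d]])
    show "{(T, f)} \<subseteq> {(T, f). on_interface M d i j T f}" using on by simp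
    show "\<forall>k\<in>{(T, f). on_interface M d i j T f} - {(T, f)}. ?g k = 0"
    proof (intro ballI)
      fix k assume k: "k \<in> {(T, f). on_interface M d i j T f} - {(T, f)}"
      obtain T' f' where kk: "k = (T', f')" by (cases k)
      have "x \<notin> rel_interior f'"
        using on_interface_unique[OF d on _ x, of T' f'] k kk by auto
      then show "?g k = 0" by (simp add: kk)
    qed
  qed
  then show ?thesis using x by simp
qed

lemma ntrace_add: "ntrace M d (u + v) = ntrace M d u + ntrace M d v"
  and ntrace_scale: "ntrace M d (c *\<^sub>R u) = c *\<^sub>R ntrace M d u"
  by (simp_all add: fun_eq_iff ntrace_def scaleR_fun_def nflux_add nflux_scale[unfolded scaleR_fun_def] split_def
      distrib_left sum.distrib sum_distrib_left mult.left_commute)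

lemma ntrace_cong:
  assumes "\<And>i j T f. on_interface M d i j T f \<Longrightarrow> nflux T f (u (nbr M d i j) T) = nflux T f (v (nbr M d i j) T)"
  shows "ntrace M d u = ntrace M d v"
  by (intro ext) (use assms in \<open>auto simp: ntrace_def intro!: sum.cong\<close>)

definition tame_mortars :: "nat \<Rightarrow> ('i \<Rightarrow> 'j \<Rightarrow> 'a \<Rightarrow> real) set" where
  "tame_mortars d = {\<eta>. \<forall>i\<in>subidx M d. \<forall>j\<in>intidx M d i. tame (\<eta> i j)}"

lemma subspace_tame: "subspace {f :: 'a \<Rightarrow> real. tame f}"
  using semi_form.sub[OF semi_form_L2[of UNIV UNIV]] by simp

lemma subspace_tame_mortars: "subspace (tame_mortars d)"
proof (rule subspaceI)
  show "0 \<in> tame_mortars d" by (simp add: tame_mortars_def)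
  show "u + v \<in> tame_mortars d" if "u \<in> tame_mortars d" "v \<in> tame_mortars d" for u v
    using that subspace_add[OF subspace_tame] by (simp add: tame_mortars_def)
  show "c *\<^sub>R u \<in> tame_mortars d" if "u \<in> tame_mortars d" for c u
    using that subspace_scale[OF subspace_tame] by (simp add: tame_mortars_def scaleR_fun_def)
qed

lemma semi_form_ip_Gamma:
  assumes d: "d < DIM('a)" shows "semi_form (tame_mortars d) (ip_Gamma M d)"
proof -
  have "semi_form (tame_mortars d) (\<lambda>\<eta> \<mu>. \<Sum>i\<in>subidx M d. \<Sum>j\<in>intidx M d i.
     (LINT x:subdom M d i|flat_measure (subdom M d i). \<eta> i j x * \<mu> i j x))"
  proof (intro semi_form_sum subspace_tame_mortars)
    fix i j assume "i \<in> subidx M d" "j \<in> intidx M d i"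
    then show "semi_form (tame_mortars d) (\<lambda>\<eta> \<mu>. LINT x:subdom M d i|flat_measure (subdom M d i). \<eta> i j x * \<mu> i j x)"
      using d by (intro semi_form_pullback[OF semi_form_L2 subspace_tame_mortars, where f = "\<lambda>\<eta>. \<eta> i j"] sub_borel)
        (simp_all add: tame_mortars_def scaleR_fun_def)
  qed
  then show ?thesis by (simp add: ip_Gamma_def[abs_def])
qed

lemma ip_Gamma_zeroD:
  assumes d: "d < DIM('a)" and \<eta>: "\<eta> \<in> tame_mortars d" and z: "ip_Gamma M d \<eta> \<eta> = 0"
    and ij: "i \<in> subidx M d" "j \<in> intidx M d i"
  shows "(LINT x:subdom M d i|flat_measure (subdom M d i). \<eta> i j x * \<eta> i j x) = 0"
proof -
  have nn: "0 \<le> (LINT x:subdom M d i|flat_measure (subdom M d i). \<eta> i j x * \<eta> i j x)" for i j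
    unfolding set_lebesgue_integral_def by (rule integral_nonneg_AE) (auto simp: indicator_def)
  have fin: "finite (subidx M d)" "finite (intidx M d i)" using geo_fin d fin_int ij by auto
  have "(\<Sum>j\<in>intidx M d i. (LINT x:subdom M d i|flat_measure (subdom M d i). \<eta> i j x * \<eta> i j x)) = 0"
    using z ij(1) unfolding ip_Gamma_def by (subst (asm) sum_nonneg_eq_0_iff) (use fin nn in \<open>auto intro: sum_nonneg\<close>)
  then show ?thesis using ij(2) by (subst (asm) sum_nonneg_eq_0_iff) (use fin nn in auto)
qed

text \<open>Stated for the relative interior of a cell \<open>Z\<close> because the functions of interest are constant
there: one zero makes them vanish on the whole cell.\<close>

lemma square_integral_zero_point:
  assumes d: "d \<le> DIM('a)" "i \<in> subidx M d" and f: "tame f"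
    and z: "(LINT x:subdom M d i|flat_measure (subdom M d i). f x * f x) = 0"
    and Z: "rel_interior Z \<subseteq> subdom M d i" "rel_interior Z \<noteq> {}" "affine hull Z = affine hull subdom M d i"
  shows "\<exists>x\<in>rel_interior Z. f x = 0"
proof -
  have "\<exists>x\<in>rel_interior Z. f x * f x = 0"
  proof (rule flat_integral_zero_on_openin[OF _ _ z _ Z(1,2)])
    show "set_integrable (flat_measure (subdom M d i)) (subdom M d i) (\<lambda>x. f x * f x)"
      by (rule tame_set_integrable[OF tame_mult[OF f f] sub_borel[OF d]])
    show "openin (top_of_set (affine hull subdom M d i)) (rel_interior Z)"
      using openin_rel_interior[of Z] Z(3) by simp
  qed simp
  then show ?thesis by simp
qed

lemma ntrace_tame_mortars: "d < DIM('a) \<Longrightarrow> ntrace M d v \<in> tame_mortars d"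
  unfolding tame_mortars_def mem_Collect_eq
proof (intro ballI)
  fix i j assume d: "d < DIM('a)"
  have "tame (\<lambda>x. \<Sum>k\<in>{(T, f). on_interface M d i j T f}. nflux (fst k) (snd k) (v (nbr M d i j) (fst k)) * indicator (rel_interior (snd k)) x)"
  proof (intro tame_sum tame_cmult tame_indicator)
    fix k assume "k \<in> {(T, f). on_interface M d i j T f}"
    then have "on_interface M d i j (fst k) (snd k)" by auto
    note a = on_interfaceD[OF this d]
    have "bounded (fst k)" using a(9) simplex_compact compact_imp_bounded by blast
    moreover have "snd k \<subseteq> fst k" using a(5) facet_of_imp_subset by blast
    ultimately show "bounded (rel_interior (snd k))"
      using rel_interior_subset bounded_subset by (meson order_trans)
  qed simp
  then show "tame (ntrace M d v i j)"
    unfolding ntrace_def[abs_def] by (simp add: split_def mult.commute)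
qed

text \<open>The fields among which the discrete extension is sought: all normal components off the interfaces
vanish.\<close>

definition interface_fluxes :: "nat \<Rightarrow> ('i \<Rightarrow> 'a set \<Rightarrow> 'a \<Rightarrow> 'a) set" where
  "interface_fluxes d = {v \<in> Vh M (Suc d). \<forall>k\<in>subidx M (Suc d). \<forall>T\<in>mesh M (Suc d) k. \<forall>f.
        f facet_of T \<and> \<not> (\<exists>i j. on_interface M d i j T f) \<longrightarrow> nflux T f (v k T) = 0}"

lemma subspace_interface_fluxes: "subspace (interface_fluxes d)"
proof (rule subspaceI)
  show "0 \<in> interface_fluxes d" by (simp add: interface_fluxes_def subspace_0[OF subspace_Vh])
  show "u + v \<in> interface_fluxes d" if "u \<in> interface_fluxes d" "v \<in> interface_fluxes d" for u v
    using that subspace_add[OF subspace_Vh, of u "Suc d" v] by (simp add: interface_fluxes_def nflux_add)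
  have s: "(c *\<^sub>R u) i T = c *\<^sub>R u i T" for c and u :: "'i \<Rightarrow> 'a set \<Rightarrow> 'a \<Rightarrow> 'a" and i T by (simp add: scaleR_fun_def)
  show "c *\<^sub>R u \<in> interface_fluxes d" if "u \<in> interface_fluxes d" for c u
    using that subspace_scale[OF subspace_Vh, of u "Suc d" c] by (simp add: interface_fluxes_def nflux_scale s)
qed

lemma semi_form_trace: "d < DIM('a) \<Longrightarrow> semi_form (interface_fluxes d) (\<lambda>u v. ip_Gamma M d (ntrace M d u) (ntrace M d v))"
  by (rule semi_form_pullback[OF semi_form_ip_Gamma subspace_interface_fluxes])
    (simp_all add: ntrace_tame_mortars ntrace_add ntrace_scale)

text \<open>The trace vanishes somewhere in each facet and is constant there, so all interface fluxes vanish;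
the other fluxes do by definition.\<close>

lemma trace_zero_interface_fluxes:
  assumes d: "d < DIM('a)" and v: "v \<in> interface_fluxes d" and z: "ip_Gamma M d (ntrace M d v) (ntrace M d v) = 0"
  shows "v = 0"
proof (rule Vh_zeroI)
  show "1 \<le> Suc d" "Suc d \<le> DIM('a)" "v \<in> Vh M (Suc d)" using d v by (auto simp: interface_fluxes_def)
  fix k T f assume k: "k \<in> subidx M (Suc d)" "T \<in> mesh M (Suc d) k" "f facet_of T"
  show "nflux T f (v k T) = 0"
  proof (cases "\<exists>i j. on_interface M d i j T f")
    case False
    then show ?thesis using v k unfolding interface_fluxes_def by blast
  next
    case True
    then obtain i j where on: "on_interface M d i j T f" by blast
    note a = on_interfaceD[OF on d]
    obtain x where "x \<in> rel_interior T" using simplex_rel_interior_nonempty[OF a(9)] by blast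
    then have "x \<in> subdom M (Suc d) k" "x \<in> subdom M (Suc d) (nbr M d i j)"
      using mesh_inside[OF _ k(1,2)] mesh_inside[OF _ a(3,4)] d by auto
    then have kk: "k = nbr M d i j" using sub_unique[OF _ _ k(1) a(3)] d by auto
    have "\<exists>x\<in>rel_interior f. ntrace M d v i j x = 0"
    proof (rule square_integral_zero_point[OF _ a(1) _ _ a(6,10,11)])
      show "tame (ntrace M d v i j)" using ntrace_tame_mortars[OF d] a(1,2) by (simp add: tame_mortars_def)
      show "(LINT x:subdom M d i|flat_measure (subdom M d i). ntrace M d v i j x * ntrace M d v i j x) = 0"
        by (rule ip_Gamma_zeroD[OF d ntrace_tame_mortars[OF d] z a(1,2)])
    qed (use d in simp)
    then show ?thesis using ntrace_at[OF d on] kk by auto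
  qed
qed

lemma inner_form_trace: "d < DIM('a) \<Longrightarrow> inner_form (interface_fluxes d) (\<lambda>u v. ip_Gamma M d (ntrace M d u) (ntrace M d v))"
  by (intro inner_form.intro semi_form_trace inner_form_axioms.intro trace_zero_interface_fluxes)

lemma fin_coord_interface_fluxes: "d < DIM('a) \<Longrightarrow> fin_coord (interface_fluxes d)"
  by (rule fin_coord_Vh_subset[of "Suc d"]) (auto simp: interface_fluxes_def)

text \<open>Dropping the fluxes through all other facets does not change the trace. It has to be checked that
the truncated field stays in the space: a facet inside the subdomain is never on an interface, so
normal continuity there reads \<open>0 + 0 = 0\<close>; and each flux is either kept or set to zero, so that
Neumann conditions persist.\<close>

lemma interface_fluxes_trace_surj:
  assumes d: "d < DIM('a)" and v: "v \<in> Vh M (Suc d)"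
  shows "\<exists>v'\<in>interface_fluxes d. ntrace M d v' = ntrace M d v"
proof -
  define on where "on T f \<longleftrightarrow> (\<exists>i j. on_interface M d i j T f)" for T f
  define v' where "v' k T = (if k \<in> subidx M (Suc d) \<and> T \<in> mesh M (Suc d) k
      then \<Sum>f\<in>{f. f facet_of T \<and> on T f}. nflux T f (v k T) *\<^sub>R RT_basis T f else 0)" for k T
  have v'_eq: "v' k T = (\<Sum>f\<in>{f. f facet_of T \<and> on T f}. nflux T f (v k T) *\<^sub>R RT_basis T f)"
    if "k \<in> subidx M (Suc d)" "T \<in> mesh M (Suc d) k" for k T using that by (simp add: v'_def)
  have flux: "nflux T f (v' k T) = (if on T f then nflux T f (v k T) else 0)"
    if k: "k \<in> subidx M (Suc d)" "T \<in> mesh M (Suc d) k" and f: "f facet_of T" for k T f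
  proof -
    have so: "solid T" using mesh_solid[OF _ _ k] d by simp
    have fin: "finite {f. f facet_of T \<and> on T f}"
      by (rule finite_subset[OF _ solid_finite_facets[OF so]]) auto
    have "nflux T f (v' k T) = (\<Sum>f'\<in>{f. f facet_of T \<and> on T f}. nflux T f' (v k T) * nflux T f (RT_basis T f'))"
      unfolding v'_eq[OF k] nflux_sum nflux_scale ..
    also have "\<dots> = (\<Sum>f'\<in>{f. f facet_of T \<and> on T f}. if f' = f then nflux T f (v k T) else 0)"
      by (rule sum.cong) (use solid_nflux_basis[OF so _ f] in auto)
    also have "\<dots> = (if on T f then nflux T f (v k T) else 0)" using fin f by simp
    finally show ?thesis .
  qed
  have "v' \<in> Vh M (Suc d)"
  proof (rule VhI)
    fix k T assume k: "k \<in> subidx M (Suc d)" "T \<in> mesh M (Suc d) k"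
    have so: "solid T" using mesh_solid[OF _ _ k] d by simp
    show "v' k T \<in> RT0 T"
      unfolding v'_eq[OF k] by (intro subspace_sum subspace_scale subspace_RT0 solid_basis_RT0[OF so]) simp
  next
    fix k T assume "\<not> (k \<in> subidx M (Suc d) \<and> T \<in> mesh M (Suc d) k)"
    then show "v' k T = 0" unfolding v'_def by (rule if_not_P)
  next
    fix k T T' f assume k: "k \<in> subidx M (Suc d)" and T: "T \<in> mesh M (Suc d) k" and T': "T' \<in> mesh M (Suc d) k"
      and "T \<noteq> T'" and f: "f facet_of T" and f': "f facet_of T'" and in_k: "rel_interior f \<subseteq> subdom M (Suc d) k"
    have "\<not> on T'' f" for T''
    proof
      assume "on T'' f"
      then obtain i j where "on_interface M d i j T'' f" unfolding on_def by blast
      note a = on_interfaceD[OF this d]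
      obtain x where x: "x \<in> rel_interior f" using a(10) by blast
      then have "x \<in> subdom M d i" "x \<in> subdom M (Suc d) k" using a(6) in_k by auto
      then show False using sub_unique[OF _ _ a(1) k] d by auto
    qed
    then show "nflux T f (v' k T) + nflux T' f (v' k T') = 0"
      using flux[OF k T f] flux[OF k T' f'] by simp
  next
    fix k T f assume k: "k \<in> subidx M (Suc d)" "T \<in> mesh M (Suc d) k" "f facet_of T"
    show "AE x in flat_measure f. x \<in> f \<inter> bdN M \<longrightarrow> nflux T f (v' k T) = 0"
      using Vh_Neumann[OF v k] by eventually_elim (simp add: flux[OF k])
  qed
  moreover have "nflux T f (v' k T) = 0"
    if "k \<in> subidx M (Suc d)" "T \<in> mesh M (Suc d) k" "f facet_of T" "\<not> on T f" for k T f
    using flux[OF that(1-3)] that(4) by simp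
  ultimately have "v' \<in> interface_fluxes d" unfolding interface_fluxes_def on_def by blast
  moreover have "ntrace M d v' = ntrace M d v"
  proof (rule ntrace_cong)
    fix i j T f assume on: "on_interface M d i j T f"
    note a = on_interfaceD[OF on d]
    have "on T f" using on unfolding on_def by blast
    then show "nflux T f (v' (nbr M d i j) T) = nflux T f (v (nbr M d i j) T)" using flux[OF a(3,4,5)] by simp
  qed
  ultimately show ?thesis by blast
qed

text \<open>Projecting onto normal traces and then lifting with zero fluxes elsewhere amounts to one
variational problem on \<open>interface_fluxes\<close>, where the trace pairing is an inner product.
This characterization replaces both descriptions from here on.\<close>

lemma Rh_comp_iff:
  assumes d: "d < DIM('a)" and \<mu>: "\<mu> \<in> tame_mortars d"
  shows "v = Rh_comp M d \<mu> \<longleftrightarrow> v \<in> interface_fluxes d \<and> (\<forall>u\<in>interface_fluxes d. ip_Gamma M d (ntrace M d v) (ntrace M d u) = ip_Gamma M d \<mu> (ntrace M d u))"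
proof -
  interpret G: semi_form "tame_mortars d" "ip_Gamma M d" by (rule semi_form_ip_Gamma[OF d])
  interpret I: inner_form "interface_fluxes d" "\<lambda>u v. ip_Gamma M d (ntrace M d u) (ntrace M d v)" by (rule inner_form_trace[OF d])
  have "lin_on (interface_fluxes d) (\<lambda>u. ip_Gamma M d \<mu> (ntrace M d u))"
    by (rule lin_on_comp[OF G.lin[OF \<mu>]]) (simp_all add: d ntrace_tame_mortars ntrace_add ntrace_scale)
  from I.riesz[OF fin_coord_interface_fluxes[OF d] this]
  obtain w where w: "w \<in> interface_fluxes d" "\<forall>u\<in>interface_fluxes d. ip_Gamma M d (ntrace M d w) (ntrace M d u) = ip_Gamma M d \<mu> (ntrace M d u)"
    and uniq: "\<And>w'. w' \<in> interface_fluxes d \<and> (\<forall>u\<in>interface_fluxes d. ip_Gamma M d (ntrace M d w') (ntrace M d u) = ip_Gamma M d \<mu> (ntrace M d u)) \<Longrightarrow> w' = w"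
    by (rule ex1E) blast
  have Vh: "interface_fluxes d \<subseteq> Vh M (Suc d)" by (auto simp: interface_fluxes_def)
  have "Pihat M d \<mu> = ntrace M d w"
    unfolding Pihat_def
  proof (rule the_equality)
    show "ntrace M d w \<in> ntrace M d ` Vh M (Suc d) \<and> (\<forall>v\<in>Vh M (Suc d). ip_Gamma M d (ntrace M d w - \<mu>) (ntrace M d v) = 0)"
    proof (intro conjI ballI)
      show "ntrace M d w \<in> ntrace M d ` Vh M (Suc d)" using w(1) Vh by blast
      fix v assume "v \<in> Vh M (Suc d)"
      then obtain v' where v': "v' \<in> interface_fluxes d" "ntrace M d v' = ntrace M d v" using interface_fluxes_trace_surj[OF d] by blast
      show "ip_Gamma M d (ntrace M d w - \<mu>) (ntrace M d v) = 0"
        using w(2) v' \<mu> ntrace_tame_mortars[OF d] by (simp add: G.diff_l flip: v'(2))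
    qed
    fix m assume m: "m \<in> ntrace M d ` Vh M (Suc d) \<and> (\<forall>v\<in>Vh M (Suc d). ip_Gamma M d (m - \<mu>) (ntrace M d v) = 0)"
    then obtain w' where w': "w' \<in> interface_fluxes d" "m = ntrace M d w'" using interface_fluxes_trace_surj[OF d] by (metis imageE)
    have "w' = w"
    proof (rule uniq, intro conjI ballI w'(1))
      fix u assume u: "u \<in> interface_fluxes d"
      then have "u \<in> Vh M (Suc d)" using Vh by blast
      then have "ip_Gamma M d (ntrace M d w' - \<mu>) (ntrace M d u) = 0" using m w'(2) by simp
      then show "ip_Gamma M d (ntrace M d w') (ntrace M d u) = ip_Gamma M d \<mu> (ntrace M d u)"
        using \<mu> ntrace_tame_mortars[OF d] by (simp add: G.diff_l)
    qed
    then show "m = ntrace M d w" using w'(2) by simp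
  qed
  moreover have inj: "w' = w" if "w' \<in> interface_fluxes d" "ntrace M d w' = ntrace M d w" for w'
    by (rule uniq) (use that w(2) in simp)
  ultimately have "Rh_comp M d \<mu> = w"
    unfolding Rh_comp_def by (intro the_equality) (use w(1) in \<open>auto simp: interface_fluxes_def\<close>)
  then show ?thesis using w uniq by blast
qed

lemma Rh_comp_interface_fluxes: "d < DIM('a) \<Longrightarrow> \<mu> \<in> tame_mortars d \<Longrightarrow> Rh_comp M d \<mu> \<in> interface_fluxes d"
  and Rh_comp_proj: "d < DIM('a) \<Longrightarrow> \<mu> \<in> tame_mortars d \<Longrightarrow> u \<in> interface_fluxes d \<Longrightarrow>
    ip_Gamma M d (ntrace M d (Rh_comp M d \<mu>)) (ntrace M d u) = ip_Gamma M d \<mu> (ntrace M d u)"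
  using Rh_comp_iff[of d \<mu> "Rh_comp M d \<mu>"] by simp_all

lemma Rh_comp_add:
  assumes d: "d < DIM('a)" and \<mu>: "\<mu> \<in> tame_mortars d" and \<nu>: "\<nu> \<in> tame_mortars d"
  shows "Rh_comp M d (\<mu> + \<nu>) = Rh_comp M d \<mu> + Rh_comp M d \<nu>"
proof -
  interpret G: semi_form "tame_mortars d" "ip_Gamma M d" by (rule semi_form_ip_Gamma[OF d])
  have "Rh_comp M d \<mu> + Rh_comp M d \<nu> = Rh_comp M d (\<mu> + \<nu>)"
    unfolding Rh_comp_iff[OF d G.in_sub(1)[OF \<mu> \<nu>]]
  proof (intro conjI ballI)
    show "Rh_comp M d \<mu> + Rh_comp M d \<nu> \<in> interface_fluxes d"
      by (rule subspace_add[OF subspace_interface_fluxes Rh_comp_interface_fluxes[OF d \<mu>] Rh_comp_interface_fluxes[OF d \<nu>]])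
    fix u assume u: "u \<in> interface_fluxes d"
    show "ip_Gamma M d (ntrace M d (Rh_comp M d \<mu> + Rh_comp M d \<nu>)) (ntrace M d u) = ip_Gamma M d (\<mu> + \<nu>) (ntrace M d u)"
      unfolding ntrace_add using Rh_comp_proj[OF d \<mu> u] Rh_comp_proj[OF d \<nu> u] ntrace_tame_mortars[OF d] \<mu> \<nu>
      by (simp only: G.add_l)
  qed
  then show ?thesis by simp
qed

lemma Rh_comp_scale:
  assumes d: "d < DIM('a)" and \<mu>: "\<mu> \<in> tame_mortars d"
  shows "Rh_comp M d (c *\<^sub>R \<mu>) = c *\<^sub>R Rh_comp M d \<mu>"
proof -
  interpret G: semi_form "tame_mortars d" "ip_Gamma M d" by (rule semi_form_ip_Gamma[OF d])
  have "c *\<^sub>R Rh_comp M d \<mu> = Rh_comp M d (c *\<^sub>R \<mu>)"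
    unfolding Rh_comp_iff[OF d G.in_sub(2)[OF \<mu>]]
  proof (intro conjI ballI)
    show "c *\<^sub>R Rh_comp M d \<mu> \<in> interface_fluxes d"
      by (rule subspace_scale[OF subspace_interface_fluxes Rh_comp_interface_fluxes[OF d \<mu>]])
    fix u assume u: "u \<in> interface_fluxes d"
    show "ip_Gamma M d (ntrace M d (c *\<^sub>R Rh_comp M d \<mu>)) (ntrace M d u) = ip_Gamma M d (c *\<^sub>R \<mu>) (ntrace M d u)"
      unfolding ntrace_scale using Rh_comp_proj[OF d \<mu> u] ntrace_tame_mortars[OF d] \<mu>
      by (simp only: G.scale_l)
  qed
  then show ?thesis by simp
qed

section \<open>The discrete spaces\<close>

lemma subspace_pointwise:
  assumes "\<And>k. subspace (S k)"
  shows "subspace {f. \<forall>k. f k \<in> S k}"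
  using assms by (auto simp: subspace_def scaleR_fun_def)

lemma Lh_P0: "\<mu> \<in> Lh M \<Longrightarrow> d < DIM('a) \<Longrightarrow> i \<in> subidx M d \<Longrightarrow> j \<in> intidx M d i \<Longrightarrow> \<mu> d i j \<in> P0 (imesh M d i j)"
  unfolding Lh_def Lh_comp_def mem_Collect_eq by meson

lemma Lh_off: "\<mu> \<in> Lh M \<Longrightarrow> \<not> (d < DIM('a) \<and> i \<in> subidx M d \<and> j \<in> intidx M d i) \<Longrightarrow> \<mu> d i j = 0"
proof -
  assume \<mu>: "\<mu> \<in> Lh M" and o: "\<not> (d < DIM('a) \<and> i \<in> subidx M d \<and> j \<in> intidx M d i)"
  have *: "if d < DIM('a) then \<mu> d \<in> Lh_comp M d else \<mu> d = 0" using \<mu> unfolding Lh_def mem_Collect_eq by (rule spec)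
  show ?thesis
  proof (cases "d < DIM('a)")
    case True
    then have "\<forall>i j. if i \<in> subidx M d \<and> j \<in> intidx M d i then \<mu> d i j \<in> P0 (imesh M d i j) else \<mu> d i j = 0"
      using * unfolding Lh_comp_def mem_Collect_eq by simp
    from this[rule_format, of i j] show ?thesis using True o by simp
  qed (use * in simp)
qed

lemma scaleR_flux: "(c *\<^sub>R (u :: ('a, 'i) flux)) d i T = c *\<^sub>R u d i T" by (simp add: scaleR_fun_def)
lemma scaleR_mortar: "(c *\<^sub>R (\<mu> :: ('a, 'i, 'j) mortar)) d i j = c *\<^sub>R \<mu> d i j" by (simp add: scaleR_fun_def)
lemma scaleR_pressure: "(c *\<^sub>R (q :: ('a, 'i) pressure)) d i = c *\<^sub>R q d i" by (simp add: scaleR_fun_def)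

lemma subspace_Lh: "subspace (Lh M)"
proof -
  have "subspace (Lh_comp M d)" for d
  proof -
    have "Lh_comp M d = {\<mu>. \<forall>i. \<mu> i \<in> {\<nu>. \<forall>j. \<nu> j \<in>
        (if i \<in> subidx M d \<and> j \<in> intidx M d i then P0 (imesh M d i j) else {0})}}"
      unfolding Lh_comp_def by (auto split: if_splits)
    then show ?thesis by (simp only:) (intro subspace_pointwise, simp add: subspace_P0 subspace_single_0)
  qed
  moreover have "Lh M = {\<mu>. \<forall>d. \<mu> d \<in> (if d < DIM('a) then Lh_comp M d else {0})}"
    unfolding Lh_def by (auto split: if_splits)
  ultimately show ?thesis by (simp only:) (rule subspace_pointwise, simp add: subspace_single_0)
qed

lemma Qh_P0: "q \<in> Qh M \<Longrightarrow> d \<le> DIM('a) \<Longrightarrow> i \<in> subidx M d \<Longrightarrow> q d i \<in> P0 (mesh M d i)"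
  unfolding Qh_def Qh_comp_def mem_Collect_eq by meson

lemma Qh_off: "q \<in> Qh M \<Longrightarrow> \<not> (d \<le> DIM('a) \<and> i \<in> subidx M d) \<Longrightarrow> q d i = 0"
proof -
  assume q: "q \<in> Qh M" and o: "\<not> (d \<le> DIM('a) \<and> i \<in> subidx M d)"
  have *: "if d \<le> DIM('a) then q d \<in> Qh_comp M d else q d = 0" using q unfolding Qh_def mem_Collect_eq by (rule spec)
  show ?thesis
  proof (cases "d \<le> DIM('a)")
    case True
    then have "\<forall>i. if i \<in> subidx M d then q d i \<in> P0 (mesh M d i) else q d i = 0"
      using * unfolding Qh_comp_def mem_Collect_eq by simp
    from this[rule_format, of i] show ?thesis using True o by simp
  qed (use * in simp)
qed

lemma subspace_Qh: "subspace (Qh M)"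
proof -
  have "subspace (Qh_comp M d)" for d
  proof -
    have "Qh_comp M d = {q. \<forall>i. q i \<in> (if i \<in> subidx M d then P0 (mesh M d i) else {0})}"
      unfolding Qh_comp_def by (auto split: if_splits)
    then show ?thesis by (simp only:) (rule subspace_pointwise, simp add: subspace_P0 subspace_single_0)
  qed
  moreover have "Qh M = {q. \<forall>d. q d \<in> (if d \<le> DIM('a) then Qh_comp M d else {0})}"
    unfolding Qh_def by (auto split: if_splits)
  ultimately show ?thesis by (simp only:) (rule subspace_pointwise, simp add: subspace_single_0)
qed

lemma V0h_comp: "v \<in> V0h M \<Longrightarrow> 1 \<le> d \<Longrightarrow> d \<le> DIM('a) \<Longrightarrow> v d \<in> V0h_comp M d"
  and V0h_off: "v \<in> V0h M \<Longrightarrow> \<not> (1 \<le> d \<and> d \<le> DIM('a)) \<Longrightarrow> v d = 0"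
  unfolding V0h_def mem_Collect_eq by meson+

lemma V0h_comp_Vh: "v \<in> V0h_comp M d \<Longrightarrow> v \<in> Vh M d"
  by (simp add: V0h_comp_def)

lemma subspace_V0h_comp: "subspace (V0h_comp M d)"
proof (rule subspaceI)
  show "0 \<in> V0h_comp M d" by (simp add: V0h_comp_def subspace_0[OF subspace_Vh])
  show "u + v \<in> V0h_comp M d" if "u \<in> V0h_comp M d" "v \<in> V0h_comp M d" for u v
    using that subspace_add[OF subspace_Vh, of u d v] by (simp add: V0h_comp_def nflux_add)
  have s: "(c *\<^sub>R u) i T = c *\<^sub>R u i T" for c and u :: "'i \<Rightarrow> 'a set \<Rightarrow> 'a \<Rightarrow> 'a" and i T by (simp add: scaleR_fun_def)
  show "c *\<^sub>R u \<in> V0h_comp M d" if "u \<in> V0h_comp M d" for c u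
    using that subspace_scale[OF subspace_Vh, of u d c] by (simp add: V0h_comp_def nflux_scale s)
qed

lemma subspace_V0h: "subspace (V0h M)"
proof -
  have "V0h M = {v. \<forall>d. v d \<in> (if 1 \<le> d \<and> d \<le> DIM('a) then V0h_comp M d else {0})}"
    unfolding V0h_def by (auto split: if_splits)
  then show ?thesis by (simp only:) (rule subspace_pointwise, simp add: subspace_V0h_comp subspace_single_0)
qed

lemma subspace_Wh: "subspace (Wh M)"
  unfolding Wh_def by (rule subspace_Times[OF subspace_V0h subspace_Lh])

definition pt :: "'a set \<Rightarrow> 'a" where "pt T = (SOME x. x \<in> rel_interior T)"

lemma pt: "int d simplex T \<Longrightarrow> pt T \<in> rel_interior T"
  unfolding pt_def using simplex_rel_interior_nonempty by (simp add: some_in_eq)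

lemma fin_coord_Lh: "fin_coord (Lh M)"
proof (rule fin_coord_family)
  let ?K = "SIGMA d:{..<DIM('a)}. SIGMA i:subidx M d. SIGMA j:intidx M d i. imesh M d i j"
  show "finite ?K"
    using geo_fin fin_int imesh_tri unfolding triangulation_def by (intro finite_SigmaI) simp_all
  show "lin_on (Lh M) ((\<lambda>(d, i, j, T) \<mu>. \<mu> d i j (pt T)) k)" for k
    by (rule lin_onI) (simp_all add: scaleR_fun_def split_def)
  fix \<mu> assume \<mu>: "\<mu> \<in> Lh M" "\<And>k. k \<in> ?K \<Longrightarrow> (\<lambda>(d, i, j, T) \<mu>. \<mu> d i j (pt T)) k \<mu> = 0"
  have "\<mu> d i j = 0" for d i j
  proof (cases "d < DIM('a) \<and> i \<in> subidx M d \<and> j \<in> intidx M d i")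
    case True
    show ?thesis
    proof (rule P0_zeroI)
      show "\<mu> d i j \<in> P0 (imesh M d i j)" using Lh_P0[OF \<mu>(1)] True by blast
      fix T assume T: "T \<in> imesh M d i j"
      then have "int d simplex T" using imesh[of d i j] True unfolding mesh_of_def by blast
      moreover have "\<mu> d i j (pt T) = 0" using \<mu>(2)[of "(d, i, j, T)"] True T by simp
      ultimately show "\<exists>x\<in>rel_interior T. \<mu> d i j x = 0" using pt by blast
    qed
  qed (rule Lh_off[OF \<mu>(1)])
  then show "\<mu> = 0" by (simp add: fun_eq_iff)
qed

lemma fin_coord_Qh: "fin_coord (Qh M)"
proof (rule fin_coord_family)
  let ?K = "SIGMA d:{..DIM('a)}. SIGMA i:subidx M d. mesh M d i"
  show "finite ?K"
    using geo_fin fin_mesh by (intro finite_SigmaI) simp_all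
  show "lin_on (Qh M) ((\<lambda>(d, i, T) q. q d i (pt T)) k)" for k
    by (rule lin_onI) (simp_all add: scaleR_fun_def split_def)
  fix q assume q: "q \<in> Qh M" "\<And>k. k \<in> ?K \<Longrightarrow> (\<lambda>(d, i, T) q. q d i (pt T)) k q = 0"
  have "q d i = 0" for d i
  proof (cases "d \<le> DIM('a) \<and> i \<in> subidx M d")
    case True
    show ?thesis
    proof (rule P0_zeroI)
      show "q d i \<in> P0 (mesh M d i)" using Qh_P0[OF q(1)] True by blast
      fix T assume T: "T \<in> mesh M d i"
      then have "int d simplex T" using mesh_simplex True by blast
      moreover have "q d i (pt T) = 0" using q(2)[of "(d, i, T)"] True T by simp
      ultimately show "\<exists>x\<in>rel_interior T. q d i x = 0" using pt by blast
    qed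
  qed (rule Qh_off[OF q(1)])
  then show "q = 0" by (simp add: fun_eq_iff)
qed

lemma V0h_zeroI:
  assumes v: "v \<in> V0h M"
    and z: "\<And>d i T f. 1 \<le> d \<Longrightarrow> d \<le> DIM('a) \<Longrightarrow> i \<in> subidx M d \<Longrightarrow> T \<in> mesh M d i \<Longrightarrow> f facet_of T \<Longrightarrow> nflux T f (v d i T) = 0"
  shows "v = 0"
proof
  fix d show "v d = 0 d"
  proof (cases "1 \<le> d \<and> d \<le> DIM('a)")
    case True
    then have d: "1 \<le> d" "d \<le> DIM('a)" by auto
    have "v d = 0"
      by (rule Vh_zeroI[OF d V0h_comp_Vh[OF V0h_comp[OF v d]]]) (rule z[OF d])
    then show ?thesis by simp
  next
    case False
    from V0h_off[OF v this] show ?thesis by simp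
  qed
qed

lemma fin_coord_V0h: "fin_coord (V0h M)"
proof (rule fin_coord_family)
  let ?K = "SIGMA d:{1..DIM('a)}. SIGMA i:subidx M d. SIGMA T:mesh M d i. {f. f facet_of T}"
  show "finite ?K"
    using geo_fin fin_mesh by (intro finite_SigmaI solid_finite_facets[OF mesh_solid]) simp_all
  show "lin_on (V0h M) ((\<lambda>(d, i, T, f) v. nflux T f (v d i T)) k)" for k
    by (rule lin_onI) (simp_all add: nflux_add nflux_scale scaleR_flux split_def)
  fix v assume v: "v \<in> V0h M" "\<And>k. k \<in> ?K \<Longrightarrow> (\<lambda>(d, i, T, f) v. nflux T f (v d i T)) k v = 0"
  show "v = 0"
  proof (rule V0h_zeroI[OF v(1)])
    show "nflux T f (v d i T) = 0" if "1 \<le> d" "d \<le> DIM('a)" "i \<in> subidx M d" "T \<in> mesh M d i" "f facet_of T" for d i T f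
      using v(2)[of "(d, i, T, f)"] that by simp
  qed
qed

lemma fin_coord_Wh: "fin_coord (Wh M)"
  unfolding Wh_def by (rule fin_coord_Times[OF fin_coord_V0h fin_coord_Lh])

lemma Lh_tame_mortars: "\<mu> \<in> Lh M \<Longrightarrow> d < DIM('a) \<Longrightarrow> \<mu> d \<in> tame_mortars d"
  unfolding tame_mortars_def mem_Collect_eq by (intro ballI P0_tame[OF imesh_tri Lh_P0])

text \<open>Fields without coupling between cells; the flux forms already make sense on them.\<close>

definition broken_RT :: "('a, 'i) flux set" where
  "broken_RT = {u. \<forall>d\<le>DIM('a). \<forall>i\<in>subidx M d. \<forall>T\<in>mesh M d i. u d i T \<in> RT0 T}"

lemma subspace_broken_RT: "subspace broken_RT"
  by (rule subspaceI) (simp_all add: broken_RT_def scaleR_flux subspace_0[OF subspace_RT0]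
      subspace_add[OF subspace_RT0] subspace_scale[OF subspace_RT0])

text \<open>The physical flux \<open>u\<^sub>0 + R\<^sub>h \<lambda>\<close>, through which fluxes and mortars enter all forms.\<close>

definition full_flux :: "('a, 'i, 'j) wvec \<Rightarrow> ('a, 'i) flux" where
  "full_flux w = fst w + Rh M (snd w)"

lemma Rh_add: "\<mu> \<in> Lh M \<Longrightarrow> \<nu> \<in> Lh M \<Longrightarrow> Rh M (\<mu> + \<nu>) = Rh M \<mu> + Rh M \<nu>"
proof
  fix d assume \<mu>: "\<mu> \<in> Lh M" and \<nu>: "\<nu> \<in> Lh M"
  show "Rh M (\<mu> + \<nu>) d = (Rh M \<mu> + Rh M \<nu>) d"
  proof (cases "1 \<le> d \<and> d \<le> DIM('a)")
    case True
    then have d: "d - 1 < DIM('a)" by auto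
    have eq: "Rh M \<eta> d = Rh_comp M (d - 1) (\<eta> (d - 1))" for \<eta> :: "('a, 'i, 'j) mortar"
      using True by (simp add: Rh_def)
    have "(\<mu> + \<nu>) (d - 1) = \<mu> (d - 1) + \<nu> (d - 1)" by (rule plus_fun_apply)
    then have "Rh M (\<mu> + \<nu>) d = Rh M \<mu> d + Rh M \<nu> d"
      unfolding eq using Rh_comp_add[OF d Lh_tame_mortars[OF \<mu> d] Lh_tame_mortars[OF \<nu> d]] by (simp only:)
    then show ?thesis by (rule trans[OF _ plus_fun_apply[symmetric]])
  next
    case False
    then show ?thesis by (simp only: Rh_def if_False plus_fun_apply add_0)
  qed
qed

lemma Rh_scale: "\<mu> \<in> Lh M \<Longrightarrow> Rh M (c *\<^sub>R \<mu>) = c *\<^sub>R Rh M \<mu>"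
proof
  fix d assume \<mu>: "\<mu> \<in> Lh M"
  have s: "(c *\<^sub>R \<mu>) d = c *\<^sub>R \<mu> d" "(c *\<^sub>R Rh M \<mu>) d = c *\<^sub>R Rh M \<mu> d" for d by (simp_all add: scaleR_fun_def)
  show "Rh M (c *\<^sub>R \<mu>) d = (c *\<^sub>R Rh M \<mu>) d"
  proof (cases "1 \<le> d \<and> d \<le> DIM('a)")
    case True
    then have d: "d - 1 < DIM('a)" by auto
    show ?thesis unfolding s unfolding Rh_def s
      using True Rh_comp_scale[OF d Lh_tame_mortars[OF \<mu> d]] by simp
  next
    case False
    have "c *\<^sub>R (0 :: 'i \<Rightarrow> 'a set \<Rightarrow> 'a \<Rightarrow> 'a) = 0" by (rule scaleR_zero_right)
    then show ?thesis unfolding s using False by (simp only: Rh_def if_False)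
  qed
qed

lemma Wh_iff: "w \<in> Wh M \<longleftrightarrow> fst w \<in> V0h M \<and> snd w \<in> Lh M"
  by (simp add: Wh_def mem_Times_iff)

lemma full_flux_add: "w \<in> Wh M \<Longrightarrow> r \<in> Wh M \<Longrightarrow> full_flux (w + r) = full_flux w + full_flux r"
  by (simp add: full_flux_def Wh_iff Rh_add)

lemma full_flux_scale: "w \<in> Wh M \<Longrightarrow> full_flux (c *\<^sub>R w) = c *\<^sub>R full_flux w"
  by (simp add: full_flux_def Wh_iff Rh_scale scaleR_add_right)

lemma full_flux_broken: "w \<in> Wh M \<Longrightarrow> full_flux w \<in> broken_RT"
  unfolding broken_RT_def mem_Collect_eq
proof (intro allI ballI impI)
  fix d i T assume w: "w \<in> Wh M" and d: "d \<le> DIM('a)" and i: "i \<in> subidx M d" and T: "T \<in> mesh M d i"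
  show "full_flux w d i T \<in> RT0 T"
  proof (cases "1 \<le> d")
    case True
    have 1: "fst w d i T \<in> RT0 T"
      using w V0h_comp_Vh[OF V0h_comp[OF _ True d]] Vh_RT0[OF _ i T] by (simp add: Wh_iff)
    have "Rh_comp M (d - 1) (snd w (d - 1)) \<in> interface_fluxes (d - 1)"
      using w d True by (intro Rh_comp_interface_fluxes Lh_tame_mortars) (simp_all add: Wh_iff)
    then have "Rh M (snd w) d \<in> Vh M d" using True d by (simp add: interface_fluxes_def Rh_def)
    from subspace_add[OF subspace_RT0 1 Vh_RT0[OF this i T]] show ?thesis by (simp add: full_flux_def)
  next
    case False
    then have "fst w d = 0" "Rh M (snd w) d = 0" using V0h_off[of "fst w" d] w by (simp_all add: Wh_iff Rh_def)
    then show ?thesis by (simp add: full_flux_def subspace_0[OF subspace_RT0])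
  qed
qed

section \<open>The forms on fluxes and mortars\<close>

lemma perm_spd:
  shows "\<exists>c. \<forall>d\<in>{1..DIM('a)}. \<forall>i\<in>subidx M d. spd_on (tangent (subdom M d i)) (perm M d i) c"
proof -
  have "\<exists>c>0. \<exists>C. \<forall>d\<in>{1..DIM('a)}. \<forall>i\<in>subidx M d.
        let U = tangent (subdom M d i); K = perm M d i in
        linear K \<and> K ` U \<subseteq> U \<and> (\<forall>x\<in>U. \<forall>y\<in>U. K x \<bullet> y = x \<bullet> K y) \<and>
        (\<forall>x\<in>U. c * (x \<bullet> x) \<le> K x \<bullet> x \<and> K x \<bullet> x \<le> C * (x \<bullet> x))"
    using par unfolding admissible_parameters_def by (elim conjE)
  then obtain c C where c: "c > 0" and *: "\<forall>d\<in>{1..DIM('a)}. \<forall>i\<in>subidx M d.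
        let U = tangent (subdom M d i); K = perm M d i in
        linear K \<and> K ` U \<subseteq> U \<and> (\<forall>x\<in>U. \<forall>y\<in>U. K x \<bullet> y = x \<bullet> K y) \<and>
        (\<forall>x\<in>U. c * (x \<bullet> x) \<le> K x \<bullet> x \<and> K x \<bullet> x \<le> C * (x \<bullet> x))" by (elim exE conjE)
  show ?thesis
  proof (intro exI[of _ c] ballI)
    fix d i assume "d \<in> {1..DIM('a)}" "i \<in> subidx M d"
    note K = *[THEN bspec, OF this(1), THEN bspec, OF this(2), unfolded Let_def]
    show "spd_on (tangent (subdom M d i)) (perm M d i) c"
    proof (rule spd_on.intro)
      show "linear (perm M d i)" "perm M d i ` tangent (subdom M d i) \<subseteq> tangent (subdom M d i)"
        using K by simp_all
    qed (use K c in \<open>blast intro: subspace_tangent\<close>)+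
  qed
qed

lemma RT0_continuous: "u \<in> RT0 T \<Longrightarrow> continuous_on T u"
proof -
  assume "u \<in> RT0 T"
  then obtain a b where "\<forall>x\<in>T. u x = a + b *\<^sub>R x" unfolding RT0_iff by blast
  then show ?thesis by (subst continuous_on_cong[OF refl, of T u "\<lambda>x. a + b *\<^sub>R x"]) (auto intro!: continuous_intros)
qed

text \<open>The flux form of one cell is semidefinite because the inverse permeability is positive on the
tangent space. On a basis field it is positive, since this field has no zero inside the cell.\<close>

lemma K_form:
  assumes d: "1 \<le> d" "d \<le> DIM('a)" and i: "i \<in> subidx M d" and T: "T \<in> mesh M d i"
  shows semi_form_K: "semi_form (RT0 T) (\<lambda>u v. LINT x:T|flat_measure T. perm_inv M d i (u x) \<bullet> v x)"
    and K_form_basis_pos: "f facet_of T \<Longrightarrow> (LINT x:T|flat_measure T. perm_inv M d i (RT_basis T f x) \<bullet> RT_basis T f x) > 0"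
proof -
  have "d \<in> {1..DIM('a)}" using d by simp
  with perm_spd i obtain c where "spd_on (tangent (subdom M d i)) (perm M d i) c" by blast
  then interpret K: spd_on "tangent (subdom M d i)" "perm M d i" c .
  have ten: "tangent T = tangent (subdom M d i)"
    using mesh_hull[OF d(2) i T] by (metis tangent_affine_hull)
  have Tc: "compact T" using mesh_simplex[OF d(2) i T] by (rule simplex_compact)
  have mem: "u x \<in> tangent (subdom M d i)" if "u \<in> RT0 T" "x \<in> T" for u x
    using that ten unfolding RT0_iff by blast
  have int: "set_integrable (flat_measure T) T (\<lambda>x. perm_inv M d i (u x) \<bullet> v x)"
    if "u \<in> RT0 T" "v \<in> RT0 T" for u v
  proof -
    have "continuous_on T (\<lambda>x. K.Ki (u x))"
      by (rule continuous_on_compose2[OF K.Ki_continuous RT0_continuous[OF that(1)]]) (use mem that in auto)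
    from continuous_set_integrable_flat[OF Tc continuous_on_inner[OF this RT0_continuous[OF that(2)]]]
    show ?thesis unfolding perm_inv_def .
  qed
  have pos: "0 \<le> perm_inv M d i (u x) \<bullet> u x" if "u \<in> RT0 T" "x \<in> T" for u x
    using K.Ki_nonneg[OF mem[OF that]] by (simp add: perm_inv_def)
  show semi: "semi_form (RT0 T) (\<lambda>u v. LINT x:T|flat_measure T. perm_inv M d i (u x) \<bullet> v x)"
  proof
    show "subspace (RT0 T)" by (rule subspace_RT0)
    fix u assume u: "u \<in> RT0 T"
    show "lin_on (RT0 T) (\<lambda>v. LINT x:T|flat_measure T. perm_inv M d i (u x) \<bullet> v x)"
    proof (rule lin_onI)
      fix v w assume "v \<in> RT0 T" "w \<in> RT0 T"
      then show "(LINT x:T|flat_measure T. perm_inv M d i (u x) \<bullet> (v + w) x) =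
          (LINT x:T|flat_measure T. perm_inv M d i (u x) \<bullet> v x) + (LINT x:T|flat_measure T. perm_inv M d i (u x) \<bullet> w x)"
        using set_integral_add(2)[OF int int, of u v u w] u by (simp add: inner_add_right)
    next
      fix k v
      show "(LINT x:T|flat_measure T. perm_inv M d i (u x) \<bullet> (k *\<^sub>R v) x) =
          k * (LINT x:T|flat_measure T. perm_inv M d i (u x) \<bullet> v x)"
        by (simp add: scaleR_fun_def)
    qed
    show "0 \<le> (LINT x:T|flat_measure T. perm_inv M d i (u x) \<bullet> u x)"
      unfolding set_lebesgue_integral_def
      by (rule integral_nonneg_AE) (use pos[OF u] in \<open>auto simp: indicator_def\<close>)
    fix v assume v: "v \<in> RT0 T"
    show "(LINT x:T|flat_measure T. perm_inv M d i (u x) \<bullet> v x) = (LINT x:T|flat_measure T. perm_inv M d i (v x) \<bullet> u x)"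
    proof (rule set_lebesgue_integral_cong)
      show "T \<in> sets (flat_measure T)" using Tc by (simp add: borel_closed compact_imp_closed)
      show "\<forall>x. x \<in> T \<longrightarrow> perm_inv M d i (u x) \<bullet> v x = perm_inv M d i (v x) \<bullet> u x"
        using K.Ki_sym mem u v by (simp add: perm_inv_def)
    qed
  qed
  show "(LINT x:T|flat_measure T. perm_inv M d i (RT_basis T f x) \<bullet> RT_basis T f x) > 0" if f: "f facet_of T"
  proof (rule ccontr)
    have so: "solid T" by (rule mesh_solid[OF d(2,1) i T])
    have b: "RT_basis T f \<in> RT0 T" by (rule solid_basis_RT0[OF so f])
    assume "\<not> (LINT x:T|flat_measure T. perm_inv M d i (RT_basis T f x) \<bullet> RT_basis T f x) > 0"
    then have z: "(LINT x:T|flat_measure T. perm_inv M d i (RT_basis T f x) \<bullet> RT_basis T f x) = 0"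
      using semi_form.nonneg[OF semi b] by linarith
    have "\<exists>x\<in>rel_interior T. perm_inv M d i (RT_basis T f x) \<bullet> RT_basis T f x = 0"
      by (rule flat_integral_zero_on_openin[OF int[OF b b] pos[OF b] z openin_rel_interior rel_interior_subset
            simplex_rel_interior_nonempty[OF mesh_simplex[OF d(2) i T]]])
    then obtain x where x: "x \<in> rel_interior T" "perm_inv M d i (RT_basis T f x) \<bullet> RT_basis T f x = 0" by blast
    then have "x \<in> T" using rel_interior_subset by blast
    then have "RT_basis T f x = 0" using K.Ki_zero_iff[OF mem[OF b]] x(2) by (simp add: perm_inv_def)
    then show False using solid_basis_nonzero[OF so f x(1)] by simp
  qed
qed

lemma semi_form_ip_K: "semi_form broken_RT (ip_K M)"
proof -
  have "semi_form broken_RT (\<lambda>u v. \<Sum>d=1..DIM('a). \<Sum>i\<in>subidx M d. \<Sum>T\<in>mesh M d i.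
     (LINT x:T|flat_measure T. perm_inv M d i (u d i T x) \<bullet> v d i T x))"
  proof (intro semi_form_sum subspace_broken_RT)
    fix d i T assume a: "d \<in> {1..DIM('a)}" "i \<in> subidx M d" "T \<in> mesh M d i"
    show "semi_form broken_RT (\<lambda>u v. LINT x:T|flat_measure T. perm_inv M d i (u d i T x) \<bullet> v d i T x)"
      by (rule semi_form_pullback[OF semi_form_K[of d i T] subspace_broken_RT, where f = "\<lambda>u. u d i T"])
        (use a in \<open>simp_all add: broken_RT_def scaleR_flux\<close>)
  qed
  then show ?thesis by (simp add: ip_K_def[abs_def])
qed

lemma no_facets_0: "int 0 simplex T \<Longrightarrow> \<not> f facet_of T"
proof -
  assume "int 0 simplex T"
  then have "aff_dim T = 0" using aff_dim_simplex[of 0 T] by simp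
  then show ?thesis by (simp add: facet_of_def) (metis aff_dim_empty)
qed

definition KD_coeff :: "nat \<Rightarrow> 'i \<Rightarrow> 'a set \<Rightarrow> 'a set \<Rightarrow> real" where
  "KD_coeff d i T f = (LINT x:T|flat_measure T. perm_inv M d i (RT_basis T f x) \<bullet> RT_basis T f x)"

text \<open>A cell with a facet has positive dimension, so the degenerate case \<open>d = 0\<close> of the sum over
dimensions is empty.\<close>

lemma KD_coeff_pos:
  assumes "d \<le> DIM('a)" "i \<in> subidx M d" "T \<in> mesh M d i" "f facet_of T"
  shows "KD_coeff d i T f > 0"
proof -
  have "d \<noteq> 0"
  proof
    assume "d = 0"
    with mesh_simplex[OF assms(1-3)] have "int 0 simplex T" by simp
    from no_facets_0[OF this] assms(4) show False by blast
  qed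
  then show ?thesis unfolding KD_coeff_def using assms by (intro K_form_basis_pos) simp_all
qed

lemma ip_KD_eq: "ip_KD M u v = (\<Sum>d=0..DIM('a). \<Sum>i\<in>subidx M d. \<Sum>T\<in>mesh M d i. \<Sum>f\<in>{f. f facet_of T}.
     KD_coeff d i T f * (nflux T f (u d i T) * nflux T f (v d i T)))"
  unfolding ip_KD_def KD_coeff_def by (simp add: mult.commute)

lemma semi_form_ip_KD: "semi_form broken_RT (ip_KD M)"
proof -
  have "semi_form broken_RT (\<lambda>u v. \<Sum>d=0..DIM('a). \<Sum>i\<in>subidx M d. \<Sum>T\<in>mesh M d i. \<Sum>f\<in>{f. f facet_of T}.
     KD_coeff d i T f * (nflux T f (u d i T) * nflux T f (v d i T)))"
  proof (intro semi_form_sum subspace_broken_RT semi_form_scale)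
    fix d i T f assume a: "d \<in> {0..DIM('a)}" "i \<in> subidx M d" "T \<in> mesh M d i" "f \<in> {f. f facet_of T}"
    have "semi_form (UNIV :: real set) (*)"
      by standard (auto simp: lin_on_def algebra_simps)
    then show "semi_form broken_RT (\<lambda>u v. nflux T f (u d i T) * nflux T f (v d i T))"
      by (rule semi_form_pullback[OF _ subspace_broken_RT]) (simp_all add: nflux_add nflux_scale scaleR_flux)
    show "KD_coeff d i T f \<ge> 0" using KD_coeff_pos[of d i T f] a by simp
  qed
  then show ?thesis unfolding ip_KD_eq[abs_def] .
qed

lemma ip_KD_zeroD:
  assumes z: "ip_KD M u u = 0" and d: "1 \<le> d" "d \<le> DIM('a)" and i: "i \<in> subidx M d"
    and T: "T \<in> mesh M d i" and f: "f facet_of T"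
  shows "nflux T f (u d i T) = 0"
proof -
  let ?t = "\<lambda>d i T f. KD_coeff d i T f * (nflux T f (u d i T) * nflux T f (u d i T))"
  have nn: "0 \<le> ?t d i T f" if "d \<le> DIM('a)" "i \<in> subidx M d" "T \<in> mesh M d i" "f facet_of T" for d i T f
    using KD_coeff_pos[OF that] by simp
  have ff: "finite {f. f facet_of T}" by (rule solid_finite_facets[OF mesh_solid[OF d(2,1) i T]])
  have "(\<Sum>i\<in>subidx M d. \<Sum>T\<in>mesh M d i. \<Sum>f\<in>{f. f facet_of T}. ?t d i T f) = 0"
    using z unfolding ip_KD_eq
    by (subst (asm) sum_nonneg_eq_0_iff) (use d nn in \<open>auto intro!: sum_nonneg\<close>)
  then have "(\<Sum>T\<in>mesh M d i. \<Sum>f\<in>{f. f facet_of T}. ?t d i T f) = 0"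
    by (subst (asm) sum_nonneg_eq_0_iff) (use d i nn geo_fin in \<open>auto intro!: sum_nonneg\<close>)
  then have "(\<Sum>f\<in>{f. f facet_of T}. ?t d i T f) = 0"
    by (subst (asm) sum_nonneg_eq_0_iff) (use d i T nn fin_mesh in \<open>auto intro!: sum_nonneg\<close>)
  then have "?t d i T f = 0"
    by (subst (asm) sum_nonneg_eq_0_iff) (use d i T f nn ff in auto)
  then show ?thesis using KD_coeff_pos[OF d(2) i T f] by simp
qed

definition mortar_coeff :: "nat \<Rightarrow> 'i \<Rightarrow> 'j \<Rightarrow> real" where
  "mortar_coeff d i j = aper M d i j / nperm M d i j"

lemma mortar_coeff_pos:
  assumes "d < DIM('a)" "i \<in> subidx M d" "j \<in> intidx M d i"
  shows "mortar_coeff d i j > 0"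
proof -
  have "\<exists>c>0. \<exists>C. \<forall>d<DIM('a). \<forall>i\<in>subidx M d. \<forall>j\<in>intidx M d i. c \<le> nperm M d i j \<and> nperm M d i j \<le> C"
    and a: "\<forall>d<DIM('a). \<forall>i\<in>subidx M d. \<forall>j\<in>intidx M d i. aper M d i j > 0"
    using par unfolding admissible_parameters_def by simp_all
  then obtain c where "c > 0" "c \<le> nperm M d i j" using assms by blast
  moreover have "aper M d i j > 0" using a assms by simp
  ultimately show ?thesis by (simp add: mortar_coeff_def)
qed

lemma ip_mortar_eq: "ip_mortar M \<eta> \<mu> = (\<Sum>d<DIM('a). \<Sum>i\<in>subidx M d. \<Sum>j\<in>intidx M d i.
    mortar_coeff d i j * (LINT x:subdom M d i|flat_measure (subdom M d i). \<eta> d i j x * \<mu> d i j x))"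
  unfolding ip_mortar_def ip_Gamma_def mortar_coeff_def by (simp add: mult.assoc)

lemma semi_form_ip_mortar: "semi_form (Lh M) (ip_mortar M)"
proof -
  have "semi_form (Lh M) (\<lambda>\<eta> \<mu>. \<Sum>d<DIM('a). \<Sum>i\<in>subidx M d. \<Sum>j\<in>intidx M d i.
    mortar_coeff d i j * (LINT x:subdom M d i|flat_measure (subdom M d i). \<eta> d i j x * \<mu> d i j x))"
  proof (intro semi_form_sum subspace_Lh semi_form_scale)
    fix d i j assume a: "d \<in> {..<DIM('a)}" "i \<in> subidx M d" "j \<in> intidx M d i"
    show "semi_form (Lh M) (\<lambda>\<eta> \<mu>. LINT x:subdom M d i|flat_measure (subdom M d i). \<eta> d i j x * \<mu> d i j x)"
      by (rule semi_form_pullback[OF semi_form_L2 subspace_Lh, where f = "\<lambda>\<eta>. \<eta> d i j"])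
        (use a sub_borel Lh_tame_mortars in \<open>simp_all add: scaleR_mortar tame_mortars_def\<close>)
    show "mortar_coeff d i j \<ge> 0" using mortar_coeff_pos[of d i j] a by simp
  qed
  then show ?thesis unfolding ip_mortar_eq[abs_def] .
qed

lemma ip_mortar_zeroD:
  assumes \<mu>: "\<mu> \<in> Lh M" and z: "ip_mortar M \<mu> \<mu> = 0" shows "\<mu> = 0"
proof -
  let ?t = "\<lambda>d i j. mortar_coeff d i j * (LINT x:subdom M d i|flat_measure (subdom M d i). \<mu> d i j x * \<mu> d i j x)"
  have nn: "0 \<le> ?t d i j" if "d < DIM('a)" "i \<in> subidx M d" "j \<in> intidx M d i" for d i j
  proof -
    have "0 \<le> (LINT x:subdom M d i|flat_measure (subdom M d i). \<mu> d i j x * \<mu> d i j x)"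
      unfolding set_lebesgue_integral_def by (rule integral_nonneg_AE) (auto simp: indicator_def)
    then show ?thesis using mortar_coeff_pos[OF that] by simp
  qed
  have "\<mu> d i j = 0" for d i j
  proof (cases "d < DIM('a) \<and> i \<in> subidx M d \<and> j \<in> intidx M d i")
    case True
    then have d: "d < DIM('a)" and i: "i \<in> subidx M d" and j: "j \<in> intidx M d i" by auto
    have "(\<Sum>i\<in>subidx M d. \<Sum>j\<in>intidx M d i. ?t d i j) = 0"
      using z unfolding ip_mortar_eq
      by (subst (asm) sum_nonneg_eq_0_iff) (use d nn in \<open>auto intro!: sum_nonneg\<close>)
    then have "(\<Sum>j\<in>intidx M d i. ?t d i j) = 0"
      by (subst (asm) sum_nonneg_eq_0_iff) (use d i nn geo_fin in \<open>auto intro!: sum_nonneg\<close>)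
    then have "?t d i j = 0"
      by (subst (asm) sum_nonneg_eq_0_iff) (use d i j nn fin_int in auto)
    then have zz: "(LINT x:subdom M d i|flat_measure (subdom M d i). \<mu> d i j x * \<mu> d i j x) = 0"
      using mortar_coeff_pos[OF d i j] by simp
    show ?thesis
    proof (rule P0_zeroI[OF Lh_P0[OF \<mu> d i j]])
      fix T assume T: "T \<in> imesh M d i j"
      show "\<exists>x\<in>rel_interior T. \<mu> d i j x = 0"
        by (rule square_integral_zero_point[OF _ i _ zz imesh_hull(2,3,1)[OF d i j T]])
          (use d P0_tame[OF imesh_tri[OF d i j] Lh_P0[OF \<mu> d i j]] in simp_all)
    qed
  qed (rule Lh_off[OF \<mu>])
  then show ?thesis by (simp add: fun_eq_iff)
qed

lemma semi_form_a: "semi_form (Wh M) (a_form M)"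
  and semi_form_aD: "semi_form (Wh M) (aD_form M)"
proof -
  have m: "semi_form (Wh M) (\<lambda>w r. ip_mortar M (snd w) (snd r))"
    by (rule semi_form_pullback[OF semi_form_ip_mortar subspace_Wh]) (simp_all add: Wh_iff)
  have "semi_form (Wh M) (\<lambda>w r. ip_K M (full_flux w) (full_flux r))"
    by (rule semi_form_pullback[OF semi_form_ip_K subspace_Wh])
      (simp_all add: full_flux_broken full_flux_add full_flux_scale)
  from semi_form_add[OF this m] show "semi_form (Wh M) (a_form M)"
    unfolding a_form_def[abs_def] full_flux_def .
  have "semi_form (Wh M) (\<lambda>w r. ip_KD M (full_flux w) (full_flux r))"
    by (rule semi_form_pullback[OF semi_form_ip_KD subspace_Wh])
      (simp_all add: full_flux_broken full_flux_add full_flux_scale)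
  from semi_form_add[OF this m] show "semi_form (Wh M) (aD_form M)"
    unfolding aD_form_def[abs_def] full_flux_def .
qed

lemma Rh_zero: "Rh M 0 = 0"
  using Rh_scale[OF subspace_0[OF subspace_Lh], of 0] by simp

text \<open>The mortar part controls \<open>\<lambda>\<close>; when \<open>\<lambda> = 0\<close> the extension vanishes, and the flux part controls
all facet fluxes of \<open>u\<^sub>0\<close>.\<close>

lemma inner_form_aD: "inner_form (Wh M) (aD_form M)"
proof (intro inner_form.intro semi_form_aD inner_form_axioms.intro)
  fix w assume w: "w \<in> Wh M" and z: "aD_form M w w = 0"
  have 1: "0 \<le> ip_KD M (full_flux w) (full_flux w)"
    by (rule semi_form.nonneg[OF semi_form_ip_KD full_flux_broken[OF w]])
  have 2: "0 \<le> ip_mortar M (snd w) (snd w)"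
    using semi_form.nonneg[OF semi_form_ip_mortar] w by (simp add: Wh_iff)
  have z: "ip_KD M (full_flux w) (full_flux w) + ip_mortar M (snd w) (snd w) = 0"
    using z by (simp add: aD_form_def full_flux_def)
  then have "ip_mortar M (snd w) (snd w) = 0" using 1 2 by linarith
  then have snd0: "snd w = 0" using ip_mortar_zeroD w by (simp add: Wh_iff)
  have f: "full_flux w = fst w" by (simp add: full_flux_def snd0 Rh_zero)
  have "ip_KD M (fst w) (fst w) = 0" using 1 2 z f by simp
  then have "fst w = 0" using V0h_zeroI[of "fst w"] ip_KD_zeroD w by (simp add: Wh_iff)
  then show "w = 0" using snd0 by (simp add: prod_eq_iff)
qed

lemma jump_tame: "\<mu> \<in> Lh M \<Longrightarrow> d < DIM('a) \<Longrightarrow> i \<in> subidx M d \<Longrightarrow> tame (jump M \<mu> d i)"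
proof -
  assume a: "\<mu> \<in> Lh M" "d < DIM('a)" "i \<in> subidx M d"
  have "tame (\<lambda>x. (-1) * (\<Sum>j\<in>intidx M d i. \<mu> d i j x))"
    using Lh_tame_mortars[OF a(1,2)] a(3) by (intro tame_cmult tame_sum) (simp add: tame_mortars_def)
  then show ?thesis by (simp add: jump_def[abs_def])
qed

text \<open>Divergences of Raviart-Thomas fields are constant on cells, and jumps are sums of piecewise constants
on the interface meshes.\<close>

lemma mdiv_tame:
  assumes u: "u \<in> broken_RT" and \<mu>: "\<mu> \<in> Lh M" and d: "d \<le> DIM('a)" and i: "i \<in> subidx M d"
  shows "tame (mdiv M u \<mu> d i)"
proof -
  have "tame (\<lambda>x. indicator (rel_interior T) x * flat_div (tangent T) (u d i T) x)" if T: "T \<in> mesh M d i" for T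
  proof -
    have "u d i T \<in> RT0 T" using u d i T by (simp add: broken_RT_def)
    from flat_div_RT0_const[OF this] obtain c where c: "\<forall>x\<in>rel_interior T. flat_div (tangent T) (u d i T) x = c" by blast
    have eq: "(\<lambda>x. indicator (rel_interior T) x * flat_div (tangent T) (u d i T) x) = (\<lambda>x. c * indicator (rel_interior T) x)"
      using c by (auto simp: fun_eq_iff indicator_def)
    have "bounded (rel_interior T)"
      by (rule bounded_subset[OF compact_imp_bounded[OF simplex_compact[OF mesh_simplex[OF d i T]]] rel_interior_subset])
    then show ?thesis unfolding eq by (intro tame_cmult tame_indicator) simp_all
  qed
  moreover have "tame (\<lambda>x. if d < DIM('a) then jump M \<mu> d i x else 0)"
    using jump_tame[OF \<mu> _ i] by (cases "d < DIM('a)") simp_all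
  ultimately have "tame (\<lambda>x. (\<Sum>T\<in>mesh M d i. indicator (rel_interior T) x * flat_div (tangent T) (u d i T) x) +
     (if d < DIM('a) then jump M \<mu> d i x else 0))"
    by (intro tame_add tame_sum)
  then show ?thesis by (simp add: mdiv_def[abs_def])
qed

text \<open>Additivity holds at every point \<open>x\<close>, even where the divergence is not meaningful, because the indicator
of the relative interiors removes these points.\<close>

lemma mdiv_lin:
  assumes d: "d \<le> DIM('a)" and i: "i \<in> subidx M d"
  shows "lin_on (Wh M) (\<lambda>r. mdiv M (full_flux r) (snd r) d i x)"
  unfolding mdiv_def
proof (intro lin_on_plus lin_on_sum)
  fix T assume T: "T \<in> mesh M d i"
  show "lin_on (Wh M) (\<lambda>r. indicator (rel_interior T) x * flat_div (tangent T) (full_flux r d i T) x)"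
  proof (cases "x \<in> rel_interior T")
    case True
    have "lin_on (Wh M) (\<lambda>r. flat_div (tangent T) (full_flux r d i T) x)"
      by (rule lin_on_comp[OF flat_div_lin[OF True]])
        (use full_flux_broken d i T in \<open>simp_all add: full_flux_add full_flux_scale scaleR_flux broken_RT_def\<close>)
    then show ?thesis by (rule lin_on_mult)
  qed (simp add: lin_on_def)
next
  show "lin_on (Wh M) (\<lambda>r. if d < DIM('a) then jump M (snd r) d i x else 0)"
    by (rule lin_onI) (simp_all add: jump_def sum.distrib scaleR_fun_def sum_distrib_left)
qed

lemma b_form_eq: "b_form M r q = (-1) * (\<Sum>d=0..DIM('a). \<Sum>i\<in>subidx M d.
     (LINT x:subdom M d i|flat_measure (subdom M d i). q d i x * mdiv M (full_flux r) (snd r) d i x))"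
  by (simp add: b_form_def full_flux_def)

lemma b_lin_r: 
  assumes q: "q \<in> Qh M" shows "lin_on (Wh M) (\<lambda>r. b_form M r q)"
  unfolding b_form_eq
proof (intro lin_on_mult lin_on_sum)
  fix d i assume a: "d \<in> {0..DIM('a)}" "i \<in> subidx M d"
  then have d: "d \<le> DIM('a)" by simp
  interpret L: semi_form "{f. tame f}" "\<lambda>f g. LINT x:subdom M d i|flat_measure (subdom M d i). f x * g x"
    by (rule semi_form_L2[OF sub_borel[OF d a(2)]])
  have "tame (q d i)" by (rule P0_tame[OF mesh_tri[OF d a(2)] Qh_P0[OF q d a(2)]])
  then have "lin_on {f. tame f} (\<lambda>g. LINT x:subdom M d i|flat_measure (subdom M d i). q d i x * g x)"
    by (intro L.lin) simp
  from this show "lin_on (Wh M) (\<lambda>r. LINT x:subdom M d i|flat_measure (subdom M d i). q d i x * mdiv M (full_flux r) (snd r) d i x)"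
  proof (rule lin_on_comp)
    fix r s assume r: "r \<in> Wh M"
    show "mdiv M (full_flux r) (snd r) d i \<in> {f. tame f}"
      using mdiv_tame[OF full_flux_broken[OF r] _ d a(2)] r by (simp add: Wh_iff)
    show "mdiv M (full_flux (c *\<^sub>R r)) (snd (c *\<^sub>R r)) d i = c *\<^sub>R mdiv M (full_flux r) (snd r) d i" for c
      using lin_on_scale[OF mdiv_lin[OF d a(2)] r] by (simp add: fun_eq_iff scaleR_fun_def[of c "mdiv M (full_flux r) (snd r) d i"])
    assume s: "s \<in> Wh M"
    show "mdiv M (full_flux (r + s)) (snd (r + s)) d i = mdiv M (full_flux r) (snd r) d i + mdiv M (full_flux s) (snd s) d i"
      using lin_on_add[OF mdiv_lin[OF d a(2)] r s] by (simp add: fun_eq_iff)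
  qed
qed

lemma b_lin_q: 
  assumes r: "r \<in> Wh M" shows "lin_on (Qh M) (b_form M r)"
proof -
  have "lin_on (Qh M) (\<lambda>q. b_form M r q)"
    unfolding b_form_eq
  proof (intro lin_on_mult lin_on_sum)
    fix d i assume a: "d \<in> {0..DIM('a)}" "i \<in> subidx M d"
    then have d: "d \<le> DIM('a)" by simp
    interpret L: semi_form "{f. tame f}" "\<lambda>f g. LINT x:subdom M d i|flat_measure (subdom M d i). f x * g x"
      by (rule semi_form_L2[OF sub_borel[OF d a(2)]])
    have m: "tame (mdiv M (full_flux r) (snd r) d i)"
      using mdiv_tame[OF full_flux_broken[OF r] _ d a(2)] r by (simp add: Wh_iff)
    have qn: "tame (q d i)" if "q \<in> Qh M" for q by (rule P0_tame[OF mesh_tri[OF d a(2)] Qh_P0[OF that d a(2)]])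
    have "lin_on {f. tame f} (\<lambda>g. LINT x:subdom M d i|flat_measure (subdom M d i). mdiv M (full_flux r) (snd r) d i x * g x)"
      using m by (intro L.lin) simp
    then have "lin_on (Qh M) (\<lambda>q. LINT x:subdom M d i|flat_measure (subdom M d i). mdiv M (full_flux r) (snd r) d i x * q d i x)"
      by (rule lin_on_comp[where f = "\<lambda>q. q d i"]) (simp_all add: qn scaleR_pressure)
    then show "lin_on (Qh M) (\<lambda>q. LINT x:subdom M d i|flat_measure (subdom M d i). q d i x * mdiv M (full_flux r) (snd r) d i x)"
      by (simp add: mult.commute)
  qed
  then show ?thesis .
qed

section \<open>The discrete gradient and the block operators\<close>

text \<open>Existence and uniqueness come from the Riesz theorem for \<open>a\<^sup>D\<close>.\<close>

lemma Dh_spec: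
  assumes q: "q \<in> Qh M"
  shows "Dh M q \<in> Wh M \<and> (\<forall>r\<in>Wh M. aD_form M (Dh M q) r = b_form M r q)"
  unfolding Dh_def
  by (rule theI'[OF inner_form.riesz[OF inner_form_aD fin_coord_Wh b_lin_r[OF q]]])

lemma Dh_mem: "q \<in> Qh M \<Longrightarrow> Dh M q \<in> Wh M"
  and Dh_eq: "q \<in> Qh M \<Longrightarrow> r \<in> Wh M \<Longrightarrow> aD_form M (Dh M q) r = b_form M r q"
  using Dh_spec by blast+

lemma Dh_add:
  assumes p: "p \<in> Qh M" and q: "q \<in> Qh M" shows "Dh M (p + q) = Dh M p + Dh M q"
proof -
  interpret D: inner_form "Wh M" "aD_form M" by (rule inner_form_aD)
  note pq = subspace_add[OF subspace_Qh p q]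
  show ?thesis
  proof (rule D.eqI)
    fix r assume r: "r \<in> Wh M"
    show "aD_form M (Dh M (p + q)) r = aD_form M (Dh M p + Dh M q) r"
      using Dh_eq[OF pq r] Dh_eq[OF p r] Dh_eq[OF q r] lin_on_add[OF b_lin_q[OF r] p q]
        D.add_l[OF r Dh_mem[OF p] Dh_mem[OF q]] by simp
  qed (use Dh_mem p q pq D.in_sub in auto)
qed

lemma Dh_scale:
  assumes q: "q \<in> Qh M" shows "Dh M (c *\<^sub>R q) = c *\<^sub>R Dh M q"
proof -
  interpret D: inner_form "Wh M" "aD_form M" by (rule inner_form_aD)
  note cq = subspace_scale[OF subspace_Qh q, of c]
  show ?thesis
  proof (rule D.eqI)
    fix r assume r: "r \<in> Wh M"
    show "aD_form M (Dh M (c *\<^sub>R q)) r = aD_form M (c *\<^sub>R Dh M q) r"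
      using Dh_eq[OF cq r] Dh_eq[OF q r] lin_on_scale[OF b_lin_q[OF r] q, of c]
        D.scale_l[OF r Dh_mem[OF q], of c] by simp
  qed (use Dh_mem q cq D.in_sub in auto)
qed

text \<open>The form whose square root is the norm.\<close>

definition ipX :: "('a, 'i, 'j) xvec \<Rightarrow> ('a, 'i, 'j) xvec \<Rightarrow> real" where
  "ipX x y = a_form M (fst x) (fst y) + aD_form M (Dh M (snd x)) (Dh M (snd y))"

lemma tnorm_eq: "tnorm M x = sqrt (ipX x x)"
  by (simp add: tnorm_def ipX_def split_def)

lemma Xh_iff: "x \<in> Xh M \<longleftrightarrow> fst x \<in> Wh M \<and> snd x \<in> Qh M"
  by (simp add: Xh_def mem_Times_iff)

lemma subspace_Xh: "subspace (Xh M)"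
  unfolding Xh_def by (rule subspace_Times[OF subspace_Wh subspace_Qh])

lemma fin_coord_Xh: "fin_coord (Xh M)"
  unfolding Xh_def by (rule fin_coord_Times[OF fin_coord_Wh fin_coord_Qh])

lemma semi_form_ipX: "semi_form (Xh M) ipX"
  unfolding ipX_def[abs_def]
proof (rule semi_form_add)
  show "semi_form (Xh M) (\<lambda>x y. a_form M (fst x) (fst y))"
    by (rule semi_form_pullback[OF semi_form_a subspace_Xh]) (simp_all add: Xh_iff)
  show "semi_form (Xh M) (\<lambda>x y. aD_form M (Dh M (snd x)) (Dh M (snd y)))"
    by (rule semi_form_pullback[OF semi_form_aD subspace_Xh]) (simp_all add: Xh_iff Dh_mem Dh_add Dh_scale)
qed

lemma L_eq: "L_form M x y = a_form M (fst x) (fst y) + aD_form M (Dh M (snd x)) (fst y) + aD_form M (Dh M (snd y)) (fst x)"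
  by (simp add: L_form_def split_def)

lemma L_sym:
  assumes "x \<in> Xh M" "y \<in> Xh M" shows "L_form M x y = L_form M y x"
  using semi_form.sym[OF semi_form_a, of "fst x" "fst y"] assms by (simp add: L_eq Xh_iff)

lemma L_lin:
  assumes x: "x \<in> Xh M" shows "lin_on (Xh M) (L_form M x)"
proof -
  interpret A: semi_form "Wh M" "a_form M" by (rule semi_form_a)
  interpret D: semi_form "Wh M" "aD_form M" by (rule semi_form_aD)
  have w: "fst x \<in> Wh M" "Dh M (snd x) \<in> Wh M" using x Dh_mem by (simp_all add: Xh_iff)
  show ?thesis
    unfolding L_eq[abs_def]
    by (rule lin_onI) (simp_all add: Xh_iff w A.expand D.expand Dh_add Dh_scale Dh_mem algebra_simps)
qed

text \<open>The sign of the pressure test function differs between the block operator and \<open>L\<close>.\<close>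

definition flip :: "('a, 'i, 'j) xvec \<Rightarrow> ('a, 'i, 'j) xvec" where
  "flip x = (fst x, (-1) *\<^sub>R snd x)"

lemma flip_mem: "x \<in> Xh M \<Longrightarrow> flip x \<in> Xh M"
  unfolding Xh_iff flip_def fst_conv snd_conv using subspace_scale[OF subspace_Qh] by blast

lemma flip_flip: "flip (flip x) = x"
  by (simp add: flip_def)

lemma ipX_flip: "x \<in> Xh M \<Longrightarrow> ipX (flip x) (flip x) = ipX x x"
proof -
  assume x: "x \<in> Xh M"
  interpret D: semi_form "Wh M" "aD_form M" by (rule semi_form_aD)
  have q: "snd x \<in> Qh M" using x by (simp add: Xh_iff)
  note w = Dh_mem[OF q]
  have "aD_form M ((-1) *\<^sub>R Dh M (snd x)) ((-1) *\<^sub>R Dh M (snd x)) = (-1) * ((-1) * aD_form M (Dh M (snd x)) (Dh M (snd x)))"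
    by (simp only: D.scale_l[OF D.in_sub(2)[OF w] w] D.scale_r[OF w w])
  then show ?thesis unfolding ipX_def flip_def fst_conv snd_conv Dh_scale[OF q] by simp
qed

lemma bij_DA: "bij_betw (DA_op M) (Wh M) (dual_space (Wh M))"
  using inner_form.riesz_bij[OF inner_form_aD fin_coord_Wh] unfolding DA_op_def[abs_def] .

lemma BT_op_eq: "q \<in> Qh M \<Longrightarrow> BT_op M q = DA_op M (Dh M q)"
  by (simp add: BT_op_def DA_op_def B_op_def on_space_def fun_eq_iff Dh_eq)

lemma DA_inv_BT: "q \<in> Qh M \<Longrightarrow> DA_inv M (BT_op M q) = Dh M q"
  unfolding DA_inv_def BT_op_eq
  by (rule inv_into_f_f[OF bij_betw_imp_inj_on[OF bij_DA] Dh_mem])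

text \<open>The lower block is the Schur complement \<open>B D\<^sub>A\<^sup>-\<^sup>1 B\<^sup>T\<close>, written as a form in the discrete
gradients. Hence the operator is the Riesz map of \<open>ipX\<close>.\<close>

lemma diag_block_eq:
  assumes "x \<in> Xh M"
  shows "diag_block M x = (on_space (Wh M) (a_form M (fst x)),
     on_space (Qh M) (\<lambda>q. aD_form M (Dh M (snd x)) (Dh M q)))"
proof -
  have q: "snd x \<in> Qh M" using assms by (simp add: Xh_iff)
  have "B_op M (Dh M (snd x)) = on_space (Qh M) (\<lambda>q. aD_form M (Dh M (snd x)) (Dh M q))"
  proof
    fix q'
    show "B_op M (Dh M (snd x)) q' = on_space (Qh M) (\<lambda>q. aD_form M (Dh M (snd x)) (Dh M q)) q'"
      using Dh_eq[of q' "Dh M (snd x)"] semi_form.sym[OF semi_form_aD Dh_mem[OF q] Dh_mem, of q'] Dh_mem[OF q]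
      by (simp add: B_op_def on_space_def)
  qed
  then show ?thesis by (simp add: diag_block_def split_def A_op_def DA_inv_BT[OF q])
qed

lemma A_block_eq:
  assumes "x \<in> Xh M"
  shows "A_block M x = (on_space (Wh M) (\<lambda>r. a_form M (fst x) r + aD_form M (Dh M (snd x)) r),
     on_space (Qh M) (\<lambda>q. - aD_form M (Dh M q) (fst x)))"
proof -
  have q: "snd x \<in> Qh M" "fst x \<in> Wh M" using assms by (simp_all add: Xh_iff)
  have "A_op M (fst x) + BT_op M (snd x) = on_space (Wh M) (\<lambda>r. a_form M (fst x) r + aD_form M (Dh M (snd x)) r)"
    by (rule ext) (simp add: A_op_def BT_op_eq[OF q(1)] DA_op_def on_space_def)
  moreover have "- B_op M (fst x) = on_space (Qh M) (\<lambda>q. - aD_form M (Dh M q) (fst x))"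
    by (rule ext) (use q Dh_eq in \<open>simp add: B_op_def on_space_def\<close>)
  ultimately show ?thesis by (simp add: A_block_def split_def)
qed

lemma A_block_dual:
  assumes x: "x \<in> Xh M" shows "A_block M x \<in> dual_space (Wh M) \<times> dual_space (Qh M)"
proof -
  interpret A: semi_form "Wh M" "a_form M" by (rule semi_form_a)
  interpret D: semi_form "Wh M" "aD_form M" by (rule semi_form_aD)
  have w: "fst x \<in> Wh M" "Dh M (snd x) \<in> Wh M" using x Dh_mem by (simp_all add: Xh_iff)
  have 1: "lin_on (Wh M) (\<lambda>r. a_form M (fst x) r + aD_form M (Dh M (snd x)) r)"
    by (rule lin_on_plus[OF A.lin[OF w(1)] D.lin[OF w(2)]])
  have 2: "lin_on (Qh M) (\<lambda>q. - aD_form M (Dh M q) (fst x))"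
    by (rule lin_onI) (simp_all add: Dh_add Dh_scale Dh_mem D.expand w)
  show ?thesis
    unfolding A_block_eq[OF x]
    by (intro SigmaI on_space_in_dual[OF subspace_Wh 1] on_space_in_dual[OF subspace_Qh 2])
qed

end

section \<open>The preconditioned operator\<close>

locale stable_medium = discretized_medium M \<sigma>
  for M :: "('a::euclidean_space, 'i, 'j) medium" and \<sigma> +
  fixes \<alpha> \<beta> :: real
  assumes \<alpha>: "\<alpha> > 0" and \<beta>: "\<beta> > 0"
    and continuity: "\<forall>x\<in>Xh M. \<forall>y\<in>Xh M. \<bar>L_form M x y\<bar> \<le> \<alpha> * tnorm M x * tnorm M y"
    and inf_sup: "(INF y\<in>Xh M - {0}. SUP x\<in>Xh M - {0}. L_form M x y / (tnorm M x * tnorm M y)) \<ge> \<beta>"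
begin

lemma tnorm_nonneg: "x \<in> Xh M \<Longrightarrow> 0 \<le> tnorm M x"
  unfolding tnorm_eq using semi_form.nonneg[OF semi_form_ipX] by simp

text \<open>If a norm vanishes the quotient is \<open>0\<close> by the convention for division by zero.\<close>

lemma quotient_bound:
  assumes "x \<in> Xh M" "y \<in> Xh M"
  shows "\<bar>L_form M x y / (tnorm M x * tnorm M y)\<bar> \<le> \<alpha>"
proof (cases "tnorm M x * tnorm M y = 0")
  case True
  then show ?thesis using \<alpha> by (simp only: div_by_0 abs_zero less_imp_le)
next
  case False
  then have p: "0 < tnorm M x * tnorm M y" using tnorm_nonneg assms by (simp add: less_le)
  have "\<bar>L_form M x y\<bar> \<le> \<alpha> * (tnorm M x * tnorm M y)" using continuity assms by (simp add: mult.assoc)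
  moreover have "\<bar>L_form M x y / (tnorm M x * tnorm M y)\<bar> = \<bar>L_form M x y\<bar> / (tnorm M x * tnorm M y)"
    unfolding abs_divide using p by (simp only: abs_of_pos)
  ultimately show ?thesis using p by (simp only: pos_divide_le_eq)
qed

text \<open>Infimum and supremum of real sets say something only for bounded sets; here continuity provides the
bounds.\<close>

lemma beta_le_sup:
  assumes y: "y \<in> Xh M - {0}"
  shows "\<beta> \<le> (SUP x\<in>Xh M - {0}. L_form M x y / (tnorm M x * tnorm M y))"
proof -
  have lower: "- \<alpha> \<le> (SUP x\<in>Xh M - {0}. L_form M x z / (tnorm M x * tnorm M z))" if z: "z \<in> Xh M - {0}" for z
  proof (rule cSUP_upper2[OF _ z])
    have q: "\<bar>L_form M x z / (tnorm M x * tnorm M z)\<bar> \<le> \<alpha>" if "x \<in> Xh M - {0}" for x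
      using quotient_bound that z by blast
    show "bdd_above ((\<lambda>x. L_form M x z / (tnorm M x * tnorm M z)) ` (Xh M - {0}))"
      by (rule bdd_aboveI2[of _ _ \<alpha>]) (use q in \<open>simp only: abs_le_iff\<close>)
    show "- \<alpha> \<le> L_form M z z / (tnorm M z * tnorm M z)" using q[OF z] by linarith
  qed
  show ?thesis
    by (rule order_trans[OF inf_sup cINF_lower[OF bdd_belowI2[of _ "- \<alpha>"] y]]) (rule lower)
qed

text \<open>If \<open>y\<close> is nonzero but has norm zero, all quotients for \<open>y\<close> are \<open>0\<close>, and so is their supremum;
this contradicts \<open>\<beta> > 0\<close>.\<close>

lemma inner_form_ipX: "inner_form (Xh M) ipX"
proof (intro inner_form.intro semi_form_ipX inner_form_axioms.intro)
  fix y assume y: "y \<in> Xh M" and z: "ipX y y = 0"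
  show "y = 0"
  proof (rule ccontr)
    assume "y \<noteq> 0"
    then have y0: "y \<in> Xh M - {0}" using y by simp
    have "tnorm M y = 0" unfolding tnorm_eq using z by simp
    then have "(SUP x\<in>Xh M - {0}. L_form M x y / (tnorm M x * tnorm M y)) = (SUP x\<in>Xh M - {0}. 0)" by simp
    also have "\<dots> = 0" by (rule cSUP_const) (use y0 in blast)
    finally show False using beta_le_sup[OF y0] \<beta> by simp
  qed
qed

lemma Dh_zero: "Dh M 0 = 0"
  using Dh_scale[OF subspace_0[OF subspace_Qh], of 0] by simp

lemma inner_form_a: "inner_form (Wh M) (a_form M)"
proof (intro inner_form.intro semi_form_a inner_form_axioms.intro)
  fix w assume w: "w \<in> Wh M" "a_form M w w = 0"
  have "ipX (w, 0) (w, 0) = 0"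
    using w(2) semi_form.zero_r[OF semi_form_aD subspace_0[OF subspace_Wh]] by (simp add: ipX_def Dh_zero)
  moreover have "(w, 0) \<in> Xh M" using w subspace_0[OF subspace_Qh] by (simp add: Xh_iff)
  ultimately have "(w, 0) = (0 :: ('a, 'i, 'j) xvec)" using inner_form.definite[OF inner_form_ipX] by blast
  then show "w = 0" by (simp add: prod_eq_iff)
qed

text \<open>Equivalent to injectivity of \<open>B\<^sup>T\<close> on the discrete pressures.\<close>

lemma inner_form_schur: "inner_form (Qh M) (\<lambda>p q. aD_form M (Dh M p) (Dh M q))"
proof (intro inner_form.intro inner_form_axioms.intro)
  show "semi_form (Qh M) (\<lambda>p q. aD_form M (Dh M p) (Dh M q))"
    by (rule semi_form_pullback[OF semi_form_aD subspace_Qh]) (simp_all add: Dh_mem Dh_add Dh_scale)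
  fix q assume q: "q \<in> Qh M" "aD_form M (Dh M q) (Dh M q) = 0"
  have "ipX (0, q) (0, q) = 0"
    using q(2) semi_form.zero_r[OF semi_form_a subspace_0[OF subspace_Wh]] by (simp add: ipX_def)
  moreover have "(0, q) \<in> Xh M" using q subspace_0[OF subspace_Wh] by (simp add: Xh_iff)
  ultimately have "(0, q) = (0 :: ('a, 'i, 'j) xvec)" using inner_form.definite[OF inner_form_ipX] by blast
  then show "q = 0" by (simp add: prod_eq_iff)
qed

lemma bij_diag: "bij_betw (diag_block M) (Xh M) (dual_space (Wh M) \<times> dual_space (Qh M))"
proof -
  have "bij_betw (map_prod (\<lambda>w. on_space (Wh M) (a_form M w)) (\<lambda>p. on_space (Qh M) (\<lambda>q. aD_form M (Dh M p) (Dh M q))))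
      (Wh M \<times> Qh M) (dual_space (Wh M) \<times> dual_space (Qh M))"
    by (rule bij_betw_map_prod[OF inner_form.riesz_bij[OF inner_form_a fin_coord_Wh]
          inner_form.riesz_bij[OF inner_form_schur fin_coord_Qh]])
  then show ?thesis
    unfolding Xh_def[symmetric]
    by (rule bij_betw_cong[THEN iffD1, rotated]) (simp add: diag_block_eq map_prod_def split_def)
qed

definition precond_op where "precond_op = B_D M \<circ> A_block M"

lemma precond_op_mem: "x \<in> Xh M \<Longrightarrow> precond_op x \<in> Xh M"
  and diag_precond_op: "x \<in> Xh M \<Longrightarrow> diag_block M (precond_op x) = A_block M x"
proof -
  assume "x \<in> Xh M"
  then have "A_block M x \<in> diag_block M ` Xh M"
    unfolding bij_betw_imp_surj_on[OF bij_diag] by (rule A_block_dual)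
  then show "precond_op x \<in> Xh M" "diag_block M (precond_op x) = A_block M x"
    unfolding precond_op_def B_D_def comp_apply by (rule inv_into_into, rule f_inv_into_f)
qed

text \<open>The identity behind the theorem: up to the pressure flip, the form \<open>L\<close> represents the preconditioned
operator with respect to the inner product of the norm.\<close>

lemma precond_op_form:
  assumes x: "x \<in> Xh M" and y: "y \<in> Xh M" shows "ipX (precond_op x) y = L_form M x (flip y)"
proof -
  interpret A: semi_form "Wh M" "a_form M" by (rule semi_form_a)
  interpret D: semi_form "Wh M" "aD_form M" by (rule semi_form_aD)
  have y': "fst y \<in> Wh M" "snd y \<in> Qh M" and x': "fst x \<in> Wh M" using x y by (simp_all add: Xh_iff)
  note eq = diag_precond_op[OF x, unfolded diag_block_eq[OF precond_op_mem[OF x]] A_block_eq[OF x]]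
  have "on_space (Wh M) (a_form M (fst (precond_op x))) (fst y) =
      on_space (Wh M) (\<lambda>r. a_form M (fst x) r + aD_form M (Dh M (snd x)) r) (fst y)"
    using eq by simp
  then have 1: "a_form M (fst (precond_op x)) (fst y) = a_form M (fst x) (fst y) + aD_form M (Dh M (snd x)) (fst y)"
    using y' by (simp add: on_space_def)
  have "on_space (Qh M) (\<lambda>q. aD_form M (Dh M (snd (precond_op x))) (Dh M q)) (snd y) =
      on_space (Qh M) (\<lambda>q. - aD_form M (Dh M q) (fst x)) (snd y)"
    using eq by simp
  then have 2: "aD_form M (Dh M (snd (precond_op x))) (Dh M (snd y)) = - aD_form M (Dh M (snd y)) (fst x)"
    using y' by (simp add: on_space_def)
  have 3: "aD_form M (Dh M ((-1) *\<^sub>R snd y)) (fst x) = - aD_form M (Dh M (snd y)) (fst x)"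
    unfolding Dh_scale[OF y'(2)] D.scale_l[OF x' Dh_mem[OF y'(2)]] by simp
  show ?thesis unfolding ipX_def L_eq flip_def fst_conv snd_conv 1 2 3 by simp
qed

sublocale X: inner_form "Xh M" ipX by (rule inner_form_ipX)

lemma tnorm_sq: "x \<in> Xh M \<Longrightarrow> tnorm M x * tnorm M x = ipX x x"
  unfolding tnorm_eq by (simp add: X.nonneg)

lemma tnorm_zero_iff: "x \<in> Xh M \<Longrightarrow> tnorm M x = 0 \<longleftrightarrow> x = 0"
  unfolding tnorm_eq using X.definite[of x] X.zero_r[OF X.in_sub(4)] by auto

lemma tnorm_flip: "x \<in> Xh M \<Longrightarrow> tnorm M (flip x) = tnorm M x"
  by (simp add: tnorm_eq ipX_flip)

lemma precond_op_upper:
  assumes x: "x \<in> Xh M" shows "tnorm M (precond_op x) \<le> \<alpha> * tnorm M x"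
proof (cases "tnorm M (precond_op x) = 0")
  case True
  then show ?thesis using \<alpha> tnorm_nonneg[OF x] by simp
next
  case False
  then have p: "0 < tnorm M (precond_op x)" using tnorm_nonneg[OF precond_op_mem[OF x]] by simp
  have "tnorm M (precond_op x) * tnorm M (precond_op x) = L_form M x (flip (precond_op x))"
    using tnorm_sq[OF precond_op_mem[OF x]] precond_op_form[OF x precond_op_mem[OF x]] by simp
  also have "\<dots> \<le> \<alpha> * tnorm M x * tnorm M (flip (precond_op x))"
    using continuity[THEN bspec, OF x, THEN bspec, OF flip_mem[OF precond_op_mem[OF x]]] by linarith
  also have "\<dots> = \<alpha> * tnorm M x * tnorm M (precond_op x)" using tnorm_flip[OF precond_op_mem[OF x]] by simp
  finally show ?thesis using p by simp
qed

text \<open>By symmetry of \<open>L\<close> the supremum in the inf-sup condition, taken over the first argument, is a dual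
norm of \<open>precond_op y\<close>.\<close>

lemma precond_op_lower:
  assumes y: "y \<in> Xh M" shows "\<beta> * tnorm M y \<le> tnorm M (precond_op y)"
proof (cases "y = 0")
  case True
  then have "tnorm M y = 0" using tnorm_zero_iff[OF y] by simp
  then show ?thesis using tnorm_nonneg[OF precond_op_mem[OF y]] by simp
next
  case False
  have ty: "0 < tnorm M y" using tnorm_zero_iff[OF y] tnorm_nonneg[OF y] False by simp
  have "\<beta> \<le> (SUP x\<in>Xh M - {0}. L_form M x y / (tnorm M x * tnorm M y))"
    using beta_le_sup y False by simp
  also have "\<dots> \<le> tnorm M (precond_op y) / tnorm M y"
  proof (rule cSUP_least)
    show "Xh M - {0} \<noteq> {}" using y False by blast
    fix x assume x: "x \<in> Xh M - {0}"
    then have xX: "x \<in> Xh M" by simp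
    have tx: "0 < tnorm M x" using tnorm_zero_iff[OF xX] tnorm_nonneg[OF xX] x by simp
    have "L_form M x y = ipX (precond_op y) (flip x)"
      using L_sym[OF xX y] precond_op_form[OF y flip_mem[OF xX]] by (simp add: flip_flip)
    also have "\<dots> \<le> \<bar>ipX (precond_op y) (flip x)\<bar>" by simp
    also have "\<dots> \<le> tnorm M (precond_op y) * tnorm M x"
      using X.Cauchy_Schwarz[OF precond_op_mem[OF y] flip_mem[OF xX]] tnorm_flip[OF xX] by (simp add: tnorm_eq)
    finally show "L_form M x y / (tnorm M x * tnorm M y) \<le> tnorm M (precond_op y) / tnorm M y"
      using tx ty by (simp add: field_simps)
  qed
  finally show ?thesis using ty by (simp add: field_simps)
qed

lemma precond_op_add: "x \<in> Xh M \<Longrightarrow> y \<in> Xh M \<Longrightarrow> precond_op (x + y) = precond_op x + precond_op y"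
proof -
  assume x: "x \<in> Xh M" and y: "y \<in> Xh M"
  note xy = X.in_sub(1)[OF x y]
  show ?thesis
  proof (rule X.eqI[OF precond_op_mem[OF xy] X.in_sub(1)[OF precond_op_mem[OF x] precond_op_mem[OF y]]])
    fix z assume z: "z \<in> Xh M"
    note f = flip_mem[OF z]
    have "ipX (precond_op (x + y)) z = L_form M (flip z) (x + y)" using precond_op_form[OF xy z] L_sym[OF xy f] by simp
    also have "\<dots> = L_form M (flip z) x + L_form M (flip z) y" by (rule lin_on_add[OF L_lin[OF f] x y])
    also have "\<dots> = ipX (precond_op x) z + ipX (precond_op y) z"
      using precond_op_form[OF x z] precond_op_form[OF y z] L_sym[OF x f] L_sym[OF y f] by simp
    also have "\<dots> = ipX (precond_op x + precond_op y) z" using X.add_l[OF z precond_op_mem[OF x] precond_op_mem[OF y]] by simp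
    finally show "ipX (precond_op (x + y)) z = ipX (precond_op x + precond_op y) z" .
  qed
qed

lemma precond_op_scale: "x \<in> Xh M \<Longrightarrow> precond_op (c *\<^sub>R x) = c *\<^sub>R precond_op x"
proof -
  assume x: "x \<in> Xh M"
  note cx = X.in_sub(2)[OF x, of c]
  show ?thesis
  proof (rule X.eqI[OF precond_op_mem[OF cx] X.in_sub(2)[OF precond_op_mem[OF x]]])
    fix z assume z: "z \<in> Xh M"
    note f = flip_mem[OF z]
    have "ipX (precond_op (c *\<^sub>R x)) z = L_form M (flip z) (c *\<^sub>R x)" using precond_op_form[OF cx z] L_sym[OF cx f] by simp
    also have "\<dots> = c * L_form M (flip z) x" by (rule lin_on_scale[OF L_lin[OF f] x])
    also have "\<dots> = c * ipX (precond_op x) z" using precond_op_form[OF x z] L_sym[OF x f] by simp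
    also have "\<dots> = ipX (c *\<^sub>R precond_op x) z" using X.scale_l[OF z precond_op_mem[OF x]] by simp
    finally show "ipX (precond_op (c *\<^sub>R x)) z = ipX (c *\<^sub>R precond_op x) z" .
  qed
qed

lemma precond_op_zeroD: "x \<in> Xh M \<Longrightarrow> ipX (precond_op x) (precond_op x) = 0 \<Longrightarrow> x = 0"
proof -
  assume x: "x \<in> Xh M" and z: "ipX (precond_op x) (precond_op x) = 0"
  have "\<beta> * tnorm M x \<le> 0" using precond_op_lower[OF x] z by (simp add: tnorm_eq)
  then have "tnorm M x \<le> 0" using \<beta> by (simp add: mult_le_0_iff)
  then have "tnorm M x = 0" using tnorm_nonneg[OF x] by simp
  then show "x = 0" using tnorm_zero_iff[OF x] by simp
qed

text \<open>For surjectivity let \<open>precond_op x\<close> be the projection of \<open>z\<close> onto the range and \<open>e\<close> the error. It is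
orthogonal to the range, that is, the adjoint annihilates it. The adjoint is \<open>flip \<circ> precond_op \<circ> flip\<close>,
which is injective, so \<open>e = 0\<close>.\<close>

lemma bij_precond_op: "bij_betw precond_op (Xh M) (Xh M)"
proof (rule bij_betw_imageI)
  show "inj_on precond_op (Xh M)"
  proof (rule inj_onI)
    fix x y assume x: "x \<in> Xh M" and y: "y \<in> Xh M" and eq: "precond_op x = precond_op y"
    have m: "(-1) *\<^sub>R y \<in> Xh M" by (rule X.in_sub(2)[OF y])
    have "precond_op (x + (-1) *\<^sub>R y) = precond_op x + (-1) *\<^sub>R precond_op y" by (simp only: precond_op_add[OF x m] precond_op_scale[OF y])
    also have "\<dots> = 0" using eq by simp
    finally have "precond_op (x + (-1) *\<^sub>R y) = 0" .
    then have "ipX (precond_op (x + (-1) *\<^sub>R y)) (precond_op (x + (-1) *\<^sub>R y)) = 0"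
      using X.zero_r[OF X.in_sub(4)] by simp
    then have "x + (-1) *\<^sub>R y = 0" by (rule precond_op_zeroD[OF X.in_sub(1)[OF x m]])
    then show "x = y" by simp
  qed
  have "inner_form (Xh M) (\<lambda>x y. ipX (precond_op x) (precond_op y))"
  proof (intro inner_form.intro inner_form_axioms.intro precond_op_zeroD)
    show "semi_form (Xh M) (\<lambda>x y. ipX (precond_op x) (precond_op y))"
      by (rule semi_form_pullback[OF semi_form_ipX subspace_Xh precond_op_mem precond_op_add precond_op_scale])
  qed
  then interpret TT: inner_form "Xh M" "\<lambda>x y. ipX (precond_op x) (precond_op y)" .
  show "precond_op ` Xh M = Xh M"
  proof
    show "precond_op ` Xh M \<subseteq> Xh M" using precond_op_mem by blast
    show "Xh M \<subseteq> precond_op ` Xh M"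
    proof
      fix z assume z: "z \<in> Xh M"
      have "lin_on (Xh M) (\<lambda>y. ipX z (precond_op y))"
        by (rule lin_on_comp[OF X.lin[OF z] precond_op_mem precond_op_add precond_op_scale])
      from TT.riesz[OF fin_coord_Xh this]
      obtain x where x: "x \<in> Xh M" "\<forall>y\<in>Xh M. ipX (precond_op x) (precond_op y) = ipX z (precond_op y)" by blast
      define e where "e = precond_op x - z"
      have e: "e \<in> Xh M" unfolding e_def by (rule X.in_sub(3)[OF precond_op_mem[OF x(1)] z])
      note fe = flip_mem[OF e]
      \<comment> \<open>\<open>y\<close> is the adjoint applied to \<open>e\<close>; orthogonality of \<open>e\<close> to \<open>precond_op y\<close> says that its norm is zero\<close>
      define y where "y = flip (precond_op (flip e))"
      have y: "y \<in> Xh M" unfolding y_def by (rule flip_mem[OF precond_op_mem[OF fe]])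
      have "ipX (precond_op (flip e)) (precond_op (flip e)) = L_form M (flip e) y"
        unfolding y_def by (rule precond_op_form[OF fe precond_op_mem[OF fe]])
      also have "\<dots> = L_form M y (flip e)" by (rule L_sym[OF fe y])
      also have "\<dots> = ipX (precond_op y) e" using precond_op_form[OF y e] by simp
      also have "\<dots> = ipX e (precond_op y)" by (rule X.sym[OF precond_op_mem[OF y] e])
      also have "\<dots> = 0" unfolding e_def using X.diff_l[OF precond_op_mem[OF y] precond_op_mem[OF x(1)] z] x(2) y by simp
      finally have "flip e = 0" by (rule precond_op_zeroD[OF fe])
      then have "tnorm M (flip e) = 0" using tnorm_zero_iff[OF fe] by simp
      then have "e = 0" using tnorm_flip[OF e] tnorm_zero_iff[OF e] by simp
      then have "z = precond_op x" by (simp add: e_def)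
      then show "z \<in> precond_op ` Xh M" using x(1) by (rule image_eqI)
    qed
  qed
qed

lemma op_norm_bound:
  assumes c: "c \<ge> 0" and S: "\<And>x. x \<in> Xh M \<Longrightarrow> tnorm M (S x) \<le> c * tnorm M x"
  shows "op_norm (tnorm M) (Xh M) S \<le> c" "0 \<le> op_norm (tnorm M) (Xh M) S"
proof -
  have b: "tnorm M (S x) / tnorm M x \<le> c" if x: "x \<in> Xh M" for x
  proof (cases "tnorm M x = 0")
    case False
    then have "0 < tnorm M x" using tnorm_nonneg[OF x] by simp
    then show ?thesis using S[OF x] by (simp add: pos_divide_le_eq)
  qed (use c in simp)
  have ne: "0 \<in> Xh M" by (rule X.in_sub(4))
  show "op_norm (tnorm M) (Xh M) S \<le> c"
    unfolding op_norm_def by (rule cSUP_least) (use ne b in auto)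
  have "tnorm M 0 = 0" using tnorm_zero_iff[OF ne] by simp
  then show "0 \<le> op_norm (tnorm M) (Xh M) S"
    unfolding op_norm_def by (intro cSUP_upper2[OF bdd_aboveI2 ne]) (use b in auto)
qed

lemma cond_number_precond_op: "cond_number (tnorm M) (Xh M) precond_op \<le> \<alpha> / \<beta>"
proof -
  have inv: "tnorm M (inv_into (Xh M) precond_op x) \<le> (1 / \<beta>) * tnorm M x" if x: "x \<in> Xh M" for x
  proof -
    have "x \<in> precond_op ` Xh M" using x bij_betw_imp_surj_on[OF bij_precond_op] by simp
    then have "inv_into (Xh M) precond_op x \<in> Xh M" "precond_op (inv_into (Xh M) precond_op x) = x"
      by (rule inv_into_into, rule f_inv_into_f)
    then have "\<beta> * tnorm M (inv_into (Xh M) precond_op x) \<le> tnorm M x" using precond_op_lower by metis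
    then show ?thesis using \<beta> by (simp add: field_simps)
  qed
  have "op_norm (tnorm M) (Xh M) precond_op * op_norm (tnorm M) (Xh M) (inv_into (Xh M) precond_op) \<le> \<alpha> * (1 / \<beta>)"
    by (rule mult_mono[OF op_norm_bound(1)[OF _ precond_op_upper] op_norm_bound(1)[OF _ inv]])
      (use \<alpha> \<beta> op_norm_bound(2)[OF _ inv] in simp_all)
  then show ?thesis by (simp add: cond_number_def)
qed

end

theorem theorem4p4:
  fixes M :: "('a::euclidean_space, 'i, 'j) medium"
    and \<sigma> \<alpha> \<beta> :: real
  assumes "DIM('a) \<in> {2, 3}"
    and "fractured_geometry M"
    and "admissible_parameters M"
    and "admissible_meshes \<sigma> M"
    and "\<alpha> > 0" and "\<beta> > 0"
    and continuity: "\<forall>x\<in>Xh M. \<forall>y\<in>Xh M. \<bar>L_form M x y\<bar> \<le> \<alpha> * tnorm M x * tnorm M y"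
    and inf_sup: "(INF y\<in>Xh M - {0}. SUP x\<in>Xh M - {0}. L_form M x y / (tnorm M x * tnorm M y)) \<ge> \<beta>"
  shows "bij_betw (DA_op M) (Wh M) (dual_space (Wh M)) \<and>
         bij_betw (diag_block M) (Xh M) (dual_space (Wh M) \<times> dual_space (Qh M)) \<and>
         bij_betw (B_D M \<circ> A_block M) (Xh M) (Xh M) \<and>
         cond_number (tnorm M) (Xh M) (B_D M \<circ> A_block M) \<le> \<alpha> / \<beta>"
proof -
  interpret stable_medium M \<sigma> \<alpha> \<beta>
    by unfold_locales (fact assms)+
  show ?thesis
    using bij_DA bij_diag bij_precond_op cond_number_precond_op unfolding precond_op_def by blast
qed

end
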